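(* For every $\varepsilon>0$ there exists an algorithm for the global minimum cut problem that runs in polynomial time (for constant $\varepsilon$), always outputs a vertex set $S$ with $\mathsf{cost}(G,S)\le(2+\varepsilon)\mathsf{OPT}$, and has average sensitivity $n^{O(1/(\varepsilon\mathsf{OPT}))}$.
   Context: Global minimum cut problem: given an undirected graph $G=(V,E)$, $n=|V|$, $m=|E|$, find $\emptyset\subsetneq S\subsetneq V$ minimizing $\mathsf{cost}(G,S)$, the number of edges of $E$ with exactly one endpoint in $S$; $\mathsf{OPT}$ is the minimum value. The output is the vertex set $S$. For a randomized algorithm $\mathcal{A}$ with output distribution $\mathcal{A}(G)$, its average sensitivity at $G$ is $\mathbb{E}_{e\sim E}[d_{\mathrm{EM}}(\mathcal{A}(G),\mathcal{A}(G-e))]$, with $e$ uniform in $E$, $G-e$ the graph with $e$ deleted, and $d_{\mathrm{EM}}$ the earth mover's distance with respect to Hamming distance (size of symmetric difference) between vertex sets. *)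

theory Defs
  imports
    "HOL-Probability.Probability"
    "HOL-Library.Landau_Symbols"
    "HOL-Library.Log_Nat"
    "HOL-Computational_Algebra.Polynomial"
begin

section \<open>Graphs and the global minimum cut problem\<close>

text \<open>A simple undirected graph is given by its number \<open>n\<close> of vertices and its edge set;
  the vertex set is \<open>{..<n}\<close>.\<close>

definition graph :: "nat \<Rightarrow> nat set set \<Rightarrow> bool" where
  "graph n E \<longleftrightarrow> E \<subseteq> {{u, v} | u v. u < n \<and> v < n \<and> u \<noteq> v}"

definition is_cut :: "nat \<Rightarrow> nat set \<Rightarrow> bool" where
  "is_cut n S \<longleftrightarrow> S \<noteq> {} \<and> S \<subset> {..<n}"

definition cut_cost :: "nat set set \<Rightarrow> nat set \<Rightarrow> nat" where
  "cut_cost E S = card {e \<in> E. card (e \<inter> S) = 1}"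

text \<open>Meaningful for \<open>n \<ge> 2\<close> only: otherwise there are no cuts.\<close>

definition OPT :: "nat \<Rightarrow> nat set set \<Rightarrow> nat" where
  "OPT n E = Min (cut_cost E ` {S. is_cut n S})"


section \<open>Average sensitivity\<close>

definition coupling :: "'a pmf \<Rightarrow> 'a pmf \<Rightarrow> ('a \<times> 'a) pmf \<Rightarrow> bool" where
  "coupling p q r \<longleftrightarrow> map_pmf fst r = p \<and> map_pmf snd r = q"

definition hamming :: "nat set \<Rightarrow> nat set \<Rightarrow> nat" where
  "hamming S T = card ((S - T) \<union> (T - S))"

text \<open>Used only for distributions on subsets of a fixed finite set, so that the cost of every
  coupling is finite.\<close>

definition earth_mover :: "nat set pmf \<Rightarrow> nat set pmf \<Rightarrow> real" where
  "earth_mover p q =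
     (INF r \<in> {r. coupling p q r}. measure_pmf.expectation r (\<lambda>(S, T). real (hamming S T)))"

definition avg_sensitivity ::
    "(nat \<Rightarrow> nat set set \<Rightarrow> nat set pmf) \<Rightarrow> nat \<Rightarrow> nat set set \<Rightarrow> real" where
  "avg_sensitivity A n E = (\<Sum>e\<in>E. earth_mover (A n E) (A n (E - {e}))) / real (card E)"


section \<open>Randomized algorithms\<close>

text \<open>
  The machine model is a probabilistic random access machine with the logarithmic cost
  criterion, presented as a structured language. The memory consists of named arrays of natural
  numbers; a program mentions only finitely many names, and a scalar variable is an
  array used at index 0 only. The source of randomness is a fair coin. Every operation is charged
  for the number of bits of the indices and values it handles, so that running times
  agree with those of probabilistic Turing machines up to a polynomial.
\<close>

type_synonym state = "string \<Rightarrow> nat \<Rightarrow> nat"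

datatype binop = Add | Sub | Mul | Div | Less

datatype expr = Const nat | Read string expr | Binop binop expr expr

datatype prog =
    Skip
  | Write string expr expr  \<comment> \<open>array, index, value\<close>
  | Coin string expr  \<comment> \<open>array, index\<close>
  | Seq prog prog
  | Branch expr prog prog
  | While expr prog

fun binop_val :: "binop \<Rightarrow> nat \<Rightarrow> nat \<Rightarrow> nat" where
  "binop_val Add x y = x + y"
| "binop_val Sub x y = x - y"
| "binop_val Mul x y = x * y"
| "binop_val Div x y = x div y"
| "binop_val Less x y = of_bool (x < y)"

primrec expr_val :: "state \<Rightarrow> expr \<Rightarrow> nat" where
  "expr_val s (Const k) = k"
| "expr_val s (Read a e) = s a (expr_val s e)"
| "expr_val s (Binop f e1 e2) = binop_val f (expr_val s e1) (expr_val s e2)"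

text \<open>\<open>floorlog 2 k\<close> is the number of binary digits of \<open>k\<close>.\<close>

primrec expr_time :: "state \<Rightarrow> expr \<Rightarrow> nat" where
  "expr_time s (Const k) = 1 + floorlog 2 k"
| "expr_time s (Read a e) = 1 + expr_time s e + floorlog 2 (expr_val s (Read a e))"
| "expr_time s (Binop f e1 e2) =
     1 + expr_time s e1 + expr_time s e2 + floorlog 2 (expr_val s (Binop f e1 e2))"

definition update :: "state \<Rightarrow> string \<Rightarrow> nat \<Rightarrow> nat \<Rightarrow> state" where
  "update s a i k = s(a := (s a)(i := k))"

text \<open>One step of execution: the remaining program, the time taken, and the new state. The
  terminated program is \<open>Skip\<close>; every other program takes time at least 1 for a step.\<close>

primrec step :: "prog \<Rightarrow> state \<Rightarrow> (prog \<times> nat \<times> state) pmf" where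
  "step Skip s = return_pmf (Skip, 0, s)"
| "step (Write a i e) s =
     return_pmf (Skip, 1 + expr_time s i + expr_time s e, update s a (expr_val s i) (expr_val s e))"
| "step (Coin a i) s =
     map_pmf (\<lambda>b. (Skip, 1 + expr_time s i, update s a (expr_val s i) (of_bool b)))
       (bernoulli_pmf (1/2))"
| "step (Seq c1 c2) s =
     (if c1 = Skip then return_pmf (c2, 1, s)
      else map_pmf (\<lambda>(c1', t, s'). (Seq c1' c2, t, s')) (step c1 s))"
| "step (Branch b c1 c2) s =
     return_pmf (if expr_val s b \<noteq> 0 then c1 else c2, 1 + expr_time s b, s)"
| "step (While b c) s =
     return_pmf (if expr_val s b \<noteq> 0 then Seq c (While b c) else Skip, 1 + expr_time s b, s)"

text \<open>The configuration after a given number of steps, with the total time taken so far.\<close>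

primrec run :: "nat \<Rightarrow> prog \<Rightarrow> state \<Rightarrow> (prog \<times> nat \<times> state) pmf" where
  "run 0 c s = return_pmf (c, 0, s)"
| "run (Suc k) c s =
     bind_pmf (run k c s)
       (\<lambda>(c', t, s'). map_pmf (\<lambda>(c'', t', s''). (c'', t + t', s'')) (step c' s'))"

text \<open>Since a step that is not idle takes time at least 1, termination within time \<open>T\<close> is visible
  after \<open>T\<close> steps. The bound is for the worst case over all outcomes of the coins.\<close>

definition halts_within :: "prog \<Rightarrow> state \<Rightarrow> nat \<Rightarrow> bool" where
  "halts_within c s T \<longleftrightarrow> (\<forall>(c', t, s') \<in> set_pmf (run T c s). c' = Skip \<and> t \<le> T)"

definition final_dist :: "prog \<Rightarrow> state \<Rightarrow> state pmf" where
  "final_dist c s = map_pmf (\<lambda>(_, _, s'). s') (run (LEAST T. halts_within c s T) c s)"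


section \<open>Randomized graph algorithms\<close>

text \<open>Input: the number of vertices and the adjacency matrix, stored row by row; all other cells
  are 0. Output: the set of vertices marked in the array \<open>''out''\<close>.\<close>

definition graph_input :: "nat \<Rightarrow> nat set set \<Rightarrow> state" where
  "graph_input n E = (\<lambda>a k.
     if a = ''n'' \<and> k = 0 then n
     else if a = ''adj'' \<and> k < n * n \<and> {k div n, k mod n} \<in> E then 1
     else 0)"

definition output_set :: "nat \<Rightarrow> state \<Rightarrow> nat set" where
  "output_set n s = {v. v < n \<and> s ''out'' v \<noteq> 0}"

definition alg_dist :: "prog \<Rightarrow> nat \<Rightarrow> nat set set \<Rightarrow> nat set pmf" where
  "alg_dist P n E = map_pmf (output_set n) (final_dist P (graph_input n E))"

definition polynomial_time :: "prog \<Rightarrow> bool" where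
  "polynomial_time P \<longleftrightarrow>
     (\<exists>p :: nat poly. \<forall>n E. graph n E \<longrightarrow> halts_within P (graph_input n E) (poly p n))"

end

theory Submission
  imports Defs "HOL-Library.Nat_Bijection"
begin

text \<open>
  One program serves all \<open>\<epsilon>\<close>, with \<open>g = 1920\<close>. It lists polynomially many cuts, among them all
  cuts of cost at most \<open>2 * OPT\<close>, and draws a cut \<open>S\<close> of cost at most twice the minimum with
  probability proportional to \<open>cost S ^ -L\<close>, where \<open>L\<close> is of order \<open>ln n\<close>.

  Sensitivity: deleting \<open>e\<close> changes only the weights of the cuts that \<open>e\<close> crosses, each by a factor
  at most \<open>\<rho> = (OPT / (OPT - 1)) ^ L = n ^ O(1 / OPT)\<close>, and the cuts that leave or enter the range of
  cost at most \<open>2 * OPT\<close> have negligible probability. Hence the total variation distance is at most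
  about \<open>2 * (\<rho> - 1)\<close> times the probability that \<open>e\<close> crosses the output. On average over \<open>e\<close> this
  probability is at most \<open>2 * OPT / m \<le> 4 / n\<close>, since \<open>OPT * n \<le> 2 * m\<close>, which cancels the maximal
  Hamming distance \<open>n\<close>.

  Enumeration: among \<open>n\<^sup>2\<close> greedily packed spanning trees, an exponential potential argument shows
  that every cut of cost at most \<open>2 * OPT\<close> crosses some tree in at most 7 edges; a spanning tree and
  the set of its edges that cross a cut determine the cut.

  Running time: every value that the program writes is bounded linearly in the values in memory.
  Hence these gain \<open>O(1)\<close> bits per step, and a polynomial bound on the number of steps bounds the
  logarithmic cost.
\<close>

section \<open>Programs and their outcomes\<close>

text \<open>The packed trees, and with them the list of candidates, may change completely when an
  edge is deleted. The sensitivity bound survives because the list is only a means: for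
  \<open>OPT > 0\<close> it contains every cut of cost at most \<open>2 * OPT\<close> up to
  complement, and all other cuts receive weight 0. Up to a small sampling error the law of the
  output thus depends on the graph alone, and two graphs can be compared without looking at their
  enumerations. Since the power law concentrates on cuts of cost below \<open>3/2 * OPT\<close>, the
  threshold \<open>2 * OPT\<close> is harmless, and \<epsilon> never enters the program.

  The machine has only coins and integer arithmetic. Scaling by \<open>fact (n * n) ^ L\<close>
  makes all weights integers without rounding, because costs lie between 1 and \<open>n * n\<close>;
  the uniform draw below a power of 2 then costs an error of \<open>1 / n ^ 4\<close>, small enough
  to survive the factor \<open>n\<close> of the Hamming distance.

  Graphs with \<open>OPT = 0\<close> need separate care: correctness is still required there,
  although the packing argument presupposes a connected graph.\<close>

definition cstep :: "prog \<times> state \<Rightarrow> (prog \<times> state) pmf" where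
  "cstep x = map_pmf (\<lambda>(c, t, s). (c, s)) (step (fst x) (snd x))"

text \<open>The recursion peels off the first step, whereas \<open>run\<close> appends the last one;
  this order suits inductions that follow sequential composition. Time is dropped because
  \<open>run_growth\<close> bounds it separately.\<close>

primrec crun :: "nat \<Rightarrow> prog \<times> state \<Rightarrow> (prog \<times> state) pmf" where
  "crun 0 x = return_pmf x"
| "crun (Suc k) x = bind_pmf (cstep x) (crun k)"

lemma crun_0: "crun 0 = return_pmf"
  by auto

lemma crun_Suc_snoc: "crun (Suc k) x = bind_pmf (crun k x) cstep"
proof (induction k arbitrary: x)
  case 0
  then show ?case by (simp add: bind_return_pmf bind_return_pmf' crun_0)
next
  case (Suc k)
  have "crun (Suc k) = (\<lambda>y. bind_pmf (crun k y) cstep)"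
    using Suc by blast
  then have "crun (Suc (Suc k)) x = bind_pmf (cstep x) (\<lambda>y. bind_pmf (crun k y) cstep)"
    by (simp only: crun.simps(2))
  then show ?case by (simp add: bind_assoc_pmf)
qed

lemma map_run: "map_pmf (\<lambda>(c, t, s). (c, s)) (run k c s) = crun k (c, s)"
proof (induction k)
  case 0
  then show ?case by simp
next
  case (Suc k)
  have "map_pmf (\<lambda>(c, t, s). (c, s)) (run (Suc k) c s) =
      bind_pmf (run k c s) (\<lambda>(c', t, s'). cstep (c', s'))"
    by (auto simp: map_bind_pmf pmf.map_comp cstep_def o_def case_prod_unfold)
  also have "\<dots> = bind_pmf (map_pmf (\<lambda>(c, t, s). (c, s)) (run k c s)) cstep"
    by (simp add: bind_map_pmf case_prod_unfold)
  finally show ?case by (simp only: Suc crun_Suc_snoc)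
qed

lemma cstep_Skip [simp]: "cstep (Skip, s) = return_pmf (Skip, s)"
  by (simp add: cstep_def)

lemma crun_Skip [simp]: "crun k (Skip, s) = return_pmf (Skip, s)"
  by (induction k) (simp_all add: bind_return_pmf)

lemma crun_add: "crun (j + k) x = bind_pmf (crun j x) (crun k)"
proof (induction j arbitrary: x)
  case (Suc j)
  then have "crun (j + k) = (\<lambda>y. bind_pmf (crun j y) (crun k))" by blast
  then show ?case by (simp add: bind_assoc_pmf)
qed (simp add: bind_return_pmf)

lemma crun_terminated:
  assumes "\<forall>y \<in> set_pmf (crun j x). fst y = Skip" "j \<le> k"
  shows "crun k x = crun j x"
proof -
  obtain i where "k = j + i" using assms(2) le_Suc_ex by blast
  then have "crun k x = bind_pmf (crun j x) (crun i)" by (simp add: crun_add)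
  also have "\<dots> = bind_pmf (crun j x) return_pmf"
  proof (rule bind_pmf_cong[OF refl])
    show "crun i y = return_pmf y" if "y \<in> set_pmf (crun j x)" for y
      using that assms(1) by (cases y) auto
  qed
  finally show ?thesis by (simp add: bind_return_pmf')
qed

lemma cstep_Seq:
  "c1 \<noteq> Skip \<Longrightarrow> cstep (Seq c1 c2, s) = map_pmf (\<lambda>(c, s'). (Seq c c2, s')) (cstep (c1, s))"
  by (simp add: cstep_def pmf.map_comp o_def case_prod_unfold)

text \<open>Depending on the coins, \<open>c1\<close> may stop at different moments. The composition
  then enters \<open>c2\<close> early, and the steps left over idle in \<open>Skip\<close>; this is
  why termination of both parts is assumed and \<open>j\<close>, \<open>k\<close> need only be upper
  bounds. The additional step removes the exhausted first component.\<close>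

lemma crun_Seq:
  assumes "\<And>y. y \<in> set_pmf (crun j (c1, s)) \<Longrightarrow> fst y = Skip"
    and "\<And>y z. y \<in> set_pmf (crun j (c1, s)) \<Longrightarrow> z \<in> set_pmf (crun k (c2, snd y)) \<Longrightarrow> fst z = Skip"
  shows "crun (Suc (j + k)) (Seq c1 c2, s) = bind_pmf (crun j (c1, s)) (\<lambda>y. crun k (c2, snd y))"
  using assms
proof (induction j arbitrary: c1 s)
  case 0
  then have c1: "c1 = Skip" by simp
  show ?case unfolding c1 by (simp add: cstep_def bind_return_pmf)
next
  case (Suc j)
  show ?case
  proof (cases "c1 = Skip")
    case True
    have *: "\<forall>z \<in> set_pmf (crun k (c2, s)). fst z = Skip"
      using Suc.prems(2)[of "(Skip, s)"] unfolding True crun_Skip by simp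
    have "cstep (Seq c1 c2, s) = return_pmf (c2, s)"
      unfolding True by (simp add: cstep_def)
    then have "crun (Suc (Suc j + k)) (Seq c1 c2, s) = crun (Suc j + k) (c2, s)"
      by (simp only: crun.simps(2)[of "Suc j + k"] bind_return_pmf)
    also have "\<dots> = crun k (c2, s)" by (rule crun_terminated[OF *]) simp
    finally show ?thesis unfolding True crun_Skip bind_return_pmf snd_conv .
  next
    case False
    have "crun (Suc (Suc j + k)) (Seq c1 c2, s) =
        bind_pmf (cstep (c1, s)) (\<lambda>y. crun (Suc (j + k)) (Seq (fst y) c2, snd y))"
      using False by (simp only: crun.simps(2)[of "Suc (j + k)"] cstep_Seq[OF False] bind_map_pmf case_prod_unfold add_Suc)
    also have "\<dots> = bind_pmf (cstep (c1, s))
        (\<lambda>y. bind_pmf (crun j (fst y, snd y)) (\<lambda>y. crun k (c2, snd y)))"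
    proof (rule bind_pmf_cong[OF refl])
      fix y assume y: "y \<in> set_pmf (cstep (c1, s))"
      then have sub: "z \<in> set_pmf (crun (Suc j) (c1, s))" if "z \<in> set_pmf (crun j (fst y, snd y))" for z
        using that y unfolding crun.simps(2) set_bind_pmf prod.collapse by blast
      show "crun (Suc (j + k)) (Seq (fst y) c2, snd y) =
          bind_pmf (crun j (fst y, snd y)) (\<lambda>y. crun k (c2, snd y))"
      proof (rule Suc.IH)
        show "fst z = Skip" if "z \<in> set_pmf (crun j (fst y, snd y))" for z
          using Suc.prems(1)[OF sub[OF that]] .
        show "fst u = Skip"
          if "z \<in> set_pmf (crun j (fst y, snd y))" "u \<in> set_pmf (crun k (c2, snd z))" for z u
          using Suc.prems(2)[OF sub[OF that(1)] that(2)] .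
      qed
    qed
    finally show ?thesis by (simp only: bind_assoc_pmf crun.simps(2) prod.collapse)
  qed
qed

text \<open>\<open>fin c s K \<mu>\<close>: whatever the coins, \<open>c\<close> stops within \<open>K\<close> steps, in a state distributed as \<open>\<mu>\<close>.\<close>

definition fin :: "prog \<Rightarrow> state \<Rightarrow> nat \<Rightarrow> state pmf \<Rightarrow> bool" where
  "fin c s K \<mu> \<longleftrightarrow> crun K (c, s) = map_pmf (Pair Skip) \<mu>"

lemma fin_mono: "fin c s K \<mu> \<Longrightarrow> K \<le> K' \<Longrightarrow> fin c s K' \<mu>"
  unfolding fin_def using crun_terminated[of K "(c, s)" K'] by auto

lemma fin_Seq:
  assumes "fin c1 s K1 \<mu>" "\<And>s'. s' \<in> set_pmf \<mu> \<Longrightarrow> fin c2 s' K2 (\<nu> s')"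
  shows "fin (Seq c1 c2) s (Suc (K1 + K2)) (bind_pmf \<mu> \<nu>)"
proof -
  have "crun (Suc (K1 + K2)) (Seq c1 c2, s) =
      bind_pmf (crun K1 (c1, s)) (\<lambda>y. crun K2 (c2, snd y))"
  proof (rule crun_Seq)
    show "fst y = Skip" if "y \<in> set_pmf (crun K1 (c1, s))" for y
      using that assms(1) by (auto simp: fin_def)
    show "fst z = Skip" if "y \<in> set_pmf (crun K1 (c1, s))" "z \<in> set_pmf (crun K2 (c2, snd y))" for y z
    proof -
      have "snd y \<in> set_pmf \<mu>" using that(1) assms(1) by (auto simp: fin_def)
      then show ?thesis using that(2) assms(2)[of "snd y"] by (auto simp: fin_def)
    qed
  qed
  also have "\<dots> = bind_pmf \<mu> (\<lambda>s'. crun K2 (c2, s'))"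
    using assms(1) by (simp add: fin_def bind_map_pmf)
  also have "\<dots> = bind_pmf \<mu> (\<lambda>s'. map_pmf (Pair Skip) (\<nu> s'))"
    using assms(2) by (intro bind_pmf_cong) (auto simp: fin_def)
  finally show ?thesis by (simp add: fin_def map_bind_pmf)
qed

lemma fin_step:
  assumes "cstep (c, s) = return_pmf (c', s')" "fin c' s' K \<mu>"
  shows "fin c s (Suc K) \<mu>"
  using assms by (simp add: fin_def bind_return_pmf)

lemma fin_Skip: "fin Skip s K (return_pmf s)"
  by (simp add: fin_def)

lemma fin_Coin:
  "fin (Coin a i) s (Suc 0)
     (map_pmf (\<lambda>b. update s a (expr_val s i) (of_bool b)) (bernoulli_pmf (1/2)))"
proof -
  have "crun (Suc 0) x = cstep x" for x
    unfolding crun.simps(2) crun_0 by (rule bind_return_pmf')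
  then have "crun (Suc 0) (Coin a i, s) = map_pmf (\<lambda>(c, t, s). (c, s)) (step (Coin a i) s)"
    by (simp only: cstep_def fst_conv snd_conv)
  then show ?thesis unfolding fin_def by (simp add: pmf.map_comp o_def del: crun.simps)
qed

section \<open>Frame property and triples for deterministic runs\<close>

primrec writes :: "prog \<Rightarrow> string set" where
  "writes Skip = {}"
| "writes (Write a i e) = {a}"
| "writes (Coin a i) = {a}"
| "writes (Seq c1 c2) = writes c1 \<union> writes c2"
| "writes (Branch b c1 c2) = writes c1 \<union> writes c2"
| "writes (While b c) = writes c"

primrec reads :: "expr \<Rightarrow> string set" where
  "reads (Const k) = {}"
| "reads (Read a e) = insert a (reads e)"
| "reads (Binop f e1 e2) = reads e1 \<union> reads e2"

lemma expr_val_cong: "(\<And>a. a \<in> reads e \<Longrightarrow> s a = s' a) \<Longrightarrow> expr_val s e = expr_val s' e"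
  by (induction e) auto

lemma cstep_frame:
  "(c', s') \<in> set_pmf (cstep (c, s)) \<Longrightarrow> writes c' \<subseteq> writes c \<and> (\<forall>a. a \<notin> writes c \<longrightarrow> s' a = s a)"
proof (induction c arbitrary: c' s')
  case (Seq c1 c2)
  show ?case
  proof (cases "c1 = Skip")
    case True
    then show ?thesis using Seq.prems by (auto simp: cstep_def)
  next
    case False
    then obtain d where "c' = Seq d c2" "(d, s') \<in> set_pmf (cstep (c1, s))"
      using Seq.prems by (auto simp: cstep_Seq)
    then show ?thesis using Seq.IH(1)[of d s'] by auto
  qed
qed (auto simp: cstep_def update_def split: if_splits)

lemma crun_frame:
  "(c', s') \<in> set_pmf (crun K (c, s)) \<Longrightarrow> a \<notin> writes c \<Longrightarrow> s' a = s a"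
proof (induction K arbitrary: c s)
  case (Suc K)
  from Suc.prems(1) obtain d t where "(d, t) \<in> set_pmf (cstep (c, s))" "(c', s') \<in> set_pmf (crun K (d, t))"
    by auto
  note dt = this
  have "a \<notin> writes d" "t a = s a" using cstep_frame[OF dt(1)] Suc.prems(2) by blast+
  then show ?case using Suc.IH[OF dt(2)] by simp
qed auto

text \<open>A total correctness triple for runs whose outcome does not depend on chance: a step
  bound, a single final state, and the frame condition, which spares every invariant from listing
  the arrays that are left alone.\<close>

definition tr :: "prog \<Rightarrow> state \<Rightarrow> nat \<Rightarrow> (state \<Rightarrow> bool) \<Rightarrow> bool" where
  "tr c s K Q \<longleftrightarrow>
     (\<exists>s'. fin c s K (return_pmf s') \<and> (\<forall>a. a \<notin> writes c \<longrightarrow> s' a = s a) \<and> Q s')"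

lemma trI:
  assumes "fin c s K (return_pmf s')" "Q s'"
  shows "tr c s K Q"
proof -
  have "(Skip, s') \<in> set_pmf (crun K (c, s))" using assms(1) by (simp add: fin_def)
  then have "\<forall>a. a \<notin> writes c \<longrightarrow> s' a = s a" using crun_frame by blast
  with assms have "fin c s K (return_pmf s') \<and> (\<forall>a. a \<notin> writes c \<longrightarrow> s' a = s a) \<and> Q s'"
    by simp
  then show ?thesis unfolding tr_def by - (rule exI[of _ s'])
qed

lemma tr_conseq:
  assumes "tr c s K Q" "K \<le> K'"
    "\<And>s'. \<forall>a. a \<notin> writes c \<longrightarrow> s' a = s a \<Longrightarrow> Q s' \<Longrightarrow> Q' s'"
  shows "tr c s K' Q'"
proof -
  obtain s' where "fin c s K (return_pmf s')" "\<forall>a. a \<notin> writes c \<longrightarrow> s' a = s a" "Q s'"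
    using assms(1) unfolding tr_def by blast
  then have "fin c s K' (return_pmf s') \<and> (\<forall>a. a \<notin> writes c \<longrightarrow> s' a = s a) \<and> Q' s'"
    using fin_mono[OF _ assms(2)] assms(3) by simp
  then show ?thesis unfolding tr_def by - (rule exI[of _ s'])
qed

lemma tr_Write:
  assumes "Q (update s a (expr_val s i) (expr_val s e))" "1 \<le> K"
  shows "tr (Write a i e) s K Q"
proof -
  have "fin (Write a i e) s (Suc 0) (return_pmf (update s a (expr_val s i) (expr_val s e)))"
    by (rule fin_step[OF _ fin_Skip]) (simp add: cstep_def)
  then have "fin (Write a i e) s K (return_pmf (update s a (expr_val s i) (expr_val s e)))"
    using assms(2)[unfolded One_nat_def] by (rule fin_mono)
  then show ?thesis using assms(1) by (rule trI[of _ _ _ _ Q])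
qed

lemma tr_Skip: "Q s \<Longrightarrow> tr Skip s K Q"
  by (rule trI[OF fin_Skip, of Q])

lemma tr_Seq:
  assumes "tr c1 s K1 (\<lambda>s'. tr c2 s' K2 Q)" "Suc (K1 + K2) \<le> K"
  shows "tr (Seq c1 c2) s K Q"
proof -
  obtain s1 where 1: "fin c1 s K1 (return_pmf s1)" "tr c2 s1 K2 Q"
    using assms(1) unfolding tr_def[of c1] by (elim exE conjE)
  obtain s2 where 2: "fin c2 s1 K2 (return_pmf s2)" "Q s2"
    using 1(2) unfolding tr_def by (elim exE conjE)
  have "fin (Seq c1 c2) s (Suc (K1 + K2)) (bind_pmf (return_pmf s1) (\<lambda>_. return_pmf s2))"
    by (rule fin_Seq[OF 1(1)]) (use 2(1) in simp)
  then have "fin (Seq c1 c2) s (Suc (K1 + K2)) (return_pmf s2)"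
    unfolding bind_return_pmf .
  then have "fin (Seq c1 c2) s K (return_pmf s2)"
    using assms(2) by (rule fin_mono)
  then show ?thesis using 2(2) by (rule trI[of _ _ _ s2 Q])
qed

lemma tr_Branch:
  assumes "expr_val s b \<noteq> 0 \<Longrightarrow> tr c1 s K1 Q" "expr_val s b = 0 \<Longrightarrow> tr c2 s K1 Q" "Suc K1 \<le> K"
  shows "tr (Branch b c1 c2) s K Q"
proof -
  have "tr (if expr_val s b \<noteq> 0 then c1 else c2) s K1 Q" using assms by auto
  then obtain s' where "fin (if expr_val s b \<noteq> 0 then c1 else c2) s K1 (return_pmf s')" "Q s'"
    unfolding tr_def by (elim exE conjE)
  note s' = this
  have "fin (Branch b c1 c2) s (Suc K1) (return_pmf s')"
    by (rule fin_step[OF _ s'(1)]) (simp add: cstep_def)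
  then have "fin (Branch b c1 c2) s K (return_pmf s')" using assms(3) by (rule fin_mono)
  then show ?thesis using s'(2) by (rule trI[of _ _ _ s' Q])
qed

definition scalar :: "string \<Rightarrow> expr" where
  "scalar x = Read x (Const 0)"

lemma expr_val_scalar [simp]: "expr_val s (scalar x) = s x 0"
  by (simp add: scalar_def)

lemma reads_scalar [simp]: "reads (scalar x) = {x}"
  by (simp add: scalar_def)

definition For :: "string \<Rightarrow> expr \<Rightarrow> prog \<Rightarrow> prog" where
  "For x b c = Seq (Write x (Const 0) (Const 0))
     (While (Binop Less (scalar x) b) (Seq c (Write x (Const 0) (Binop Add (scalar x) (Const 1)))))"

lemma writes_For [simp]: "writes (For x b c) = insert x (writes c)"
  by (auto simp: For_def)

text \<open>The bound \<open>b\<close> reads nothing that the loop changes, so \<open>m\<close>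
  stays fixed; the invariant must not depend on the counter, whose value is supplied separately. An
  iteration costs \<open>K\<close> steps for the body and 4 for the test, the increment and the two
  compositions.\<close>

lemma tr_For:
  fixes I :: "nat \<Rightarrow> state \<Rightarrow> bool"
  assumes x: "x \<notin> writes c" "reads b \<inter> insert x (writes c) = {}"
    and m: "expr_val s b = m"
    and upd: "\<And>i t v. I i t \<Longrightarrow> I i (update t x 0 v)"
    and init: "I 0 s"
    and body: "\<And>i t. i < m \<Longrightarrow> t x 0 = i \<Longrightarrow> (\<And>a. a \<notin> insert x (writes c) \<Longrightarrow> t a = s a) \<Longrightarrow> I i t \<Longrightarrow>
      tr c t K (I (Suc i))"
    and post: "\<And>t. (\<And>a. a \<notin> insert x (writes c) \<Longrightarrow> t a = s a) \<Longrightarrow> I m t \<Longrightarrow> Q t"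
    and K: "m * (K + 4) + 4 \<le> K'"
  shows "tr (For x b c) s K' Q"
proof -
  let ?inc = "Write x (Const 0) (Binop Add (scalar x) (Const 1))"
  let ?w = "While (Binop Less (scalar x) b) (Seq c ?inc)"
  have loop: "tr ?w t (j * (K + 4) + 1) (I m)"
    if "j + i = m" "t x 0 = i" "\<And>a. a \<notin> insert x (writes c) \<Longrightarrow> t a = s a" "I i t" for i j t
    using that
  proof (induction j arbitrary: i t)
    case 0
    have "expr_val t b = m"
      using m x(2) 0 by (metis disjoint_iff expr_val_cong)
    then show ?case
    proof (intro trI[of _ _ _ t "I m"])
      assume b: "expr_val t b = m"
      have "fin ?w t (Suc 0) (return_pmf t)"
        by (rule fin_step[OF _ fin_Skip]) (use b 0 in \<open>simp add: cstep_def\<close>)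
      then show "fin ?w t (0 * (K + 4) + 1) (return_pmf t)" by simp
      show "I m t" using 0 by simp
    qed
  next
    case (Suc j)
    have b: "expr_val t b = m"
      using m x(2) Suc.prems by (metis disjoint_iff expr_val_cong)
    have "tr c t K (I (Suc i))"
      using Suc.prems by (intro body) auto
    then obtain t' where t': "fin c t K (return_pmf t')" "\<And>a. a \<notin> writes c \<Longrightarrow> t' a = t a" "I (Suc i) t'"
      unfolding tr_def by (elim exE conjE) simp
    let ?t = "update t' x 0 (Suc i)"
    have t'x: "t' x 0 = i" using t'(2)[OF x(1)] Suc.prems(2) by simp
    have "fin ?inc t' (Suc 0) (return_pmf ?t)"
      by (rule fin_step[OF _ fin_Skip]) (simp add: cstep_def t'x)
    then have f1: "fin (Seq c ?inc) t (Suc (K + Suc 0)) (return_pmf ?t)"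
      using fin_Seq[OF t'(1), of ?inc "Suc 0" "\<lambda>_. return_pmf ?t"] by (simp add: bind_return_pmf)
    have "tr ?w ?t (j * (K + 4) + 1) (I m)"
    proof (rule Suc.IH[of "Suc i"])
      show "I (Suc i) ?t" using t'(3) by (rule upd)
      show "?t a = s a" if "a \<notin> insert x (writes c)" for a
        using that t'(2) Suc.prems(3) by (simp add: update_def)
    qed (use Suc.prems(1) in \<open>auto simp: update_def\<close>)
    then obtain u where u: "fin ?w ?t (j * (K + 4) + 1) (return_pmf u)" "I m u"
      unfolding tr_def by (elim exE conjE)
    have f2: "fin (Seq (Seq c ?inc) ?w) t (Suc (Suc (K + Suc 0) + (j * (K + 4) + 1))) (return_pmf u)"
      using fin_Seq[OF f1, of ?w "j * (K + 4) + 1" "\<lambda>_. return_pmf u"] u(1) by (simp add: bind_return_pmf)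
    have "fin ?w t (Suc (Suc (Suc (K + Suc 0) + (j * (K + 4) + 1)))) (return_pmf u)"
      using Suc.prems(1,2) b by (intro fin_step[OF _ f2]) (simp add: cstep_def)
    then have "fin ?w t (Suc j * (K + 4) + 1) (return_pmf u)"
      by (rule fin_mono) simp
    then show ?case by (rule trI[of _ _ _ u "I m"]) (rule u(2))
  qed
  have "tr (For x b c) s (m * (K + 4) + 4) (I m)"
    unfolding For_def
  proof (rule tr_Seq[of _ _ 1 _ "m * (K + 4) + 1"])
    show "tr (Write x (Const 0) (Const 0)) s 1 (\<lambda>s'. tr ?w s' (m * (K + 4) + 1) (I m))"
    proof (rule tr_Write)
      have "I 0 (update s x 0 0)" using init by (rule upd)
      then show "tr ?w (update s x (expr_val s (Const 0)) (expr_val s (Const 0))) (m * (K + 4) + 1) (I m)"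
      proof (intro loop[of m 0])
        show "update s x (expr_val s (Const 0)) (expr_val s (Const 0)) a = s a"
          if "a \<notin> insert x (writes c)" for a
          using that by (simp add: update_def)
      qed (simp_all add: update_def)
    qed (rule order_refl)
  qed simp
  then show ?thesis
  proof (rule tr_conseq[OF _ K])
    fix t assume "\<forall>a. a \<notin> writes (For x b c) \<longrightarrow> t a = s a" "I m t"
    then show "Q t" by (intro post[of t]) simp_all
  qed
qed

section \<open>Bit complexity\<close>

text \<open>Constants count in unary, so that \<open>k \<le> M ^ esize (Const k)\<close> for
  \<open>M \<ge> 2\<close>.\<close>

primrec esize :: "expr \<Rightarrow> nat" where
  "esize (Const k) = Suc k"
| "esize (Read a e) = Suc (esize e)"
| "esize (Binop f e1 e2) = Suc (esize e1 + esize e2)"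

text \<open>A syntactic certificate for a value that is at most \<open>esize e\<close> times a bound
  on the memory entries. Indices, divisors, subtrahends and operands of a comparison are
  unrestricted, since they cannot enlarge the result. Products are excluded: repeated squaring would
  double the bit length in every step.\<close>

primrec linear_expr :: "expr \<Rightarrow> bool" where
  "linear_expr (Const k) = True"
| "linear_expr (Read a e) = True"
| "linear_expr (Binop f e1 e2) =
     (case f of Add \<Rightarrow> linear_expr e1 \<and> linear_expr e2 | Sub \<Rightarrow> linear_expr e1 | Div \<Rightarrow> linear_expr e1
      | Mul \<Rightarrow> False | Less \<Rightarrow> True)"

text \<open>A maximum, not a sum: unfolding a loop duplicates program text but creates no new
  expression, so the bound is inherited by every remaining program.\<close>

primrec psize :: "prog \<Rightarrow> nat" where
  "psize Skip = 0"
| "psize (Write a i e) = max (esize i) (esize e)"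
| "psize (Coin a i) = esize i"
| "psize (Seq c1 c2) = max (psize c1) (psize c2)"
| "psize (Branch b c1 c2) = max (esize b) (max (psize c1) (psize c2))"
| "psize (While b c) = max (esize b) (psize c)"

primrec linear_writes :: "prog \<Rightarrow> bool" where
  "linear_writes Skip = True"
| "linear_writes (Write a i e) = linear_expr e"
| "linear_writes (Coin a i) = True"
| "linear_writes (Seq c1 c2) = (linear_writes c1 \<and> linear_writes c2)"
| "linear_writes (Branch b c1 c2) = (linear_writes c1 \<and> linear_writes c2)"
| "linear_writes (While b c) = linear_writes c"

definition below :: "nat \<Rightarrow> state \<Rightarrow> bool" where
  "below M s \<longleftrightarrow> (\<forall>a k. s a k \<le> M)"

lemma below_mult:
  assumes "below M s" "1 \<le> A"
  shows "below (A * M) s"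
  unfolding below_def
proof (intro allI)
  fix a k
  have "s a k \<le> 1 * M" using assms(1) by (simp add: below_def)
  also have "\<dots> \<le> A * M" using assms(2) by (rule mult_le_mono1)
  finally show "s a k \<le> A * M" .
qed

lemma esize_pos: "0 < esize e"
  by (cases e) auto

text \<open>Indices and guards may contain products, for which only a power bound holds. Its
  logarithm is still at most \<open>esize e\<close> times the bit length of \<open>M\<close>, which
  is all that evaluation time needs.\<close>

lemma expr_val_le_power:
  assumes "below M s" "2 \<le> M"
  shows "expr_val s e \<le> M ^ esize e"
proof (induction e)
  case (Const k)
  have "k \<le> 2 ^ k" by (simp add: less_imp_le)
  also have "\<dots> \<le> M ^ k" using assms(2) by (intro power_mono) auto
  also have "\<dots> \<le> M ^ Suc k" using assms(2) by (intro power_increasing) auto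
  finally show ?case by simp
next
  case (Read a e)
  have "s a (expr_val s e) \<le> M ^ 1" using assms(1) by (simp add: below_def)
  also have "\<dots> \<le> M ^ Suc (esize e)" using assms(2) by (intro power_increasing) auto
  finally show ?case by simp
next
  case (Binop f e1 e2)
  let ?a = "esize e1" and ?b = "esize e2"
  have M: "1 \<le> M" using assms(2) by simp
  have a: "M ^ ?a \<le> M ^ (?a + ?b)" and b: "M ^ ?b \<le> M ^ (?a + ?b)"
    using M by (intro power_increasing; simp)+
  have s: "2 * M ^ (?a + ?b) \<le> M ^ Suc (?a + ?b)" using assms(2) by simp
  have 1: "1 \<le> M ^ (?a + ?b)" using M by simp
  \<comment> \<open>The factor 2 covers sums; the \<open>Suc\<close> in \<open>esize\<close> absorbs
    it, since \<open>M \<ge> 2\<close>.\<close>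
  have "expr_val s (Binop f e1 e2) \<le> 2 * M ^ (?a + ?b)"
  proof (cases f)
    case Mul
    have "expr_val s e1 * expr_val s e2 \<le> M ^ ?a * M ^ ?b"
      using Binop by (rule mult_le_mono)
    then show ?thesis using Mul by (simp add: power_add)
  next
    case Div
    then have "expr_val s (Binop f e1 e2) \<le> expr_val s e1" by simp
    then show ?thesis using Binop(1) a by linarith
  qed (use Binop a b 1 in auto)
  then have "expr_val s (Binop f e1 e2) \<le> M ^ Suc (?a + ?b)" using s by (rule order_trans)
  then show ?case by simp
qed

lemma expr_val_le_mult:
  assumes "below M s" "2 \<le> M"
  shows "linear_expr e \<Longrightarrow> expr_val s e \<le> esize e * M"
proof (induction e)
  case (Const k)
  then show ?case using assms(2) by (simp add: trans_le_add2)
next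
  case (Read a e)
  then show ?case using assms(1) by (simp add: below_def trans_le_add1)
next
  case (Binop f e1 e2)
  show ?case
  proof (cases f)
    case Div
    then have "expr_val s (Binop f e1 e2) \<le> expr_val s e1" by simp
    moreover have "expr_val s e1 \<le> esize e1 * M" using Binop Div by simp
    moreover have "esize e1 * M \<le> esize (Binop f e1 e2) * M" by (rule mult_le_mono1) simp
    ultimately show ?thesis by linarith
  next
    case Less
    then show ?thesis using assms(2) by (simp add: trans_le_add1)
  qed (use Binop in \<open>auto simp: algebra_simps\<close>)
qed

lemma floorlog_le_of_less_power: "x < 2 ^ k \<Longrightarrow> floorlog 2 x \<le> k"
  by (rule floorlog_leI) auto

lemma less_power_floorlog: "x < 2 ^ floorlog 2 x"
  using floorlog_bounds[of x 2] by (cases "x = 0") auto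

lemma floorlog_power_le: "0 < k \<Longrightarrow> floorlog 2 (x ^ k) \<le> k * floorlog 2 x"
proof (rule floorlog_le_of_less_power)
  assume "0 < k"
  have "x ^ k < (2 ^ floorlog 2 x) ^ k"
    using \<open>0 < k\<close> by (intro power_strict_mono less_power_floorlog) auto
  then show "x ^ k < 2 ^ (k * floorlog 2 x)" by (simp add: power_mult[symmetric] mult.commute)
qed

lemma expr_time_le:
  assumes "below M s" "2 \<le> M"
  shows "expr_time s e \<le> esize e * (1 + esize e * floorlog 2 M)"
proof -
  have fl: "floorlog 2 (expr_val s e) \<le> esize e * floorlog 2 M" for e
    using floorlog_mono[OF expr_val_le_power[OF assms, of e], of 2] floorlog_power_le[OF esize_pos[of e], of M]
    by (rule order_trans)
  show ?thesis
  proof (induction e)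
    case (Const k)
    have "expr_time s (Const k) \<le> 1 + esize (Const k) * floorlog 2 M"
      using fl[of "Const k"] by simp
    also have "\<dots> \<le> esize (Const k) * (1 + esize (Const k) * floorlog 2 M)" by simp
    finally show ?case .
  next
    case (Read a e)
    let ?z = "esize e" and ?f = "floorlog 2 M"
    have "expr_time s (Read a e) \<le> 1 + ?z * (1 + ?z * ?f) + Suc ?z * ?f"
      using Read fl[of "Read a e"] by simp
    also have "\<dots> \<le> Suc ?z * (1 + Suc ?z * ?f)" by (simp add: algebra_simps)
    finally show ?case by simp
  next
    case (Binop f e1 e2)
    let ?y = "esize e1" and ?z = "esize e2" and ?f = "floorlog 2 M"
    have "expr_time s (Binop f e1 e2) \<le>
        1 + ?y * (1 + ?y * ?f) + ?z * (1 + ?z * ?f) + Suc (?y + ?z) * ?f"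
      using Binop fl[of "Binop f e1 e2"] by simp
    also have "\<dots> \<le> Suc (?y + ?z) * (1 + Suc (?y + ?z) * ?f)" by (simp add: algebra_simps)
    finally show ?case by simp
  qed
qed

lemma expr_time_le':
  assumes "below M s" "2 \<le> M" "esize e \<le> A"
  shows "expr_time s e \<le> A * (1 + A * floorlog 2 M)"
proof -
  have "esize e * (1 + esize e * floorlog 2 M) \<le> A * (1 + A * floorlog 2 M)"
    using assms(3) by (intro mult_le_mono add_left_mono order_refl)
  with expr_time_le[OF assms(1,2)] show ?thesis by (rule order_trans)
qed

text \<open>The properties \<open>psize c' \<le> A\<close> and \<open>linear_writes c'\<close> are
  returned so that the estimate can be iterated. The factor 2 in the time accounts for the two
  expressions of a \<open>Write\<close>.\<close>

lemma step_growth: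
  assumes "(c', t, s') \<in> set_pmf (step c s)" "below M s" "2 \<le> M" "psize c \<le> A" "1 \<le> A" "linear_writes c"
  shows "psize c' \<le> A \<and> linear_writes c' \<and> below (A * M) s' \<and>
    t \<le> 1 + 2 * (A * (1 + A * floorlog 2 M))"
  using assms
proof (induction c arbitrary: c' s')
  case Skip
  then show ?case using below_mult[OF Skip.prems(2,5)] by simp
next
  case (Write a i e)
  have le: "s b k \<le> A * M" for b k
    using below_mult[OF Write.prems(2,5)] by (simp add: below_def)
  have "expr_val s e \<le> esize e * M"
    using expr_val_le_mult[of M s e] Write.prems by simp
  also have "\<dots> \<le> A * M" using Write.prems(4) by simp
  finally have "below (A * M) (update s a (expr_val s i) (expr_val s e))"
    using le by (auto simp: below_def update_def)
  moreover have "expr_time s i \<le> A * (1 + A * floorlog 2 M)" "expr_time s e \<le> A * (1 + A * floorlog 2 M)"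
    using Write.prems by (intro expr_time_le'; simp)+
  ultimately show ?case using Write.prems by (simp add: below_def)
next
  case (Coin a i)
  have le: "s b k \<le> A * M" for b k
    using below_mult[OF Coin.prems(2,5)] by (simp add: below_def)
  have "1 \<le> A * M" using Coin.prems(3,5) by (simp add: Suc_leI)
  then have "below (A * M) (update s a (expr_val s i) (of_bool b))" for b
    using le by (auto simp: below_def update_def)
  moreover have "expr_time s i \<le> A * (1 + A * floorlog 2 M)"
    using Coin.prems by (intro expr_time_le'; simp)
  ultimately show ?case using Coin.prems by auto
next
  case (Seq c1 c2)
  have le: "below (A * M) s"
    using Seq.prems(2,5) by (rule below_mult)
  show ?case
  proof (cases "c1 = Skip")
    case True
    then show ?thesis using Seq.prems le by auto
  next
    case False
    then obtain d where d: "c' = Seq d c2" "(d, t, s') \<in> set_pmf (step c1 s)"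
      using Seq.prems(1) by auto
    show ?thesis using Seq.IH(1)[OF d(2)] Seq.prems d(1) by simp
  qed
next
  case (Branch b c1 c2)
  have le: "below (A * M) s"
    using Branch.prems(2,5) by (rule below_mult)
  have "expr_time s b \<le> A * (1 + A * floorlog 2 M)"
    using Branch.prems by (intro expr_time_le'; simp)
  then show ?case using Branch.prems le by (auto split: if_splits)
next
  case (While b c)
  have le: "below (A * M) s"
    using While.prems(2,5) by (rule below_mult)
  have "expr_time s b \<le> A * (1 + A * floorlog 2 M)"
    using While.prems by (intro expr_time_le'; simp)
  then show ?case using While.prems le by (auto split: if_splits)
qed

text \<open>Memory values grow by at most a factor \<open>A\<close> per step, hence by a bounded
  number of bits; the time of a single step is therefore at most linear in the number of steps made
  so far.\<close>

lemma run_growth: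
  assumes "below M s" "2 \<le> M" "psize c \<le> A" "1 \<le> A" "linear_writes c"
  shows "(c', t, s') \<in> set_pmf (run k c s) \<Longrightarrow> psize c' \<le> A \<and> linear_writes c' \<and>
    below (A ^ k * M) s' \<and> t \<le> k * (1 + 2 * (A * (1 + A * (k * A + M))))"
proof (induction k arbitrary: c' t s')
  case 0
  then show ?case using assms by simp
next
  case (Suc k)
  then obtain d u r v where 1: "(d, u, r) \<in> set_pmf (run k c s)" "(c', v, s') \<in> set_pmf (step d r)"
    and t: "t = u + v"
    by auto
  let ?B = "\<lambda>k. 1 + 2 * (A * (1 + A * (k * A + M)))"
  have IH: "psize d \<le> A" "linear_writes d" "below (A ^ k * M) r" "u \<le> k * ?B k"
    using Suc.IH[OF 1(1)] by auto
  have "1 \<le> A ^ k" using assms(4) by simp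
  then have M: "2 \<le> A ^ k * M" using assms(2) mult_le_mono[of 1 "A ^ k" 2 M] by simp
  have s: "psize c' \<le> A" "linear_writes c'" "below (A * (A ^ k * M)) s'"
    "v \<le> 1 + 2 * (A * (1 + A * floorlog 2 (A ^ k * M)))"
    using step_growth[OF 1(2) IH(3) M IH(1) assms(4) IH(2)] by auto
  \<comment> \<open>Crude bit lengths \<open>A\<close> and \<open>M\<close> in place of their
    logarithms: \<open>A\<close> is a constant of the program and \<open>M\<close> will be
    \<open>n + 2\<close>.\<close>
  have "A ^ k * M < 2 ^ (k * A + M)"
  proof -
    have "A ^ k \<le> (2 ^ A) ^ k" by (intro power_mono) (simp_all add: less_imp_le)
    also have "\<dots> = 2 ^ (k * A)" by (simp add: power_mult[symmetric] mult.commute)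
    finally have "A ^ k * M \<le> 2 ^ (k * A) * M" by simp
    also have "\<dots> < 2 ^ (k * A) * 2 ^ M" by simp
    finally show ?thesis by (simp add: power_add)
  qed
  then have "floorlog 2 (A ^ k * M) \<le> k * A + M" by (rule floorlog_le_of_less_power)
  then have "v \<le> ?B k" using s(4) by (elim order_trans) (intro add_left_mono mult_le_mono order_refl)
  moreover have "?B k \<le> ?B (Suc k)" by simp
  moreover have "k * ?B k \<le> k * ?B (Suc k)" by (rule mult_le_mono2[OF \<open>?B k \<le> ?B (Suc k)\<close>])
  ultimately have "t \<le> k * ?B (Suc k) + ?B (Suc k)" using IH(4) t by linarith
  then show ?case using s by (simp add: algebra_simps)
qed

section \<open>From bounds on steps to polynomial running time\<close>

lemma run_terminated:
  assumes "\<forall>(c', t, s') \<in> set_pmf (run K c s). c' = Skip"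
  shows "run (K + j) c s = run K c s"
proof (induction j)
  case (Suc j)
  have "run (K + Suc j) c s = bind_pmf (run K c s)
      (\<lambda>(c', t, s'). map_pmf (\<lambda>(c'', t', s''). (c'', t + t', s'')) (step c' s'))"
    using Suc by simp
  also have "\<dots> = bind_pmf (run K c s) return_pmf"
  proof (rule bind_pmf_cong[OF refl])
    fix x assume "x \<in> set_pmf (run K c s)"
    then show "(case x of (c', t, s') \<Rightarrow>
        map_pmf (\<lambda>(c'', t', s''). (c'', t + t', s'')) (step c' s')) = return_pmf x"
      using assms by (cases x) auto
  qed
  finally show ?case by (simp only: bind_return_pmf')
qed simp

lemma crun_all_Skip:
  "(\<forall>y \<in> set_pmf (crun K (c, s)). fst y = Skip) \<longleftrightarrow> (\<forall>(c', t, s') \<in> set_pmf (run K c s). c' = Skip)"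
  unfolding map_run[symmetric] by auto

text \<open>\<open>final_dist\<close> observes the run at the least halting time, which is not
  known. Both this time and \<open>K\<close> are times at which all outcomes have terminated, so
  both agree with the run at the later of the two.\<close>

lemma final_dist_eq:
  assumes "fin c s K \<mu>" "halts_within c s T"
  shows "final_dist c s = \<mu>"
proof -
  define L where "L = (LEAST T. halts_within c s T)"
  have "halts_within c s L" unfolding L_def using assms(2) by (rule LeastI)
  then have L: "\<forall>y \<in> set_pmf (crun L (c, s)). fst y = Skip"
    unfolding crun_all_Skip by (auto simp: halts_within_def)
  have K: "\<forall>y \<in> set_pmf (crun K (c, s)). fst y = Skip"
    using assms(1) by (auto simp: fin_def)
  have "crun L (c, s) = crun (max K L) (c, s)" "crun K (c, s) = crun (max K L) (c, s)"
    by (rule crun_terminated[symmetric, OF L] crun_terminated[symmetric, OF K]; simp)+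
  then have "map_pmf snd (crun L (c, s)) = \<mu>"
    using assms(1) by (simp add: fin_def pmf.map_comp o_def)
  moreover have "final_dist c s = map_pmf snd (crun L (c, s))"
    unfolding final_dist_def L_def[symmetric] map_run[symmetric]
    by (simp add: pmf.map_comp o_def case_prod_unfold)
  ultimately show ?thesis by simp
qed

definition poly_bounded :: "(nat \<Rightarrow> nat) \<Rightarrow> bool" where
  "poly_bounded f \<longleftrightarrow> (\<exists>p :: nat poly. \<forall>n. f n \<le> poly p n)"

lemma poly_bounded_const: "poly_bounded (\<lambda>n. k)"
  unfolding poly_bounded_def by (rule exI[of _ "[:k:]"]) simp

lemma poly_bounded_ident: "poly_bounded (\<lambda>n. n)"
  unfolding poly_bounded_def by (rule exI[of _ "[:0, 1:]"]) simp

lemma poly_bounded_add: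
  assumes "poly_bounded f" "poly_bounded g"
  shows "poly_bounded (\<lambda>n. f n + g n)"
proof -
  obtain p q :: "nat poly" where "\<And>n. f n \<le> poly p n" "\<And>n. g n \<le> poly q n"
    using assms unfolding poly_bounded_def by blast
  then show ?thesis
    unfolding poly_bounded_def by (intro exI[of _ "p + q"]) (simp add: add_mono)
qed

lemma poly_bounded_mult:
  assumes "poly_bounded f" "poly_bounded g"
  shows "poly_bounded (\<lambda>n. f n * g n)"
proof -
  obtain p q :: "nat poly" where "\<And>n. f n \<le> poly p n" "\<And>n. g n \<le> poly q n"
    using assms unfolding poly_bounded_def by blast
  then show ?thesis
    unfolding poly_bounded_def by (intro exI[of _ "p * q"]) (simp add: mult_le_mono)
qed

lemma poly_bounded_power: "poly_bounded f \<Longrightarrow> poly_bounded (\<lambda>n. f n ^ k)"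
  by (induction k) (auto intro: poly_bounded_mult poly_bounded_const)

lemmas poly_bounded_intros = poly_bounded_const poly_bounded_ident poly_bounded_add
  poly_bounded_mult poly_bounded_power

text \<open>A bound on steps suffices: \<open>run_growth\<close> turns it into a bound
  \<open>B\<close> on time. The polynomial dominates \<open>K n + B n\<close> because
  \<open>halts_within\<close> uses one number both as step count and as time limit.\<close>

lemma polynomial_timeI:
  assumes fin: "\<And>n E. graph n E \<Longrightarrow> fin P (graph_input n E) (K n) (\<mu> n E)"
    and K: "poly_bounded K" and lin: "linear_writes P"
  shows "polynomial_time P"
proof -
  define A where "A = Suc (psize P)"
  define B where "B = (\<lambda>n. K n * (1 + 2 * (A * (1 + A * (K n * A + (n + 2))))))"
  have "poly_bounded (\<lambda>n. K n + B n)"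
    unfolding B_def by (intro poly_bounded_intros K)
  then obtain p :: "nat poly" where p: "\<And>n. K n + B n \<le> poly p n"
    unfolding poly_bounded_def by blast
  have "halts_within P (graph_input n E) (poly p n)" if g: "graph n E" for n E
  proof -
    let ?s = "graph_input n E"
    have Skip: "\<forall>(c', t, s') \<in> set_pmf (run (K n) P ?s). c' = Skip"
      unfolding crun_all_Skip[symmetric] using fin[OF g] by (auto simp: fin_def)
    \<comment> \<open>The summand 2 ensures the requirement \<open>2 \<le> M\<close> of the growth
      estimate for every \<open>n\<close>.\<close>
    have b: "below (n + 2) ?s" by (auto simp: below_def graph_input_def)
    have B: "t \<le> B n" if "(c', t, s') \<in> set_pmf (run (K n) P ?s)" for c' t s'
      using run_growth[OF b, of P A, OF _ _ _ lin that] by (simp add: A_def B_def)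
    have t: "c' = Skip \<and> t \<le> poly p n" if x: "(c', t, s') \<in> set_pmf (run (K n) P ?s)" for c' t s'
    proof
      show "c' = Skip" using bspec[OF Skip x] by simp
      show "t \<le> poly p n" using B[OF x] p[of n] by linarith
    qed
    have j: "poly p n = K n + (poly p n - K n)" using p[of n] by linarith
    have r: "run (poly p n) P ?s = run (K n) P ?s"
      by (subst j) (rule run_terminated[OF Skip])
    show ?thesis unfolding halts_within_def r
    proof
      fix x assume "x \<in> set_pmf (run (K n) P ?s)"
      then show "case x of (c', t, s') \<Rightarrow> c' = Skip \<and> t \<le> poly p n"
        using t by (cases x) simp
    qed
  qed
  then show ?thesis unfolding polynomial_time_def by blast
qed

lemma alg_dist_eq:
  assumes "fin P (graph_input n E) K \<mu>" "polynomial_time P" "graph n E"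
  shows "alg_dist P n E = map_pmf (output_set n) \<mu>"
proof -
  obtain T where "halts_within P (graph_input n E) T"
    using assms(2,3) unfolding polynomial_time_def by blast
  then show ?thesis unfolding alg_dist_def using final_dist_eq[OF assms(1)] by simp
qed

section \<open>Earth mover bound\<close>

text \<open>For probability mass functions supported in \<open>U\<close> this is the total variation
  distance. The one-sided form lets each comparison be made in the direction in which the estimate
  is easier.\<close>

definition excess :: "'a set \<Rightarrow> ('a \<Rightarrow> real) \<Rightarrow> ('a \<Rightarrow> real) \<Rightarrow> real" where
  "excess U f g = (\<Sum>x\<in>U. max 0 (f x - g x))"

lemma excess_swap: "sum f U = sum g U \<Longrightarrow> excess U f g = excess U g f"
proof -
  assume "sum f U = sum g U"
  moreover have "excess U f g - excess U g f = sum f U - sum g U"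
    unfolding excess_def sum_subtractf[symmetric] by (rule sum.cong) auto
  ultimately show ?thesis by simp
qed

lemma excess_swap_pmf:
  assumes "finite U" "set_pmf p \<subseteq> U" "set_pmf q \<subseteq> U"
  shows "excess U (pmf p) (pmf q) = excess U (pmf q) (pmf p)"
  using assms by (intro excess_swap) (simp add: sum_pmf_eq_1)

lemma excess_triangle: "excess U p r \<le> excess U p q + excess U q r"
  unfolding excess_def sum.distrib[symmetric] by (rule sum_mono) auto

lemma excess_le_1:
  assumes "finite U" "set_pmf p \<subseteq> U"
  shows "excess U (pmf p) (pmf q) \<le> 1"
proof -
  have "excess U (pmf p) (pmf q) \<le> (\<Sum>x\<in>U. pmf p x)" unfolding excess_def by (rule sum_mono) auto
  then show ?thesis using assms by (simp add: sum_pmf_eq_1)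
qed

lemma excess_nonneg: "0 \<le> excess U p q"
  unfolding excess_def by (rule sum_nonneg) auto

lemma earth_mover_le_coupling:
  assumes "coupling p q r"
  shows "earth_mover p q \<le> measure_pmf.expectation r (\<lambda>(S, T). real (hamming S T))"
  unfolding earth_mover_def
proof (rule cINF_lower)
  show "bdd_below ((\<lambda>r. measure_pmf.expectation r (\<lambda>(S, T). real (hamming S T))) ` {r. coupling p q r})"
    by (rule bdd_belowI[of _ 0]) (auto intro!: integral_nonneg_AE)
qed (use assms in simp)

lemma hamming_le:
  assumes "S \<subseteq> {..<n}" "T \<subseteq> {..<n}"
  shows "hamming S T \<le> n"
proof -
  have "card ((S - T) \<union> (T - S)) \<le> card {..<n}" using assms by (intro card_mono) auto
  then show ?thesis by (simp add: hamming_def)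
qed

text \<open>The maximal coupling: keep the common part \<open>min p q\<close> on the diagonal and couple the
  two excesses independently.\<close>

lemma maximal_coupling:
  fixes p q :: "'a pmf"
  assumes U: "finite U" "set_pmf p \<subseteq> U" "set_pmf q \<subseteq> U" and D: "0 < excess U (pmf p) (pmf q)"
  defines "f \<equiv> \<lambda>(x, y). (if x = y then min (pmf p x) (pmf q x) else 0) +
    max 0 (pmf p x - pmf q x) * max 0 (pmf q y - pmf p y) / excess U (pmf p) (pmf q)"
  obtains r where "coupling p q r" "\<And>z. pmf r z = f z" "set_pmf r \<subseteq> U \<times> U"
proof -
  let ?D = "excess U (pmf p) (pmf q)"
  have p0: "pmf p x = 0" and q0: "pmf q x = 0" if "x \<notin> U" for x
    using U that by (auto simp: set_pmf_eq)
  have D': "(\<Sum>y\<in>U. max 0 (pmf q y - pmf p y)) = ?D"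
    using excess_swap_pmf[OF U] by (simp add: excess_def)
  have f0: "f z = 0" if "z \<notin> U \<times> U" for z
    using that p0 q0 by (cases z) (auto simp: f_def)
  have f_nonneg: "0 \<le> f z" for z
    using D by (cases z) (auto simp: f_def)
  have fst_sum: "(\<Sum>y\<in>U. f (x, y)) = pmf p x" if "x \<in> U" for x
  proof -
    have "(\<Sum>y\<in>U. f (x, y)) = min (pmf p x) (pmf q x) +
        (\<Sum>y\<in>U. max 0 (pmf p x - pmf q x) * max 0 (pmf q y - pmf p y) / ?D)"
      using U(1) that by (simp add: f_def sum.distrib sum.delta)
    also have "\<dots> = min (pmf p x) (pmf q x) + max 0 (pmf p x - pmf q x)"
      using D by (simp only: sum_divide_distrib[symmetric] sum_distrib_left[symmetric] D') simp
    also have "\<dots> = pmf p x" by auto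
    finally show ?thesis .
  qed
  have snd_sum: "(\<Sum>x\<in>U. f (x, y)) = pmf q y" if "y \<in> U" for y
  proof -
    have "(\<Sum>x\<in>U. f (x, y)) = min (pmf p y) (pmf q y) +
        (\<Sum>x\<in>U. max 0 (pmf p x - pmf q x) * max 0 (pmf q y - pmf p y) / ?D)"
      using U(1) that by (simp add: f_def sum.distrib sum.delta')
    also have "\<dots> = min (pmf p y) (pmf q y) + max 0 (pmf q y - pmf p y)"
      using D by (simp only: sum_divide_distrib[symmetric] sum_distrib_right[symmetric] excess_def[symmetric]) simp
    also have "\<dots> = pmf q y" by auto
    finally show ?thesis .
  qed
  have total: "(\<Sum>z\<in>U \<times> U. f z) = 1"
    using U by (simp add: sum.cartesian_product' fst_sum sum_pmf_eq_1)
  have "(\<integral>\<^sup>+ z. ennreal (f z) \<partial>count_space UNIV) = (\<Sum>z\<in>U \<times> U. ennreal (f z))"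
    using U(1) f0 by (intro nn_integral_count_space') auto
  also have "\<dots> = 1" using total by (simp add: sum_ennreal f_nonneg)
  finally have nn: "(\<integral>\<^sup>+ z. ennreal (f z) \<partial>count_space UNIV) = 1" .
  define r where "r = embed_pmf f"
  have pmf_r: "pmf r z = f z" for z
    unfolding r_def using f_nonneg nn by (rule pmf_embed_pmf)
  have set_r: "set_pmf r \<subseteq> U \<times> U"
    using f0 by (auto simp: set_pmf_eq pmf_r)
  have "pmf (map_pmf fst r) x = pmf p x" for x
  proof (cases "x \<in> U")
    case True
    have "pmf (map_pmf fst r) x = measure r ((fst -` {x}) \<inter> (U \<times> U))"
      unfolding pmf_map using set_r by (intro measure_pmf.finite_measure_eq_AE) (auto simp: AE_measure_pmf_iff)
    also have "(fst -` {x}) \<inter> (U \<times> U) = Pair x ` U" using True by auto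
    also have "measure r (Pair x ` U) = (\<Sum>z\<in>Pair x ` U. pmf r z)"
      using U(1) by (simp add: measure_measure_pmf_finite)
    also have "\<dots> = (\<Sum>y\<in>U. f (x, y))" by (subst sum.reindex) (auto simp: inj_on_def pmf_r)
    finally show ?thesis using fst_sum[OF True] by simp
  next
    case False
    then have "x \<notin> set_pmf (map_pmf fst r)" using set_r by auto
    then show ?thesis using p0[OF False] by (simp add: set_pmf_eq)
  qed
  moreover have "pmf (map_pmf snd r) y = pmf q y" for y
  proof (cases "y \<in> U")
    case True
    have "pmf (map_pmf snd r) y = measure r ((snd -` {y}) \<inter> (U \<times> U))"
      unfolding pmf_map using set_r by (intro measure_pmf.finite_measure_eq_AE) (auto simp: AE_measure_pmf_iff)
    also have "(snd -` {y}) \<inter> (U \<times> U) = (\<lambda>x. (x, y)) ` U" using True by auto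
    also have "measure r ((\<lambda>x. (x, y)) ` U) = (\<Sum>z\<in>(\<lambda>x. (x, y)) ` U. pmf r z)"
      using U(1) by (simp add: measure_measure_pmf_finite)
    also have "\<dots> = (\<Sum>x\<in>U. f (x, y))" by (subst sum.reindex) (auto simp: inj_on_def pmf_r)
    finally show ?thesis using snd_sum[OF True] by simp
  next
    case False
    then have "y \<notin> set_pmf (map_pmf snd r)" using set_r by auto
    then show ?thesis using q0[OF False] by (simp add: set_pmf_eq)
  qed
  ultimately have "coupling p q r" by (simp add: coupling_def pmf_eq_iff)
  then show ?thesis using pmf_r set_r that by blast
qed

text \<open>In the maximal coupling the two sets differ with probability equal to the excess, and
  then by at most \<open>n\<close> vertices. For excess 0 that coupling would divide by 0; the
  distributions coincide and the diagonal is used.\<close>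

lemma earth_mover_le_excess:
  assumes U: "finite U" "set_pmf p \<subseteq> U" "set_pmf q \<subseteq> U" and n: "\<And>S. S \<in> U \<Longrightarrow> S \<subseteq> {..<n}"
  shows "earth_mover p q \<le> real n * excess U (pmf p) (pmf q)"
proof (cases "excess U (pmf p) (pmf q) = 0")
  case True
  have le: "pmf p x \<le> pmf q x" if "x \<in> U" for x
  proof -
    have "max 0 (pmf p x - pmf q x) = 0"
      using True that U(1) unfolding excess_def by (subst (asm) sum_nonneg_eq_0_iff) auto
    then show ?thesis by linarith
  qed
  have le': "pmf q x \<le> pmf p x" if "x \<in> U" for x
  proof -
    have "max 0 (pmf q x - pmf p x) = 0"
      using True that U(1) unfolding excess_swap_pmf[OF U] unfolding excess_def
      by (subst (asm) sum_nonneg_eq_0_iff) auto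
    then show ?thesis by linarith
  qed
  have "pmf p x = pmf q x" for x
  proof (cases "x \<in> U")
    case False
    then show ?thesis using U by (metis pmf_eq_0_set_pmf subsetD)
  qed (use le[of x] le'[of x] in simp)
  then have "p = q" by (simp add: pmf_eq_iff)
  then have "coupling p q (map_pmf (\<lambda>x. (x, x)) p)"
    by (simp add: coupling_def pmf.map_comp o_def)
  then show ?thesis
    using earth_mover_le_coupling[of p q "map_pmf (\<lambda>x. (x, x)) p"] True by (simp add: hamming_def)
next
  case False
  let ?D = "excess U (pmf p) (pmf q)"
  have D: "0 < ?D" using False excess_nonneg[of U "pmf p" "pmf q"] by linarith
  from maximal_coupling[OF U D] obtain r where r: "coupling p q r"
    "\<And>z. pmf r z = (case z of (x, y) \<Rightarrow> (if x = y then min (pmf p x) (pmf q x) else 0) +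
      max 0 (pmf p x - pmf q x) * max 0 (pmf q y - pmf p y) / ?D)"
    "set_pmf r \<subseteq> U \<times> U"
    by blast
  let ?h = "\<lambda>(S, T). real (hamming S T)"
  let ?a = "\<lambda>x. max 0 (pmf p x - pmf q x)" and ?b = "\<lambda>y. max 0 (pmf q y - pmf p y)"
  have "measure_pmf.expectation r ?h = (\<Sum>z\<in>U \<times> U. ?h z * pmf r z)"
    using U(1) r(3) by (intro integral_measure_pmf_real) auto
  also have "\<dots> \<le> (\<Sum>z\<in>U \<times> U. real n * (?a (fst z) * ?b (snd z) / ?D))"
  proof (rule sum_mono)
    fix z assume z: "z \<in> U \<times> U"
    obtain x y where xy: "z = (x, y)" "x \<in> U" "y \<in> U" using z by auto
    have h: "real (hamming x y) \<le> real n" using hamming_le n xy by simp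
    show "?h z * pmf r z \<le> real n * (?a (fst z) * ?b (snd z) / ?D)"
    proof (cases "x = y")
      case True
      then show ?thesis using D xy by (simp add: hamming_def)
    next
      case False
      have "real (hamming x y) * (?a x * ?b y / ?D) \<le> real n * (?a x * ?b y / ?D)"
        using D by (intro mult_right_mono h) simp
      then show ?thesis using False xy by (simp add: r(2))
    qed
  qed
  also have "\<dots> = real n * ((\<Sum>x\<in>U. ?a x) * (\<Sum>y\<in>U. ?b y) / ?D)"
  proof -
    have "(\<Sum>x\<in>U. ?a x) * (\<Sum>y\<in>U. ?b y) = (\<Sum>z\<in>U \<times> U. ?a (fst z) * ?b (snd z))"
      unfolding sum_product sum.cartesian_product by (simp only: case_prod_unfold)
    then show ?thesis by (simp only: sum_divide_distrib sum_distrib_left)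
  qed
  also have "\<dots> = real n * ?D"
    using D excess_swap_pmf[OF U] by (simp add: excess_def[symmetric])
  finally show ?thesis using earth_mover_le_coupling[OF r(1)] by linarith
qed

section \<open>Cuts\<close>

definition crosses :: "nat set \<Rightarrow> nat set \<Rightarrow> bool" where
  "crosses S e \<longleftrightarrow> card (e \<inter> S) = 1"

lemma crosses_doubleton: "u \<noteq> v \<Longrightarrow> crosses S {u, v} \<longleftrightarrow> (u \<in> S) \<noteq> (v \<in> S)"
  by (auto simp: crosses_def Int_insert_left)

lemma finite_cuts: "finite {S. is_cut n S}"
  by (rule finite_subset[of _ "Pow {..<n}"]) (auto simp: is_cut_def)

lemma is_cut_singleton:
  assumes "2 \<le> n" "v < n"
  shows "is_cut n {v}"
proof -
  have "card {v} \<noteq> card {..<n}" using assms(1) by simp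
  then have "{v} \<noteq> {..<n}" by metis
  then show ?thesis using assms(2) by (auto simp: is_cut_def)
qed

lemma OPT_le: "is_cut n S \<Longrightarrow> OPT n E \<le> cut_cost E S"
  unfolding OPT_def by (rule Min_le) (auto simp: finite_cuts)

lemma OPT_attained:
  assumes "2 \<le> n"
  obtains S where "is_cut n S" "cut_cost E S = OPT n E"
proof -
  have "{S. is_cut n S} \<noteq> {}" using is_cut_singleton[OF assms, of 0] assms by auto
  then have "OPT n E \<in> cut_cost E ` {S. is_cut n S}"
    unfolding OPT_def by (intro Min_in) (auto simp: finite_cuts)
  then show ?thesis using that by auto
qed

lemma graph_finite: "graph n E \<Longrightarrow> finite E"
  by (rule finite_subset[of _ "Pow {..<n}"]) (auto simp: graph_def)

lemma graph_edgeE: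
  assumes "graph n E" "e \<in> E"
  obtains u v where "u < v" "v < n" "e = {u, v}"
proof -
  obtain u v where uv: "e = {u, v}" "u < n" "v < n" "u \<noteq> v"
    using assms by (auto simp: graph_def)
  show ?thesis
    using that[of u v] that[of v u] uv by (cases "u < v") (auto simp: insert_commute)
qed

lemma cut_cost_compl:
  assumes "graph n E"
  shows "cut_cost E ({..<n} - S) = cut_cost E S"
proof -
  have "crosses ({..<n} - S) e \<longleftrightarrow> crosses S e" if e: "e \<in> E" for e
  proof -
    obtain u v where "u < v" "v < n" "e = {u, v}" using graph_edgeE[OF assms e] .
    then show ?thesis by (auto simp: crosses_doubleton)
  qed
  then have "{e \<in> E. crosses ({..<n} - S) e} = {e \<in> E. crosses S e}" by (simp cong: conj_cong)
  then show ?thesis by (simp add: cut_cost_def crosses_def)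
qed

lemma min_cut_avoiding_0:
  assumes "graph n E" "2 \<le> n"
  obtains S where "is_cut n S" "0 \<notin> S" "cut_cost E S = OPT n E"
proof -
  obtain S where S: "is_cut n S" "cut_cost E S = OPT n E" using OPT_attained[OF assms(2)] by blast
  show ?thesis
  proof (cases "0 \<in> S")
    case True
    have "is_cut n ({..<n} - S)" using S(1) True by (auto simp: is_cut_def)
    then show ?thesis using that[of "{..<n} - S"] S(2) cut_cost_compl[OF assms(1)] True by simp
  qed (use S that in blast)
qed

lemma cut_cost_remove:
  assumes "finite E" "e \<in> E"
  shows "cut_cost E S = cut_cost (E - {e}) S + (if crosses S e then 1 else 0)"
proof -
  have "{d \<in> E. crosses S d} =
      {d \<in> E - {e}. crosses S d} \<union> (if crosses S e then {e} else {})"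
    using assms(2) by auto
  then have "card {d \<in> E. crosses S d} =
      card {d \<in> E - {e}. crosses S d} + card (if crosses S e then {e} else {})"
    using assms(1) by (simp only:) (rule card_Un_disjoint; auto)
  then show ?thesis by (simp add: cut_cost_def crosses_def)
qed

lemma graph_remove: "graph n E \<Longrightarrow> graph n (E - {e})"
  by (auto simp: graph_def)

lemma OPT_remove:
  assumes "graph n E" "e \<in> E" "2 \<le> n"
  shows "OPT n (E - {e}) \<le> OPT n E" "OPT n E \<le> Suc (OPT n (E - {e}))"
proof -
  have fin: "finite E" using assms(1) by (rule graph_finite)
  obtain S where S: "is_cut n S" "cut_cost E S = OPT n E" using OPT_attained[OF assms(3)] by blast
  have "cut_cost (E - {e}) S \<le> cut_cost E S" using cut_cost_remove[OF fin assms(2), of S] by simp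
  then show "OPT n (E - {e}) \<le> OPT n E" using OPT_le[OF S(1), of "E - {e}"] S(2) by simp
  obtain T where T: "is_cut n T" "cut_cost (E - {e}) T = OPT n (E - {e})"
    using OPT_attained[OF assms(3)] by blast
  have "cut_cost E T \<le> Suc (cut_cost (E - {e}) T)"
    using cut_cost_remove[OF fin assms(2), of T] by simp
  then show "OPT n E \<le> Suc (OPT n (E - {e}))" using OPT_le[OF T(1), of E] T(2) by simp
qed

text \<open>Every class of a nontrivial partition is a cut, and every edge is counted at most twice.\<close>

lemma OPT_mult_card_classes_le:
  fixes f :: "nat \<Rightarrow> 'a"
  assumes "graph n E" "2 \<le> card (f ` {..<n})"
  shows "OPT n E * card (f ` {..<n}) \<le> 2 * card {e \<in> E. \<exists>u\<in>e. \<exists>v\<in>e. f u \<noteq> f v}"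
proof -
  let ?X = "{e \<in> E. \<exists>u\<in>e. \<exists>v\<in>e. f u \<noteq> f v}" and ?C = "\<lambda>a. {v. v < n \<and> f v = a}"
  have finE: "finite E" using assms(1) by (rule graph_finite)
  have "OPT n E \<le> cut_cost E (?C a)" if a: "a \<in> f ` {..<n}" for a
  proof (rule OPT_le)
    obtain b where "b \<in> f ` {..<n}" "b \<noteq> a"
      using assms(2) a by (metis card_le_Suc0_iff_eq finite_imageI finite_lessThan not_less_eq_eq numeral_2_eq_2)
    then show "is_cut n (?C a)" using a by (auto simp: is_cut_def)
  qed
  then have "OPT n E * card (f ` {..<n}) \<le> (\<Sum>a\<in>f ` {..<n}. cut_cost E (?C a))"
    using sum_bounded_below[of "f ` {..<n}" "OPT n E" "\<lambda>a. cut_cost E (?C a)"] by (simp add: mult.commute)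
  also have "\<dots> = (\<Sum>a\<in>f ` {..<n}. \<Sum>e\<in>E. of_bool (crosses (?C a) e))"
    using finE by (simp add: cut_cost_def crosses_def sum.If_cases of_bool_def Int_def)
  also have "\<dots> = (\<Sum>e\<in>E. \<Sum>a\<in>f ` {..<n}. of_bool (crosses (?C a) e))"
    by (rule sum.swap)
  also have "\<dots> \<le> (\<Sum>e\<in>E. if e \<in> ?X then 2 else 0)"
  proof (rule sum_mono)
    fix e assume e: "e \<in> E"
    obtain u v where uv: "u < v" "v < n" "e = {u, v}" using graph_edgeE[OF assms(1) e] .
    have "(\<Sum>a\<in>f ` {..<n}. of_bool (crosses (?C a) e)) = card {a \<in> f ` {..<n}. crosses (?C a) e}"
      by (simp add: of_bool_def sum.If_cases Int_def)
    also have "\<dots> \<le> card (if f u = f v then {} else {f u, f v})"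
      using uv by (intro card_mono) (auto simp: crosses_doubleton split: if_splits)
    also have "\<dots> \<le> (if e \<in> ?X then 2 else 0)"
      using uv e by (auto simp: card_insert_if)
    finally show "(\<Sum>a\<in>f ` {..<n}. of_bool (crosses (?C a) e)) \<le> (if e \<in> ?X then 2 else (0::nat))" .
  qed
  also have "\<dots> = 2 * card ?X"
    using finE by (simp add: sum.If_cases Int_def)
  finally show ?thesis .
qed

text \<open>The partition into singletons; this is the handshake lemma with all degrees at least
  \<open>OPT\<close>.\<close>

lemma OPT_mult_n_le:
  assumes "graph n E" "2 \<le> n"
  shows "OPT n E * n \<le> 2 * card E"
proof -
  have "OPT n E * n \<le> 2 * card {e \<in> E. \<exists>u\<in>e. \<exists>v\<in>e. u \<noteq> v}"
    using OPT_mult_card_classes_le[OF assms(1), of "\<lambda>v. v"] assms(2) by simp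
  also have "\<dots> \<le> 2 * card E"
    using graph_finite[OF assms(1)] by (intro mult_le_mono2 card_mono) auto
  finally show ?thesis .
qed

lemma card_edges_le: "graph n E \<Longrightarrow> card E \<le> n * n"
proof -
  assume "graph n E"
  then have "E \<subseteq> (\<lambda>(u, v). {u, v}) ` ({..<n} \<times> {..<n})" by (auto simp: graph_def)
  then have "card E \<le> card ((\<lambda>(u, v). {u, v}) ` ({..<n} \<times> {..<n}))" by (intro card_mono) auto
  also have "\<dots> \<le> card ({..<n} \<times> {..<n})" by (rule card_image_le) simp
  finally show ?thesis by (simp add: card_cartesian_product)
qed

lemma cut_cost_le: "graph n E \<Longrightarrow> cut_cost E S \<le> n * n"
  using card_edges_le[of n E] card_mono[OF graph_finite, of n E "{e \<in> E. card (e \<inter> S) = 1}"]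
  by (fastforce simp: cut_cost_def)

text \<open>Vertex 0 has at most \<open>n - 1\<close> neighbours.\<close>

lemma OPT_less: "graph n E \<Longrightarrow> 2 \<le> n \<Longrightarrow> OPT n E < n"
proof -
  assume g: "graph n E" and n: "2 \<le> n"
  have "{e \<in> E. card (e \<inter> {0}) = 1} \<subseteq> (\<lambda>v. {0, v}) ` {1..<n}"
  proof
    fix e assume e: "e \<in> {e \<in> E. card (e \<inter> {0}) = 1}"
    then obtain u v where uv: "u < v" "v < n" "e = {u, v}" using graph_edgeE[OF g, of e] by blast
    then have "u = 0" using e by (cases "u = 0") auto
    then show "e \<in> (\<lambda>v. {0, v}) ` {1..<n}" using uv by auto
  qed
  then have "cut_cost E {0} \<le> card ((\<lambda>v. {0, v}) ` {1..<n})"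
    unfolding cut_cost_def by (intro card_mono) auto
  also have "\<dots> \<le> n - 1" using card_image_le[of "{1..<n}" "\<lambda>v. {0, v}"] by simp
  finally have "cut_cost E {0} \<le> n - 1" .
  then show ?thesis using OPT_le[OF is_cut_singleton[OF n, of 0], of E] n by linarith
qed

section \<open>Power-law sampling of near-minimum cuts\<close>

text \<open>A cut and its complement are represented by the side that avoids vertex 0.\<close>

definition small_cuts :: "nat \<Rightarrow> nat set set \<Rightarrow> nat set set" where
  "small_cuts n E = {S. is_cut n S \<and> 0 \<notin> S \<and> cut_cost E S \<le> 2 * OPT n E}"

text \<open>A power law instead of the exponential weights of the usual exponential mechanism: the
  weights do not refer to \<open>OPT\<close>, so that a change of \<open>OPT\<close> does not rescale all of them.\<close>

definition weight :: "nat \<Rightarrow> nat set set \<Rightarrow> nat set \<Rightarrow> real" where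
  "weight L E S = 1 / real (cut_cost E S) ^ L"

text \<open>The ideal law of the output, kept as a real function because the program only
  approximates it. It is meant for \<open>0 < OPT\<close>, where no cut has cost 0.\<close>

definition gibbs :: "nat \<Rightarrow> nat \<Rightarrow> nat set set \<Rightarrow> nat set \<Rightarrow> real" where
  "gibbs L n E S =
     (if S \<in> small_cuts n E then weight L E S / sum (weight L E) (small_cuts n E) else 0)"

lemma finite_small_cuts [simp]: "finite (small_cuts n E)"
  by (rule finite_subset[OF _ finite_cuts[of n]]) (auto simp: small_cuts_def)

lemma small_cuts_subset: "small_cuts n E \<subseteq> Pow {..<n}"
  by (auto simp: small_cuts_def is_cut_def)

lemma small_cuts_cost: "S \<in> small_cuts n E \<Longrightarrow> OPT n E \<le> cut_cost E S"
  by (simp add: small_cuts_def OPT_le)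

lemma weight_nonneg [simp]: "0 \<le> weight L E S"
  by (simp add: weight_def)

lemma gibbs_nonneg [simp]: "0 \<le> gibbs L n E S"
  by (simp add: gibbs_def sum_nonneg)

lemma weight_OPT_le_total:
  assumes "graph n E" "2 \<le> n"
  shows "1 / real (OPT n E) ^ L \<le> sum (weight L E) (small_cuts n E)"
proof -
  obtain S where S: "is_cut n S" "0 \<notin> S" "cut_cost E S = OPT n E"
    using min_cut_avoiding_0[OF assms] .
  then have "S \<in> small_cuts n E" by (simp add: small_cuts_def)
  then have "weight L E S \<le> sum (weight L E) (small_cuts n E)"
    by (intro member_le_sum) auto
  then show ?thesis using S(3) by (simp add: weight_def)
qed

lemma total_pos:
  assumes "graph n E" "2 \<le> n" "0 < OPT n E"
  shows "0 < sum (weight L E) (small_cuts n E)"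
proof -
  have "0 < 1 / real (OPT n E) ^ L" using assms(3) by simp
  then show ?thesis using weight_OPT_le_total[OF assms(1,2), of L] by linarith
qed

lemma sum_gibbs:
  assumes "graph n E" "2 \<le> n" "0 < OPT n E"
  shows "sum (gibbs L n E) (small_cuts n E) = 1"
proof -
  have "sum (gibbs L n E) (small_cuts n E) =
      sum (weight L E) (small_cuts n E) / sum (weight L E) (small_cuts n E)"
    unfolding sum_divide_distrib by (rule sum.cong) (auto simp: gibbs_def)
  then show ?thesis using total_pos[OF assms, of L] by simp
qed

text \<open>Each such cut weighs at most \<open>(2/3) ^ L\<close> times a minimum cut, which alone
  contributes \<open>1 / OPT ^ L\<close> to the total; \<open>tau\<close> pays for the number of
  cuts.\<close>

lemma expensive_cuts_rare:
  assumes "graph n E" "2 \<le> n" "0 < OPT n E"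
    and G: "G \<subseteq> small_cuts n E" "\<And>S. S \<in> G \<Longrightarrow> 3 * OPT n E \<le> 2 * cut_cost E S"
    and tau: "real (card (small_cuts n E)) * (2/3) ^ L \<le> tau"
  shows "sum (weight L E) G \<le> tau * sum (weight L E) (small_cuts n E)"
proof -
  let ?k = "real (OPT n E)"
  have "weight L E S \<le> (2/3) ^ L * (1 / ?k ^ L)" if "S \<in> G" for S
  proof -
    have "3/2 * ?k \<le> real (cut_cost E S)" using G(2)[OF that] by linarith
    then have "(3/2 * ?k) ^ L \<le> real (cut_cost E S) ^ L" by (intro power_mono) auto
    moreover have "0 < (3/2 * ?k) ^ L" using assms(3) by (intro zero_less_power) simp
    ultimately have "weight L E S \<le> 1 / (3/2 * ?k) ^ L"
      unfolding weight_def by (intro divide_left_mono mult_pos_pos) linarith+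
    also have "\<dots> = (2/3) ^ L * (1 / ?k ^ L)" by (simp add: power_mult_distrib power_divide)
    finally show ?thesis .
  qed
  then have "sum (weight L E) G \<le> real (card G) * ((2/3) ^ L * (1 / ?k ^ L))"
    by (intro sum_bounded_above)
  also have "\<dots> \<le> real (card (small_cuts n E)) * ((2/3) ^ L * (1 / ?k ^ L))"
    using card_mono[OF finite_small_cuts G(1)] by (intro mult_right_mono) auto
  also have "\<dots> = real (card (small_cuts n E)) * (2/3) ^ L * (1 / ?k ^ L)" by simp
  also have "\<dots> \<le> tau * (1 / ?k ^ L)" using tau by (intro mult_right_mono) auto
  also have "\<dots> \<le> tau * sum (weight L E) (small_cuts n E)"
  proof (rule mult_left_mono[OF weight_OPT_le_total[OF assms(1,2)]])
    have "0 \<le> real (card (small_cuts n E)) * (2/3) ^ L" by simp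
    then show "0 \<le> tau" using tau by linarith
  qed
  finally show ?thesis .
qed

text \<open>Taking the excess of the new law over the old one yields a bound by crossing
  probabilities of the old law. These refer to one and the same distribution for all
  \<open>e\<close>, so they can be summed over the edges later. Weights of common cuts rise by at
  most the factor \<open>rho\<close>, the normalizer hardly falls, and cuts that newly enter are
  covered by \<open>expensive_cuts_rare\<close>.\<close>

lemma excess_gibbs_remove:
  assumes g: "graph n E" "e \<in> E" "2 \<le> n" and k: "4 \<le> OPT n E"
    and tau: "real (card (small_cuts n E)) * (2/3) ^ L \<le> tau"
      "real (card (small_cuts n (E - {e}))) * (2/3) ^ L \<le> tau" "tau \<le> 1/2"
    and rho: "rho = (real (OPT n E) / (real (OPT n E) - 1)) ^ L"
  shows "excess (Pow {..<n}) (gibbs L n (E - {e})) (gibbs L n E) \<le>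
    2 * (rho - 1) * (\<Sum>S\<in>small_cuts n E. of_bool (crosses S e) * gibbs L n E S) + 3 * tau"
proof -
  define F F' where "F = small_cuts n E" and "F' = small_cuts n (E - {e})"
  define w w' where "w = weight L E" and "w' = weight L (E - {e})"
  define W W' where "W = sum w F" and "W' = sum w' F'"
  define Q Q' where "Q = gibbs L n E" and "Q' = gibbs L n (E - {e})"
  let ?k = "OPT n E" and ?k' = "OPT n (E - {e})"
  have kk: "?k' \<le> ?k" "?k \<le> Suc ?k'" using OPT_remove[OF g] by auto
  have c: "cut_cost E S = cut_cost (E - {e}) S + (if crosses S e then 1 else 0)" for S
    by (rule cut_cost_remove[OF graph_finite[OF g(1)] g(2)])
  have fin: "finite F" "finite F'" by (simp_all add: F_def F'_def)
  have W: "0 < W" "0 < W'"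
    unfolding W_def W'_def w_def w'_def F_def F'_def
    using total_pos[OF g(1,3)] total_pos[OF graph_remove[OF g(1)] g(3)] kk k by auto
  have tau0: "0 \<le> tau"
  proof -
    have "0 \<le> real (card (small_cuts n E)) * (2/3) ^ L" by simp
    then show ?thesis using tau(1) by linarith
  qed
  have rho1: "1 \<le> rho"
    unfolding rho using k by (intro one_le_power) simp
  have QF: "Q S = w S / W" if "S \<in> F" for S
    using that by (simp add: Q_def gibbs_def F_def W_def w_def)
  have Q'F': "Q' S = w' S / W'" if "S \<in> F'" for S
    using that by (simp add: Q'_def gibbs_def F'_def W'_def w'_def)
  have ww': "w S \<le> w' S" "w' S \<le> (if crosses S e then rho else 1) * w S" if "S \<in> F" for S
  proof -
    have cS: "?k \<le> cut_cost E S" using small_cuts_cost that F_def by blast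
    let ?c = "real (cut_cost E S)"
    have c1: "real (cut_cost (E - {e}) S) = (if crosses S e then ?c - 1 else ?c)" using c[of S] by simp
    have pos: "0 < ?c - 1" using cS k by simp
    have "w S \<le> w' S \<and> w' S \<le> (if crosses S e then rho else 1) * w S"
    proof (cases "crosses S e")
      case True
      have "(?c - 1) ^ L \<le> ?c ^ L" using pos by (intro power_mono) auto
      then have 1: "1 / ?c ^ L \<le> 1 / (?c - 1) ^ L" using pos by (intro divide_left_mono mult_pos_pos) auto
      \<comment> \<open>\<open>c / (c - 1)\<close> decreases in \<open>c\<close>, so the worst case
        is a minimum cut.\<close>
      have "?c / (?c - 1) \<le> real ?k / (real ?k - 1)"
        using cS k pos by (simp add: field_simps)
      then have "(?c / (?c - 1)) ^ L \<le> rho"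
        unfolding rho using pos by (intro power_mono) auto
      then have "(?c / (?c - 1)) ^ L * (1 / ?c ^ L) \<le> rho * (1 / ?c ^ L)"
        by (intro mult_right_mono) auto
      then have "1 / (?c - 1) ^ L \<le> rho * (1 / ?c ^ L)"
        using pos by (simp add: power_divide)
      then show ?thesis using 1 True by (simp add: w_def w'_def weight_def c1)
    next
      case False
      then show ?thesis by (simp add: w_def w'_def weight_def c1)
    qed
    then show "w S \<le> w' S" "w' S \<le> (if crosses S e then rho else 1) * w S" by auto
  qed
  \<comment> \<open>A cut leaves the range only because \<open>OPT\<close> drops by 1, so its cost
    is still close to \<open>2 * OPT\<close>.\<close>
  have "sum w (F - F') \<le> tau * W"
    unfolding w_def W_def F_def
  proof (rule expensive_cuts_rare[OF g(1,3)])
    fix S assume "S \<in> small_cuts n E - F'"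
    then have "2 * ?k' < cut_cost (E - {e}) S" by (auto simp: small_cuts_def F'_def)
    then show "3 * ?k \<le> 2 * cut_cost E S" using c[of S] kk k by (auto split: if_splits)
  qed (use k tau in auto)
  moreover have "sum w F = sum w (F - F') + sum w (F \<inter> F')"
    using fin by (simp add: sum.Int_Diff[of F w F'] add.commute)
  moreover have "sum w (F \<inter> F') \<le> sum w' (F \<inter> F')"
    using ww'(1) by (intro sum_mono) auto
  moreover have "sum w' (F \<inter> F') \<le> W'"
    unfolding W'_def using fin by (intro sum_mono2) (auto simp: w'_def)
  ultimately have WW': "(1 - tau) * W \<le> W'" by (simp add: W_def algebra_simps)
  have t1: "1/2 \<le> 1 - tau" using tau(3) by simp
  have common: "max 0 (Q' S - Q S) \<le> 2 * (rho - 1) * (of_bool (crosses S e) * Q S) + 2 * tau * Q S"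
    if S: "S \<in> F \<inter> F'" for S
  proof -
    let ?r = "if crosses S e then rho else 1"
    have Q0: "0 \<le> Q S" by (simp add: Q_def)
    have "Q' S = w' S / W'" using S Q'F' by simp
    also have "\<dots> \<le> w' S / ((1 - tau) * W)"
      using WW' W t1 by (intro divide_left_mono mult_pos_pos) (auto simp: w'_def)
    also have "\<dots> \<le> ?r * w S / ((1 - tau) * W)"
      using ww'(2) S W t1 by (intro divide_right_mono) auto
    also have "\<dots> = ?r / (1 - tau) * Q S" using S QF by simp
    finally have "Q' S - Q S \<le> (?r / (1 - tau) - 1) * Q S" by (simp add: algebra_simps)
    \<comment> \<open>The factor 2 bounds \<open>1 / (1 - tau)\<close>, as
      \<open>tau \<le> 1/2\<close>.\<close>
    also have "\<dots> \<le> (2 * (?r - 1) + 2 * tau) * Q S"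
    proof (rule mult_right_mono[OF _ Q0])
      have "?r / (1 - tau) - 1 = ((?r - 1) + tau) / (1 - tau)" using t1 by (simp add: field_simps)
      also have "\<dots> \<le> ((?r - 1) + tau) / (1/2)"
        using t1 rho1 tau0 by (intro divide_left_mono) auto
      finally show "?r / (1 - tau) - 1 \<le> 2 * (?r - 1) + 2 * tau" by simp
    qed
    also have "\<dots> = 2 * (rho - 1) * (of_bool (crosses S e) * Q S) + 2 * tau * Q S"
      by (simp add: algebra_simps)
    finally have "Q' S - Q S \<le> 2 * (rho - 1) * (of_bool (crosses S e) * Q S) + 2 * tau * Q S" .
    moreover have "0 \<le> 2 * (rho - 1) * (of_bool (crosses S e) * Q S)" "0 \<le> 2 * tau * Q S"
      using Q0 rho1 tau0 by auto
    ultimately show ?thesis by linarith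
  qed
  have "excess (Pow {..<n}) Q' Q = (\<Sum>S\<in>F'. max 0 (Q' S - Q S))"
    unfolding excess_def
  proof (rule sum.mono_neutral_right)
    show "F' \<subseteq> Pow {..<n}" unfolding F'_def by (rule small_cuts_subset)
    show "\<forall>S\<in>Pow {..<n} - F'. max 0 (Q' S - Q S) = 0"
    proof
      fix S assume "S \<in> Pow {..<n} - F'"
      then have "Q' S = 0" by (simp add: Q'_def gibbs_def F'_def)
      moreover have "0 \<le> Q S" by (simp add: Q_def)
      ultimately show "max 0 (Q' S - Q S) = 0" by simp
    qed
  qed simp
  also have "\<dots> = (\<Sum>S\<in>F' \<inter> F. max 0 (Q' S - Q S)) + (\<Sum>S\<in>F' - F. max 0 (Q' S - Q S))"
    using fin by (simp add: sum.Int_Diff[of F' _ F])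
  also have "(\<Sum>S\<in>F' \<inter> F. max 0 (Q' S - Q S)) \<le>
      (\<Sum>S\<in>F' \<inter> F. 2 * (rho - 1) * (of_bool (crosses S e) * Q S) + 2 * tau * Q S)"
    using common by (intro sum_mono) auto
  also have "\<dots> \<le> (\<Sum>S\<in>F. 2 * (rho - 1) * (of_bool (crosses S e) * Q S) + 2 * tau * Q S)"
    using fin rho1 tau0 by (intro sum_mono2) (auto simp: Q_def)
  also have "\<dots> = 2 * (rho - 1) * (\<Sum>S\<in>F. of_bool (crosses S e) * Q S) + 2 * tau * sum Q F"
    by (simp only: sum.distrib sum_distrib_left)
  also have "sum Q F = 1"
    unfolding Q_def F_def using k by (intro sum_gibbs g) auto
  also have "(\<Sum>S\<in>F' - F. max 0 (Q' S - Q S)) \<le> (\<Sum>S\<in>F' - F. w' S / W')"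
    using Q'F' W by (intro sum_mono) (auto simp: Q_def w'_def)
  also have "\<dots> = sum w' (F' - F) / W'" by (simp add: sum_divide_distrib)
  also have "\<dots> \<le> tau"
  proof -
    \<comment> \<open>Such a cut has cost more than \<open>2 * OPT\<close> before the deletion,
      hence at least \<open>2 * OPT\<close> after it, with \<open>OPT\<close> that of the original
      graph.\<close>
    have "sum w' (F' - F) \<le> tau * W'"
      unfolding w'_def W'_def F'_def
    proof (rule expensive_cuts_rare[OF graph_remove[OF g(1)] g(3)])
      fix S assume S: "S \<in> small_cuts n (E - {e}) - F"
      then have "2 * ?k < cut_cost E S" by (auto simp: small_cuts_def F_def)
      then show "3 * ?k' \<le> 2 * cut_cost (E - {e}) S" using c[of S] kk k by (auto split: if_splits)
    qed (use k kk tau in auto)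
    then show ?thesis using W by (simp add: field_simps)
  qed
  finally show ?thesis by (simp add: Q_def Q'_def F_def)
qed

text \<open>Exchanging the sums turns the left side into the expected cost of the output.\<close>

lemma sum_edges_gibbs:
  assumes "graph n E" "2 \<le> n" "0 < OPT n E"
  shows "(\<Sum>e\<in>E. \<Sum>S\<in>small_cuts n E. of_bool (crosses S e) * gibbs L n E S) \<le> 2 * real (OPT n E)"
proof -
  have "(\<Sum>e\<in>E. \<Sum>S\<in>small_cuts n E. of_bool (crosses S e) * gibbs L n E S) =
      (\<Sum>S\<in>small_cuts n E. \<Sum>e\<in>E. of_bool (crosses S e) * gibbs L n E S)"
    by (rule sum.swap)
  also have "\<dots> = (\<Sum>S\<in>small_cuts n E. real (cut_cost E S) * gibbs L n E S)"
    using graph_finite[OF assms(1)]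
    by (simp add: sum_distrib_right[symmetric] cut_cost_def crosses_def sum.If_cases of_bool_def Int_def)
  also have "\<dots> \<le> (\<Sum>S\<in>small_cuts n E. 2 * real (OPT n E) * gibbs L n E S)"
  proof (intro sum_mono mult_right_mono)
    fix S assume "S \<in> small_cuts n E"
    then have "cut_cost E S \<le> 2 * OPT n E" by (simp add: small_cuts_def)
    then show "real (cut_cost E S) \<le> 2 * real (OPT n E)" by linarith
  qed simp
  also have "\<dots> = 2 * real (OPT n E)"
    using sum_gibbs[OF assms] by (simp add: sum_distrib_left[symmetric])
  finally show ?thesis .
qed

text \<open>A one-sided bound up to the factor \<open>1 - err\<close> suffices, since both sides
  have total mass 1. The support is restricted even when \<open>OPT = 0\<close>, where it expresses
  that the output is a minimum cut; \<open>tau\<close> bounds the relative weight of expensive cuts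
  in \<open>expensive_cuts_rare\<close>.\<close>

definition approx_gibbs :: "nat \<Rightarrow> real \<Rightarrow> real \<Rightarrow> nat \<Rightarrow> nat set set \<Rightarrow> nat set pmf \<Rightarrow> bool" where
  "approx_gibbs L err tau n E p \<longleftrightarrow> set_pmf p \<subseteq> small_cuts n E \<and>
     (0 < OPT n E \<longrightarrow> real (card (small_cuts n E)) * (2/3) ^ L \<le> tau \<and>
       (\<forall>S\<in>small_cuts n E. (1 - err) * gibbs L n E S \<le> pmf p S))"

lemma excess_gibbs_pmf:
  assumes "approx_gibbs L err tau n E p" "0 \<le> err" "graph n E" "2 \<le> n" "0 < OPT n E"
  shows "excess (Pow {..<n}) (gibbs L n E) (pmf p) \<le> err"
    "excess (Pow {..<n}) (pmf p) (gibbs L n E) \<le> err"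
proof -
  let ?F = "small_cuts n E" and ?U = "Pow {..<n}"
  have *: "excess ?U (gibbs L n E) (pmf p) = (\<Sum>S\<in>?F. max 0 (gibbs L n E S - pmf p S))"
    unfolding excess_def
    by (rule sum.mono_neutral_right) (use small_cuts_subset in \<open>auto simp: gibbs_def max_def\<close>)
  also have "\<dots> \<le> (\<Sum>S\<in>?F. err * gibbs L n E S)"
  proof (rule sum_mono)
    fix S assume "S \<in> ?F"
    then have "(1 - err) * gibbs L n E S \<le> pmf p S"
      using assms(1,5) by (simp add: approx_gibbs_def)
    moreover have "0 \<le> err * gibbs L n E S" using assms(2) by simp
    ultimately show "max 0 (gibbs L n E S - pmf p S) \<le> err * gibbs L n E S"
      by (simp add: algebra_simps)
  qed
  also have "\<dots> = err" using sum_gibbs[OF assms(3-5)] by (simp add: sum_distrib_left[symmetric])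
  finally show 1: "excess ?U (gibbs L n E) (pmf p) \<le> err" .
  have "sum (gibbs L n E) ?U = sum (gibbs L n E) ?F"
    by (rule sum.mono_neutral_right) (use small_cuts_subset in \<open>auto simp: gibbs_def\<close>)
  also have "\<dots> = 1" by (rule sum_gibbs[OF assms(3-5)])
  also have "\<dots> = sum (pmf p) ?U"
  proof (rule sum_pmf_eq_1[symmetric])
    show "set_pmf p \<subseteq> ?U" using assms(1) small_cuts_subset unfolding approx_gibbs_def by blast
  qed simp
  finally show "excess ?U (pmf p) (gibbs L n E) \<le> err"
    using 1 excess_swap by metis
qed

section \<open>Average sensitivity of an approximate sampler\<close>

lemma avg_sensitivity_le_n:
  assumes "\<And>E. graph n E \<Longrightarrow> set_pmf (A n E) \<subseteq> small_cuts n E" "graph n E" "0 < card E"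
  shows "avg_sensitivity A n E \<le> real n"
proof -
  have "earth_mover (A n E) (A n (E - {e})) \<le> real n" for e
  proof -
    have s: "set_pmf (A n E) \<subseteq> Pow {..<n}" "set_pmf (A n (E - {e})) \<subseteq> Pow {..<n}"
      using assms(1)[OF assms(2)] assms(1)[OF graph_remove[OF assms(2)]] small_cuts_subset by blast+
    have "earth_mover (A n E) (A n (E - {e})) \<le>
        real n * excess (Pow {..<n}) (pmf (A n E)) (pmf (A n (E - {e})))"
      using s by (intro earth_mover_le_excess) auto
    also have "\<dots> \<le> real n * 1" using s by (intro mult_left_mono excess_le_1) auto
    finally show ?thesis by simp
  qed
  then have "(\<Sum>e\<in>E. earth_mover (A n E) (A n (E - {e}))) \<le> real (card E) * real n"
    by (intro sum_bounded_above)
  then show ?thesis using assms(3) by (simp add: avg_sensitivity_def field_simps)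
qed

text \<open>The triangle inequality passes from the program to the ideal law on both graphs; the
  resulting errors account for the summand 1. The 8 is a product of three factors 2: from
  \<open>excess_gibbs_remove\<close>, from the expected cost of at most \<open>2 * OPT\<close>, and
  from \<open>OPT * n \<le> 2 * card E\<close>.\<close>

lemma avg_sensitivity_le_rho:
  assumes A: "\<And>E. graph n E \<Longrightarrow> approx_gibbs L err tau n E (A n E)"
    and g: "graph n E" "2 \<le> n" and k: "4 \<le> OPT n E"
    and small: "0 \<le> err" "tau \<le> 1/2" "real n * (2 * err + 3 * tau) \<le> 1"
    and rho: "rho = (real (OPT n E) / (real (OPT n E) - 1)) ^ L"
  shows "avg_sensitivity A n E \<le> 1 + 8 * (rho - 1)"
proof -
  let ?U = "Pow {..<n}" and ?k = "real (OPT n E)" and ?m = "real (card E)"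
  let ?P = "\<lambda>e. \<Sum>S\<in>small_cuts n E. of_bool (crosses S e) * gibbs L n E S"
  have rho1: "1 \<le> rho" unfolding rho using k by (intro one_le_power) simp
  have km: "?k * real n \<le> 2 * ?m"
    using OPT_mult_n_le[OF g] by (metis of_nat_le_iff of_nat_mult of_nat_numeral)
  have m: "0 < ?m"
  proof -
    have "0 < ?k * real n" using k g(2) by simp
    then show ?thesis using km by linarith
  qed
  have "earth_mover (A n E) (A n (E - {e})) \<le>
      real n * (2 * err + 3 * tau) + real n * 2 * (rho - 1) * ?P e" if e: "e \<in> E" for e
  proof -
    let ?E = "E - {e}" and ?p = "A n E" and ?p' = "A n (E - {e})"
    have g': "graph n ?E" using g(1) by (rule graph_remove)
    have k': "0 < OPT n ?E" using OPT_remove(2)[OF g(1) e g(2)] k by linarith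
    note a = A[OF g(1)] A[OF g']
    have s: "set_pmf ?p \<subseteq> ?U" "set_pmf ?p' \<subseteq> ?U"
      using a small_cuts_subset unfolding approx_gibbs_def by blast+
    have "excess ?U (pmf ?p) (pmf ?p') = excess ?U (pmf ?p') (pmf ?p)"
      using s by (intro excess_swap_pmf) auto
    also have "\<dots> \<le> excess ?U (pmf ?p') (gibbs L n ?E) +
        (excess ?U (gibbs L n ?E) (gibbs L n E) + excess ?U (gibbs L n E) (pmf ?p))"
      using excess_triangle[of ?U "pmf ?p'" "pmf ?p" "gibbs L n ?E"]
        excess_triangle[of ?U "gibbs L n ?E" "pmf ?p" "gibbs L n E"] by linarith
    also have "\<dots> \<le> err + ((2 * (rho - 1) * ?P e + 3 * tau) + err)"
    proof (intro add_mono)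
      show "excess ?U (pmf ?p') (gibbs L n ?E) \<le> err"
        by (rule excess_gibbs_pmf(2)[OF a(2) small(1) g' g(2) k'])
      show "excess ?U (gibbs L n E) (pmf ?p) \<le> err"
        using k by (intro excess_gibbs_pmf(1)[OF a(1) small(1) g]) simp
      show "excess ?U (gibbs L n ?E) (gibbs L n E) \<le> 2 * (rho - 1) * ?P e + 3 * tau"
      proof (rule excess_gibbs_remove[OF g(1) e g(2) k _ _ small(2) rho])
        show "real (card (small_cuts n E)) * (2/3) ^ L \<le> tau"
          using a(1) k by (simp add: approx_gibbs_def)
        show "real (card (small_cuts n ?E)) * (2/3) ^ L \<le> tau"
          using a(2) k' by (simp add: approx_gibbs_def)
      qed
    qed
    finally have "excess ?U (pmf ?p) (pmf ?p') \<le> 2 * err + 3 * tau + 2 * (rho - 1) * ?P e" by simp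
    then have "real n * excess ?U (pmf ?p) (pmf ?p') \<le> real n * (2 * err + 3 * tau + 2 * (rho - 1) * ?P e)"
      by (intro mult_left_mono) auto
    moreover have "earth_mover ?p ?p' \<le> real n * excess ?U (pmf ?p) (pmf ?p')"
      using s by (intro earth_mover_le_excess) auto
    ultimately show ?thesis by (simp add: algebra_simps)
  qed
  then have "(\<Sum>e\<in>E. earth_mover (A n E) (A n (E - {e}))) \<le>
      (\<Sum>e\<in>E. real n * (2 * err + 3 * tau) + real n * 2 * (rho - 1) * ?P e)"
    by (rule sum_mono)
  also have "\<dots> = ?m * (real n * (2 * err + 3 * tau)) + real n * 2 * (rho - 1) * (\<Sum>e\<in>E. ?P e)"
    by (simp only: sum.distrib sum_distrib_left sum_constant)
  also have "\<dots> \<le> ?m * 1 + real n * 2 * (rho - 1) * (2 * ?k)"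
    using small(3) rho1 k sum_edges_gibbs[OF g, of L] by (intro add_mono mult_left_mono) auto
  also have "\<dots> = ?m + 4 * (rho - 1) * (?k * real n)" by (simp add: algebra_simps)
  also have "\<dots> \<le> ?m + 4 * (rho - 1) * (2 * ?m)"
    using km rho1 by (intro add_left_mono mult_left_mono) auto
  also have "\<dots> = ?m * (1 + 8 * (rho - 1))" by (simp add: algebra_simps)
  finally show ?thesis using m by (simp add: avg_sensitivity_def field_simps)
qed

text \<open>For \<open>OPT < 4\<close> the exponent exceeds 1 and the trivial bound \<open>n\<close>
  is enough. Otherwise \<open>1 + 8 * (rho - 1) \<le> rho ^ 8\<close> by Bernoulli's inequality, and
  \<open>OPT - 1 \<ge> OPT / 2\<close> gives \<open>rho \<le> exp (240 * ln n / OPT)\<close>; this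
  is the origin of \<open>1920 = 8 * 240\<close>.\<close>

lemma avg_sensitivity_le_powr:
  assumes A: "\<And>E. graph n E \<Longrightarrow> approx_gibbs L err tau n E (A n E)"
    and g: "graph n E" "2 \<le> n" and k: "0 < OPT n E"
    and small: "0 \<le> err" "tau \<le> 1/2" "real n * (2 * err + 3 * tau) \<le> 1"
    and L: "real L \<le> 120 * ln (real n)"
  shows "avg_sensitivity A n E \<le> real n powr (1920 / real (OPT n E))"
proof (cases "OPT n E < 4")
  case True
  have "0 < OPT n E * n" using k g(2) by simp
  then have "0 < card E" using OPT_mult_n_le[OF g] by linarith
  then have "avg_sensitivity A n E \<le> real n"
    using A g(1) by (intro avg_sensitivity_le_n) (auto simp: approx_gibbs_def)
  also have "\<dots> = real n powr 1" using g(2) by simp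
  also have "\<dots> \<le> real n powr (1920 / real (OPT n E))"
    using True k g(2) by (intro powr_mono) (auto simp: field_simps)
  finally show ?thesis .
next
  case False
  let ?k = "real (OPT n E)"
  define rho where "rho = (?k / (?k - 1)) ^ L"
  have k4: "4 \<le> ?k" using False by simp
  have rho1: "1 \<le> rho" unfolding rho_def using k4 by (intro one_le_power) simp
  have "avg_sensitivity A n E \<le> 1 + 8 * (rho - 1)"
  proof (rule avg_sensitivity_le_rho[where A = A and n = n and L = L and err = err and tau = tau,
        OF A g _ small rho_def])
    show "4 \<le> OPT n E" using False by simp
  qed
  also have "\<dots> \<le> rho ^ 8"
    using Bernoulli_inequality[of "rho - 1" 8] rho1 by simp
  finally have 1: "avg_sensitivity A n E \<le> rho ^ 8" .
  have "rho \<le> exp (240 * ln (real n) / ?k)"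
  proof -
    have "?k / (?k - 1) = 1 + 1 / (?k - 1)" using k4 by (simp add: field_simps)
    also have "\<dots> \<le> exp (1 / (?k - 1))" by (rule exp_ge_add_one_self)
    finally have "rho \<le> exp (1 / (?k - 1)) ^ L"
      unfolding rho_def using k4 by (intro power_mono) auto
    also have "\<dots> = exp (real L / (?k - 1))" by (simp add: exp_of_nat_mult[symmetric])
    finally have "rho \<le> exp (real L / (?k - 1))" .
    moreover have "real L / (?k - 1) \<le> real L / (?k / 2)"
      using k4 by (intro divide_left_mono mult_pos_pos) auto
    moreover have "\<dots> \<le> 120 * ln (real n) / (?k / 2)" using L k4 by (intro divide_right_mono) auto
    ultimately have "real L / (?k - 1) \<le> 240 * ln (real n) / ?k" by simp
    then have "exp (real L / (?k - 1)) \<le> exp (240 * ln (real n) / ?k)" by (simp only: exp_le_cancel_iff)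
    with \<open>rho \<le> exp (real L / (?k - 1))\<close> show ?thesis by (rule order_trans)
  qed
  then have "rho ^ 8 \<le> exp (240 * ln (real n) / ?k) ^ 8" using rho1 by (intro power_mono) auto
  also have "\<dots> = real n powr (1920 / ?k)"
    using g(2) by (simp add: powr_def exp_of_nat_mult[symmetric])
  finally show ?thesis using 1 by linarith
qed

section \<open>Greedy tree packing\<close>

text \<open>The pair \<open>(u, v)\<close> of vertices has the code \<open>u * n + v\<close>, its index in the adjacency matrix.\<close>

definition edge_codes :: "nat \<Rightarrow> nat set set \<Rightarrow> nat set" where
  "edge_codes n E = {k. k < n * n \<and> k div n < k mod n \<and> {k div n, k mod n} \<in> E}"

definition crosses_code :: "nat \<Rightarrow> nat set \<Rightarrow> nat \<Rightarrow> bool" where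
  "crosses_code n S k \<longleftrightarrow> (k div n \<in> S) \<noteq> (k mod n \<in> S)"

lemma finite_edge_codes [simp]: "finite (edge_codes n E)"
  by (rule finite_subset[of _ "{..<n * n}"]) (auto simp: edge_codes_def)

lemma code_div_less: "k < n * n \<Longrightarrow> k div n < (n::nat)"
  by (simp add: less_mult_imp_div_less)

lemma code_mod_less: "k < n * n \<Longrightarrow> k mod n < (n::nat)"
  by (cases "n = 0") auto

lemma pair_code:
  fixes n :: nat
  assumes "u < n" "v < n"
  shows "u * n + v < n * n" "(u * n + v) div n = u" "(u * n + v) mod n = v"
proof -
  have "u * n + v < Suc u * n" using assms(2) by simp
  also have "\<dots> \<le> n * n" using assms(1) by (intro mult_le_mono1) simp
  finally show "u * n + v < n * n" .
qed (use assms in auto)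

lemma bij_betw_edge_codes:
  assumes "graph n E"
  shows "bij_betw (\<lambda>k. {k div n, k mod n}) (edge_codes n E) E"
proof (rule bij_betwI')
  fix k k' assume k: "k \<in> edge_codes n E" "k' \<in> edge_codes n E"
  show "({k div n, k mod n} = {k' div n, k' mod n}) = (k = k')"
  proof
    assume "{k div n, k mod n} = {k' div n, k' mod n}"
    then have "k div n = k' div n" "k mod n = k' mod n"
      using k by (auto simp: edge_codes_def doubleton_eq_iff)
    then show "k = k'" by (metis div_mult_mod_eq)
  qed simp
next
  fix e assume e: "e \<in> E"
  obtain u v where uv: "u < v" "v < n" "e = {u, v}" using graph_edgeE[OF assms e] .
  then have "u < n" by simp
  note p = pair_code[OF this uv(2)]
  have "u * n + v \<in> edge_codes n E"
    unfolding edge_codes_def mem_Collect_eq p(2,3) using p(1) uv e by simp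
  moreover have "e = {(u * n + v) div n, (u * n + v) mod n}" using uv p by simp
  ultimately show "\<exists>k\<in>edge_codes n E. e = {k div n, k mod n}" by blast
qed (simp add: edge_codes_def)

lemma card_edges_eq_codes:
  assumes "graph n E"
  shows "card {e \<in> E. P e} = card {k \<in> edge_codes n E. P {k div n, k mod n}}"
proof -
  let ?f = "\<lambda>k. {k div n, k mod n}"
  note b = bij_betw_edge_codes[OF assms]
  have "inj_on ?f {k \<in> edge_codes n E. P (?f k)}"
    using bij_betw_imp_inj_on[OF b] by (rule inj_on_subset) blast
  moreover have "?f ` {k \<in> edge_codes n E. P (?f k)} = {e \<in> E. P e}"
  proof (intro equalityI subsetI)
    fix e assume e: "e \<in> {e \<in> E. P e}"
    then have "e \<in> ?f ` edge_codes n E" unfolding bij_betw_imp_surj_on[OF b] by blast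
    then show "e \<in> ?f ` {k \<in> edge_codes n E. P (?f k)}" using e by blast
  next
    fix e assume "e \<in> ?f ` {k \<in> edge_codes n E. P (?f k)}"
    then obtain k where "k \<in> edge_codes n E" "P (?f k)" "e = ?f k" by blast
    then show "e \<in> {e \<in> E. P e}" by (simp add: edge_codes_def)
  qed
  ultimately have "bij_betw ?f {k \<in> edge_codes n E. P (?f k)} {e \<in> E. P e}"
    unfolding bij_betw_def by (rule conjI)
  then show ?thesis by (rule bij_betw_same_card[symmetric])
qed

lemma cut_cost_eq_codes:
  assumes "graph n E"
  shows "cut_cost E S = card {k \<in> edge_codes n E. crosses_code n S k}"
proof -
  have "{k \<in> edge_codes n E. crosses S {k div n, k mod n}} = {k \<in> edge_codes n E. crosses_code n S k}"
    by (auto simp: edge_codes_def crosses_doubleton crosses_code_def)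
  then show ?thesis
    using card_edges_eq_codes[OF assms, of "crosses S"] by (simp add: cut_cost_def crosses_def)
qed

text \<open>Sorting by load is replaced by sweeps: each block of \<open>n * n\<close> time steps
  serves one value of the load, in increasing order, and visits all codes once.\<close>

definition active :: "nat \<Rightarrow> (nat \<Rightarrow> nat) \<Rightarrow> (nat \<Rightarrow> nat) \<Rightarrow> nat \<Rightarrow> bool" where
  "active n l c j \<longleftrightarrow> 0 < n \<and> (let k = j mod (n * n) in j div (n * n) = l k \<and> c (k div n) \<noteq> c (k mod n))"

text \<open>Kruskal's algorithm on all pairs of vertices: time \<open>j\<close> treats the code \<open>j mod (n * n)\<close> if
  its load is \<open>j div (n * n)\<close>. \<open>comp\<close> labels the components at time \<open>j\<close>.\<close>

primrec comp :: "nat \<Rightarrow> (nat \<Rightarrow> nat) \<Rightarrow> nat \<Rightarrow> nat \<Rightarrow> nat" where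
  "comp n l 0 = (\<lambda>w. w)"
| "comp n l (Suc j) = (let k = j mod (n * n); c = comp n l j in
     if active n l c j then (\<lambda>w. if c w = c (k div n) then c (k mod n) else c w) else c)"

text \<open>\<open>col\<close> is a colouring by parities in which a tree edge is bichromatic iff its mark is odd.\<close>

primrec col :: "nat \<Rightarrow> (nat \<Rightarrow> nat) \<Rightarrow> (nat \<Rightarrow> nat) \<Rightarrow> nat \<Rightarrow> nat \<Rightarrow> nat" where
  "col n l mk 0 = (\<lambda>w. 0)"
| "col n l mk (Suc j) = (let k = j mod (n * n); c = comp n l j; d = col n l mk j in
     if active n l c j
     then (\<lambda>w. if c w = c (k div n) then d w + (d (k div n) + d (k mod n) + mk k) else d w) else d)"

text \<open>The only time at which \<open>k\<close> can be active. The order of the keys is the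
  order of the loads, with ties broken by the code.\<close>

definition key :: "nat \<Rightarrow> (nat \<Rightarrow> nat) \<Rightarrow> nat \<Rightarrow> nat" where
  "key n l k = l k * (n * n) + k"

definition tree :: "nat \<Rightarrow> (nat \<Rightarrow> nat) \<Rightarrow> nat \<Rightarrow> nat set" where
  "tree n l J = {k. k < n * n \<and> key n l k < J \<and> active n l (comp n l (key n l k)) (key n l k)}"

lemma mult_add_div_mod:
  assumes "k < (N::nat)"
  shows "(a * N + k) div N = a" "(a * N + k) mod N = k"
  using assms by auto

lemma key_div_mod:
  assumes "k < n * n"
  shows "key n l k div (n * n) = l k" "key n l k mod (n * n) = k"
  unfolding key_def by (rule mult_add_div_mod[OF assms])+

lemma active_key: "active n l c j \<Longrightarrow> j = key n l (j mod (n * n))"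
  unfolding active_def key_def Let_def by (metis div_mult_mod_eq)

lemma active_mod_less: "active n l c j \<Longrightarrow> j mod (n * n) < n * n"
  by (simp add: active_def)

lemma finite_tree [simp]: "finite (tree n l J)"
  by (rule finite_subset[of _ "{..<n * n}"]) (auto simp: tree_def)

lemma tree_Suc:
  "tree n l (Suc j) = tree n l j \<union> (if active n l (comp n l j) j then {j mod (n * n)} else {})"
proof -
  have "k \<in> tree n l (Suc j) \<longleftrightarrow>
      k \<in> tree n l j \<union> (if active n l (comp n l j) j then {j mod (n * n)} else {})" for k
  proof (cases "key n l k = j \<and> k < n * n")
    case True
    then have "j mod (n * n) = k" using key_div_mod(2)[of k n l] by simp
    then show ?thesis using True by (auto simp: tree_def)
  next
    case False
    have "k \<noteq> j mod (n * n)" if "active n l (comp n l j) j"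
      using active_key[OF that] active_mod_less[OF that] False by metis
    then show ?thesis using False by (auto simp: tree_def less_Suc_eq)
  qed
  then show ?thesis by blast
qed

lemma not_in_tree: "active n l c j \<Longrightarrow> j mod (n * n) \<notin> tree n l j"
  using active_key[of n l c j] by (auto simp: tree_def)

lemma comp_mono:
  assumes "comp n l J u = comp n l J v" "J \<le> J'"
  shows "comp n l J' u = comp n l J' v"
  using assms(2) assms(1) by (induction J' rule: dec_induct) (auto simp: Let_def)

lemma comp_processed:
  assumes "k < n * n" "key n l k < J"
  shows "comp n l J (k div n) = comp n l J (k mod n)"
proof -
  let ?j = "key n l k"
  have "comp n l (Suc ?j) (k div n) = comp n l (Suc ?j) (k mod n)"
  proof (cases "active n l (comp n l ?j) ?j")
    case True
    then show ?thesis unfolding comp.simps(2) Let_def key_div_mod(2)[OF assms(1)] by simp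
  next
    case False
    have "0 < n" using assms(1) by (cases n) auto
    then have "comp n l ?j (k div n) = comp n l ?j (k mod n)"
      using False unfolding active_def Let_def key_div_mod[OF assms(1)] by simp
    then show ?thesis using False by simp
  qed
  then show ?thesis by (rule comp_mono) (use assms(2) in simp)
qed

text \<open>All pairs of vertices take part, not only edges, so the forest ends up spanning
  \<open>{..<n}\<close> even for a disconnected graph.\<close>

lemma comp_all_processed:
  assumes "\<And>k. k < n * n \<Longrightarrow> key n l k < J" "u < n" "v < n"
  shows "comp n l J u = comp n l J v"
proof -
  note p = pair_code[OF assms(2,3)]
  show ?thesis using comp_processed[OF p(1) assms(1)[OF p(1)]] unfolding p(2,3) .
qed

lemma card_comp_Suc:
  assumes "active n l (comp n l j) j"
  shows "Suc (card (comp n l (Suc j) ` {..<n})) = card (comp n l j ` {..<n})"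
proof -
  let ?k = "j mod (n * n)" and ?c = "comp n l j"
  have k: "?k < n * n" using assms by (rule active_mod_less)
  have ne: "?c (?k div n) \<noteq> ?c (?k mod n)" using assms by (simp add: active_def Let_def)
  have "comp n l (Suc j) ` {..<n} = ?c ` {..<n} - {?c (?k div n)}"
  proof (rule set_eqI, rule iffI)
    fix x assume "x \<in> comp n l (Suc j) ` {..<n}"
    then show "x \<in> ?c ` {..<n} - {?c (?k div n)}"
      using assms ne code_mod_less[OF k] by (auto simp: Let_def)
  next
    fix x assume "x \<in> ?c ` {..<n} - {?c (?k div n)}"
    then obtain w where "w < n" "x = ?c w" "?c w \<noteq> ?c (?k div n)" by auto
    then have "x = comp n l (Suc j) w" using assms by (simp add: Let_def)
    then show "x \<in> comp n l (Suc j) ` {..<n}" using \<open>w < n\<close> by blast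
  qed
  moreover have "?c (?k div n) \<in> ?c ` {..<n}" using code_div_less[OF k] by blast
  ultimately show ?thesis by (metis card_Suc_Diff1 finite_imageI finite_lessThan)
qed

lemma card_comp_tree:
  assumes "J0 \<le> J"
  shows "card (comp n l J ` {..<n}) + card {k \<in> tree n l J. J0 \<le> key n l k} = card (comp n l J0 ` {..<n})"
  using assms
proof (induction J rule: dec_induct)
  case base
  have "{k \<in> tree n l J0. J0 \<le> key n l k} = {}" by (auto simp: tree_def)
  then show ?case by (simp only: card.empty)
next
  case (step j)
  show ?case
  proof (cases "active n l (comp n l j) j")
    case True
    have "{k \<in> tree n l (Suc j). J0 \<le> key n l k} = insert (j mod (n * n)) {k \<in> tree n l j. J0 \<le> key n l k}"
      using True step.hyps active_key[OF True] by (auto simp: tree_Suc)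
    then have "card {k \<in> tree n l (Suc j). J0 \<le> key n l k} = Suc (card {k \<in> tree n l j. J0 \<le> key n l k})"
      using not_in_tree[OF True] by simp
    then show ?thesis using card_comp_Suc[OF True] step.IH by linarith
  next
    case False
    then have "tree n l (Suc j) = tree n l j" "comp n l (Suc j) = comp n l j"
      by (simp_all add: tree_Suc Let_def)
    then show ?thesis using step.IH by (simp only:)
  qed
qed

text \<open>Contract everything of load below \<open>t\<close>: at time \<open>t * (n * n)\<close>
  the components are the classes of a partition. The tree uses fewer codes of load at least
  \<open>t\<close> than there are classes, while every graph edge between classes has load at least
  \<open>t\<close>, and by \<open>OPT_mult_card_classes_le\<close> there are at least
  \<open>OPT / 2\<close> of these per class. So at every threshold the tree has at most
  \<open>2 / OPT\<close> times as many codes as the graph has edges.\<close>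

lemma OPT_mult_tree_le:
  assumes g: "graph n E" "2 \<le> n"
  shows "OPT n E * card {k \<in> tree n l J. t \<le> l k} \<le> 2 * card {k \<in> edge_codes n E. t \<le> l k}"
proof (cases "{k \<in> tree n l J. t \<le> l k} = {}")
  case False
  let ?J0 = "t * (n * n)" and ?T = "{k \<in> tree n l J. t \<le> l k}"
  let ?c = "comp n l ?J0"
  have key_iff: "t \<le> l k \<longleftrightarrow> ?J0 \<le> key n l k" if "k < n * n" for k
  proof
    assume "t \<le> l k"
    then have "?J0 \<le> l k * (n * n)" by (rule mult_le_mono1)
    then show "?J0 \<le> key n l k" unfolding key_def by (rule trans_le_add1)
  next
    assume "?J0 \<le> key n l k"
    then have "?J0 div (n * n) \<le> key n l k div (n * n)" by (rule div_le_mono)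
    then show "t \<le> l k" using that g(2) by (simp add: key_div_mod)
  qed
  obtain k0 where "k0 \<in> tree n l J" "t \<le> l k0" using False by blast
  then have J: "?J0 \<le> J" using key_iff[of k0] by (auto simp: tree_def)
  have T: "?T = {k \<in> tree n l J. ?J0 \<le> key n l k}" using key_iff by (auto simp: tree_def)
  have "card (comp n l J ` {..<n}) > 0" using g(2) by (auto simp: card_gt_0_iff lessThan_empty_iff)
  then have lt: "card ?T < card (?c ` {..<n})" using card_comp_tree[OF J, of n l] T by simp
  moreover have "card ?T > 0" using False by (auto simp: card_gt_0_iff)
  ultimately have "2 \<le> card (?c ` {..<n})" by simp
  note c = OPT_mult_card_classes_le[OF g(1) this]
  have "{k \<in> edge_codes n E. \<exists>u\<in>{k div n, k mod n}. \<exists>v\<in>{k div n, k mod n}. ?c u \<noteq> ?c v}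
      \<subseteq> {k \<in> edge_codes n E. t \<le> l k}"
  proof (rule subsetI)
    fix k assume a: "k \<in> {k \<in> edge_codes n E. \<exists>u\<in>{k div n, k mod n}. \<exists>v\<in>{k div n, k mod n}. ?c u \<noteq> ?c v}"
    then have k: "k \<in> edge_codes n E" "?c (k div n) \<noteq> ?c (k mod n)" by auto
    have kn: "k < n * n" using k(1) by (simp add: edge_codes_def)
    then have "\<not> key n l k < ?J0" using comp_processed[OF kn, of l ?J0] k(2) by blast
    then show "k \<in> {k \<in> edge_codes n E. t \<le> l k}" using key_iff[OF kn] k(1) by simp
  qed
  then have "card {k \<in> edge_codes n E. \<exists>u\<in>{k div n, k mod n}. \<exists>v\<in>{k div n, k mod n}. ?c u \<noteq> ?c v}
      \<le> card {k \<in> edge_codes n E. t \<le> l k}"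
    by (intro card_mono) auto
  then have "OPT n E * card (?c ` {..<n}) \<le> 2 * card {k \<in> edge_codes n E. t \<le> l k}"
    using c card_edges_eq_codes[OF g(1), of "\<lambda>e. \<exists>u\<in>e. \<exists>v\<in>e. ?c u \<noteq> ?c v"] by linarith
  moreover have "OPT n E * card ?T \<le> OPT n E * card (?c ` {..<n})" using lt by (intro mult_le_mono2) simp
  ultimately show ?thesis by linarith
next
  case True
  then have z: "card {k \<in> tree n l J. t \<le> l k} = 0" by (metis card.empty)
  show ?thesis unfolding z by simp
qed

text \<open>Loads do not exceed \<open>2 * (n * n)\<close> in the rounds \<open>i < n * n\<close>,
  so this many time steps reach every code.\<close>

definition kruskal_time :: "nat \<Rightarrow> nat" where
  "kruskal_time n = (2 * (n * n) + 2) * (n * n)"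

text \<open>Greedy tree packing: each round takes a minimum spanning tree with respect to the number of
  earlier trees through an edge. Pairs that are not edges start with a prohibitive load.\<close>

primrec load :: "nat \<Rightarrow> nat set set \<Rightarrow> nat \<Rightarrow> nat \<Rightarrow> nat" where
  "load n E 0 = (\<lambda>k. if k \<in> edge_codes n E then 0 else Suc (n * n))"
| "load n E (Suc i) =
     (\<lambda>k. load n E i k + of_bool (k \<in> tree n (load n E i) (kruskal_time n)))"

definition packed :: "nat \<Rightarrow> nat set set \<Rightarrow> nat \<Rightarrow> nat set" where
  "packed n E i = tree n (load n E i) (kruskal_time n)"

lemma load_Suc_packed: "load n E (Suc i) k = load n E i k + of_bool (k \<in> packed n E i)"
  by (simp add: packed_def)

lemma load_edge_le: "k \<in> edge_codes n E \<Longrightarrow> load n E i k \<le> i"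
  by (induction i) (auto simp: of_bool_def)

lemma load_non_edge_ge: "k \<notin> edge_codes n E \<Longrightarrow> Suc (n * n) \<le> load n E i k"
  by (induction i) auto

lemma load_le: "load n E i k \<le> Suc (n * n) + i"
  by (induction i) (auto simp: of_bool_def)

lemma load_gt_iff: "i \<le> n * n \<Longrightarrow> n * n < load n E i k \<longleftrightarrow> k \<notin> edge_codes n E"
  using load_edge_le[of k n E i] load_non_edge_ge[of k n E i] by (cases "k \<in> edge_codes n E") auto

lemma key_load_less:
  assumes "k < n * n" "i < n * n"
  shows "key n (load n E i) k < kruskal_time n"
proof -
  have "load n E i k \<le> 2 * (n * n)" using load_le[of n E i k] assms(2) by simp
  then have "key n (load n E i) k \<le> 2 * (n * n) * (n * n) + k"
    unfolding key_def by (intro add_right_mono mult_le_mono1)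
  then show ?thesis using assms(1) by (simp add: kruskal_time_def add_mult_distrib)
qed

text \<open>The counting inequality at threshold \<open>Suc (n * n)\<close>: no edge has such a
  load, so with \<open>OPT > 0\<close> no tree member has it either. Connectedness enters only
  through \<open>OPT > 0\<close>.\<close>

lemma packed_subset_edges:
  assumes g: "graph n E" "2 \<le> n" "0 < OPT n E" and i: "i \<le> n * n"
  shows "packed n E i \<subseteq> edge_codes n E"
proof -
  have e0: "{k \<in> edge_codes n E. Suc (n * n) \<le> load n E i k} = {}"
    using load_edge_le[of _ n E i] i by fastforce
  then have c0: "card {k \<in> edge_codes n E. Suc (n * n) \<le> load n E i k} = 0"
    by (metis card.empty)
  have "OPT n E * card {k \<in> packed n E i. Suc (n * n) \<le> load n E i k} \<le>
      2 * card {k \<in> edge_codes n E. Suc (n * n) \<le> load n E i k}"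
    unfolding packed_def by (rule OPT_mult_tree_le[OF g(1,2)])
  then have "OPT n E * card {k \<in> packed n E i. Suc (n * n) \<le> load n E i k} = 0"
    using c0 by linarith
  then have "card {k \<in> packed n E i. Suc (n * n) \<le> load n E i k} = 0"
    using g(3) by (metis mult_is_0 neq0_conv)
  moreover have "finite {k \<in> packed n E i. Suc (n * n) \<le> load n E i k}" by (simp add: packed_def)
  ultimately have e: "{k \<in> packed n E i. Suc (n * n) \<le> load n E i k} = {}" by (simp only: card_0_eq)
  show ?thesis
  proof
    fix k assume "k \<in> packed n E i"
    then have "\<not> Suc (n * n) \<le> load n E i k" using e by blast
    then show "k \<in> edge_codes n E" using load_non_edge_ge[of k n E i] by blast
  qed
qed

section \<open>The exponential potential of the packing\<close>

lemma two_power_eq_sum: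
  assumes "x \<le> M"
  shows "(2::nat) ^ x = (\<Sum>t\<le>M. (if t = 0 then 1 else 2 ^ (t - 1)) * of_bool (t \<le> x))"
proof -
  have "(\<Sum>t\<le>M. (if t = 0 then 1 else 2 ^ (t - 1)) * of_bool (t \<le> x)) =
      (\<Sum>t\<le>x. if t = 0 then 1 else (2::nat) ^ (t - 1))"
    using assms by (intro sum.mono_neutral_cong_right) auto
  also have "\<dots> = 2 ^ x" by (induction x) auto
  finally show ?thesis by simp
qed

text \<open>Layer-cake summation: it converts a sum of \<open>2 ^ f k\<close> into counts of the
  sets \<open>t \<le> f k\<close>, the form in which \<open>OPT_mult_tree_le\<close> compares tree
  and graph.\<close>

lemma sum_two_power:
  assumes "finite A" "\<And>k. k \<in> A \<Longrightarrow> f k \<le> M"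
  shows "(\<Sum>k\<in>A. (2::nat) ^ f k) = (\<Sum>t\<le>M. (if t = 0 then 1 else 2 ^ (t - 1)) * card {k \<in> A. t \<le> f k})"
proof -
  have "(\<Sum>k\<in>A. (2::nat) ^ f k) =
      (\<Sum>k\<in>A. \<Sum>t\<le>M. (if t = 0 then 1 else 2 ^ (t - 1)) * of_bool (t \<le> f k))"
    by (rule sum.cong[OF refl two_power_eq_sum[OF assms(2)]])
  also have "\<dots> = (\<Sum>t\<le>M. \<Sum>k\<in>A. (if t = 0 then 1 else 2 ^ (t - 1)) * of_bool (t \<le> f k))"
    by (rule sum.swap)
  also have "\<dots> = (\<Sum>t\<le>M. (if t = 0 then 1 else 2 ^ (t - 1)) * (\<Sum>k\<in>A. of_bool (t \<le> f k)))"
    by (simp only: sum_distrib_left)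
  also have "\<dots> = (\<Sum>t\<le>M. (if t = 0 then 1 else 2 ^ (t - 1)) * card {k \<in> A. t \<le> f k})"
  proof -
    have "(\<Sum>k\<in>A. of_bool (t \<le> f k)) = card {k \<in> A. t \<le> f k}" for t
      using assms(1) by (simp add: of_bool_def sum.If_cases Int_def)
    then show ?thesis by (simp only:)
  qed
  finally show ?thesis .
qed

definition potential :: "nat \<Rightarrow> nat set set \<Rightarrow> nat \<Rightarrow> nat" where
  "potential n E i = (\<Sum>k\<in>edge_codes n E. 2 ^ load n E i k)"

text \<open>A tree edge doubles its term, so the potential grows by the share of the tree, at most
  \<open>2 / OPT\<close> of it. The inequality is multiplied out to stay in the natural
  numbers.\<close>

lemma potential_Suc_le:
  assumes g: "graph n E" "2 \<le> n" "0 < OPT n E" and i: "i \<le> n * n"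
  shows "OPT n E * potential n E (Suc i) \<le> (OPT n E + 2) * potential n E i"
proof -
  let ?l = "load n E i" and ?T = "packed n E i" and ?C = "edge_codes n E" and ?k = "OPT n E"
  let ?a = "\<lambda>t. if t = 0 then 1 else 2 ^ (t - 1) :: nat"
  have T: "?T \<subseteq> ?C" by (rule packed_subset_edges[OF g i])
  have "potential n E (Suc i) = (\<Sum>k\<in>?C. 2 ^ ?l k + (if k \<in> ?T then 2 ^ ?l k else 0))"
    unfolding potential_def by (rule sum.cong) (auto simp: packed_def)
  also have "\<dots> = potential n E i + (\<Sum>k\<in>?T. 2 ^ ?l k)"
    using T by (simp add: sum.distrib potential_def sum.If_cases Int_absorb1)
  finally have 1: "potential n E (Suc i) = potential n E i + (\<Sum>k\<in>?T. 2 ^ ?l k)" .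
  have le: "?l k \<le> i" if "k \<in> ?C" for k using that by (rule load_edge_le)
  have "?k * (\<Sum>k\<in>?T. 2 ^ ?l k) = ?k * (\<Sum>t\<le>i. ?a t * card {k \<in> ?T. t \<le> ?l k})"
    using T le by (subst sum_two_power[of ?T ?l i]) (auto simp: packed_def)
  also have "\<dots> = (\<Sum>t\<le>i. ?a t * (?k * card {k \<in> ?T. t \<le> ?l k}))"
    by (simp only: sum_distrib_left mult.left_commute)
  also have "\<dots> \<le> (\<Sum>t\<le>i. ?a t * (2 * card {k \<in> ?C. t \<le> ?l k}))"
    unfolding packed_def by (intro sum_mono mult_le_mono2 OPT_mult_tree_le g)
  also have "\<dots> = 2 * (\<Sum>t\<le>i. ?a t * card {k \<in> ?C. t \<le> ?l k})"
    by (simp only: sum_distrib_left mult.left_commute)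
  also have "\<dots> = 2 * potential n E i"
    unfolding potential_def using le by (subst sum_two_power[of ?C ?l i]) auto
  finally show ?thesis using 1 by (simp add: algebra_simps)
qed

lemma potential_le:
  assumes g: "graph n E" "2 \<le> n" "0 < OPT n E"
  shows "i \<le> n * n \<Longrightarrow> OPT n E ^ i * potential n E i \<le> (OPT n E + 2) ^ i * card E"
proof (induction i)
  case 0
  have "potential n E 0 = card (edge_codes n E)" by (simp add: potential_def)
  also have "\<dots> = card E" using bij_betw_same_card[OF bij_betw_edge_codes[OF g(1)]] .
  finally show ?case by simp
next
  case (Suc i)
  have "OPT n E ^ Suc i * potential n E (Suc i) = OPT n E ^ i * (OPT n E * potential n E (Suc i))"
    by simp
  also have "\<dots> \<le> OPT n E ^ i * ((OPT n E + 2) * potential n E i)"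
    using Suc.prems by (intro mult_le_mono2 potential_Suc_le[OF g]) simp
  also have "\<dots> = (OPT n E + 2) * (OPT n E ^ i * potential n E i)" by (rule mult.left_commute)
  also have "\<dots> \<le> (OPT n E + 2) * ((OPT n E + 2) ^ i * card E)"
    using Suc.IH Suc.prems by (intro mult_le_mono2) simp
  finally show ?case by (simp only: power_Suc mult.assoc)
qed

lemma card_edges_less: "graph n E \<Longrightarrow> card E < 2 ^ n"
proof -
  assume g: "graph n E"
  have "E \<subset> Pow {..<n}" using g by (auto simp: graph_def)
  then have "card E < card (Pow {..<n})" by (intro psubset_card_mono) auto
  then show ?thesis by (simp add: card_Pow)
qed

lemma exp_2_le: "exp (2::real) \<le> 8"
proof -
  have "exp (2::real) = exp 1 ^ 2" by (simp add: exp_of_nat_mult[symmetric])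
  also have "\<dots> \<le> 2.72 ^ 2" using e_less_272 by (intro power_mono) auto
  finally show ?thesis by (simp add: power2_eq_square)
qed

text \<open>\<open>(1 + 2 / k) ^ N \<le> exp (2 * N / k)\<close>; raising to the power
  \<open>k\<close> removes the division, and \<open>exp 2 \<le> 8\<close>.\<close>

lemma growth_bound:
  fixes k N x m :: nat
  assumes k: "0 < k" and le: "k ^ N * 2 ^ x \<le> (k + 2) ^ N * m"
  shows "(2::real) ^ (x * k) \<le> 8 ^ N * real m ^ k"
proof -
  let ?E = "exp (2 / real k)"
  have "real (k ^ N * 2 ^ x) \<le> real ((k + 2) ^ N * m)" using le by (simp only: of_nat_le_iff)
  then have "real k ^ N * 2 ^ x \<le> (real k + 2) ^ N * real m"
    by (simp only: of_nat_mult of_nat_power of_nat_add of_nat_numeral)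
  also have "\<dots> \<le> (real k * ?E) ^ N * real m"
  proof (intro mult_right_mono power_mono)
    have "real k * (1 + 2 / real k) \<le> real k * ?E"
      by (intro mult_left_mono exp_ge_add_one_self) simp
    then show "real k + 2 \<le> real k * ?E" using k by (simp add: distrib_left)
  qed simp_all
  finally have "real k ^ N * 2 ^ x \<le> real k ^ N * (?E ^ N * real m)"
    by (simp only: power_mult_distrib mult.assoc)
  then have "2 ^ x \<le> ?E ^ N * real m" using k by simp
  then have "(2 ^ x) ^ k \<le> (?E ^ N * real m) ^ k" by (intro power_mono) simp_all
  also have "\<dots> = (?E ^ k) ^ N * real m ^ k"
    by (simp only: power_mult_distrib power_mult[symmetric] mult.commute)
  also have "?E ^ k = exp 2" using k by (simp add: exp_of_nat_mult[symmetric])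
  also have "exp 2 ^ N * real m ^ k \<le> 8 ^ N * real m ^ k"
    using exp_2_le by (intro mult_right_mono power_mono) simp_all
  finally show ?thesis by (simp only: power_mult)
qed

text \<open>Otherwise \<open>16 ^ N \<le> 8 ^ N * m ^ OPT\<close> with \<open>N = n * n\<close> and
  \<open>m = card E\<close>, so \<open>2 ^ N \<le> m ^ OPT\<close>, against \<open>m < 2 ^ n\<close>
  and \<open>OPT < n\<close>. With \<open>n * n\<close> rounds the initial potential
  \<open>m\<close> is absorbed in this way.\<close>

lemma load_OPT_less:
  assumes g: "graph n E" "2 \<le> n" "0 < OPT n E" and k: "k \<in> edge_codes n E"
  shows "load n E (n * n) k * OPT n E < 4 * (n * n)"
proof (rule ccontr)
  let ?k = "OPT n E" and ?N = "n * n" and ?m = "card E"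
  let ?x = "load n E ?N k"
  assume "\<not> ?x * ?k < 4 * ?N"
  then have big: "4 * ?N \<le> ?x * ?k" by simp
  have "2 ^ ?x \<le> potential n E ?N"
    unfolding potential_def using k by (intro member_le_sum) auto
  then have "?k ^ ?N * 2 ^ ?x \<le> ?k ^ ?N * potential n E ?N" by (rule mult_le_mono2)
  also have "\<dots> \<le> (?k + 2) ^ ?N * ?m" by (rule potential_le[OF g order_refl])
  finally have "?k ^ ?N * 2 ^ ?x \<le> (?k + 2) ^ ?N * ?m" .
  with g(3) have "(2::real) ^ (?x * ?k) \<le> 8 ^ ?N * real ?m ^ ?k" by (rule growth_bound)
  moreover have "(2::real) ^ (4 * ?N) \<le> 2 ^ (?x * ?k)" using big by (intro power_increasing) auto
  moreover have "(2::real) ^ (4 * ?N) = 8 ^ ?N * 2 ^ ?N"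
    by (simp only: power_mult power_mult_distrib[symmetric]) simp
  ultimately have "(8::real) ^ ?N * 2 ^ ?N \<le> 8 ^ ?N * real ?m ^ ?k" by linarith
  then have "(2::real) ^ ?N \<le> real ?m ^ ?k" by simp
  also have "\<dots> < (2 ^ n) ^ ?k"
  proof (rule power_strict_mono)
    show "real ?m < 2 ^ n" using card_edges_less[OF g(1)] by (simp flip: of_nat_less_iff)
  qed (use g(3) in auto)
  also have "\<dots> \<le> 2 ^ ?N"
    unfolding power_mult[symmetric] using OPT_less[OF g(1,2)] by (intro power_increasing) auto
  finally show False by simp
qed

text \<open>A cheap cut is crossed at most 7 times by some tree of the packing: otherwise one of its
  edges would be overloaded.\<close>

lemma packed_crosses_few:
  assumes g: "graph n E" "2 \<le> n" "0 < OPT n E" and S: "is_cut n S" "cut_cost E S \<le> 2 * OPT n E"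
  obtains i where "i < n * n" "card {k \<in> packed n E i. crosses_code n S k} \<le> 7"
proof (rule ccontr)
  assume no: "\<not> thesis"
  note found = that
  have many: "8 \<le> card {k \<in> packed n E i. crosses_code n S k}" if i: "i < n * n" for i
  proof (rule ccontr)
    assume "\<not> 8 \<le> card {k \<in> packed n E i. crosses_code n S k}"
    then have "card {k \<in> packed n E i. crosses_code n S k} \<le> 7" by linarith
    then show False using found[OF i] no by blast
  qed
  let ?D = "{k \<in> edge_codes n E. crosses_code n S k}" and ?N = "n * n"
  have load_sum: "load n E j k = (\<Sum>i<j. of_bool (k \<in> packed n E i))" if "k \<in> ?D" for j k
    using that by (induction j) (auto simp: packed_def)
  have "8 * ?N \<le> (\<Sum>i<?N. card {k \<in> packed n E i. crosses_code n S k})"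
    using sum_bounded_below[of "{..<?N}" 8 "\<lambda>i. card {k \<in> packed n E i. crosses_code n S k}"] many
    by (simp add: mult.commute)
  also have "\<dots> = (\<Sum>i<?N. \<Sum>k\<in>?D. of_bool (k \<in> packed n E i))"
  proof (rule sum.cong[OF refl])
    fix i assume "i \<in> {..<?N}"
    then have "packed n E i \<subseteq> edge_codes n E" by (intro packed_subset_edges g) simp
    then have "{k \<in> packed n E i. crosses_code n S k} = ?D \<inter> {k. k \<in> packed n E i}" by auto
    then show "card {k \<in> packed n E i. crosses_code n S k} = (\<Sum>k\<in>?D. of_bool (k \<in> packed n E i))"
      by (simp add: of_bool_def sum.If_cases)
  qed
  also have "\<dots> = (\<Sum>k\<in>?D. load n E ?N k)"
    by (subst sum.swap) (simp add: load_sum)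
  finally have sum: "8 * ?N \<le> (\<Sum>k\<in>?D. load n E ?N k)" .
  \<comment> \<open>The origin of 7: at most \<open>2 * OPT\<close> edges, each of load below
    \<open>4 * N / OPT\<close>, carry fewer than \<open>8 * N\<close> crossings, but 8 crossings in
    each of the \<open>N\<close> trees would require that many.\<close>
  have "OPT n E * (8 * ?N) \<le> (\<Sum>k\<in>?D. load n E ?N k * OPT n E)"
    using mult_le_mono2[OF sum, of "OPT n E"] by (simp add: sum_distrib_left mult.commute)
  also have "\<dots> \<le> (\<Sum>k\<in>?D. 4 * ?N - 1)"
  proof (rule sum_mono)
    fix k assume "k \<in> ?D"
    then show "load n E ?N k * OPT n E \<le> 4 * ?N - 1" using load_OPT_less[OF g, of k] by simp
  qed
  also have "\<dots> = cut_cost E S * (4 * ?N - 1)" using cut_cost_eq_codes[OF g(1)] by simp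
  also have "\<dots> \<le> 2 * OPT n E * (4 * ?N - 1)" using S(2) by (rule mult_le_mono1)
  also have "\<dots> < 2 * OPT n E * (4 * ?N)" using g(2,3) by simp
  finally show False by simp
qed

text \<open>Parities along tree paths. When two components are joined, the whole absorbed one is
  shifted by the same amount, which keeps all parities of differences inside it and is chosen so
  that the new tree edge gets the parity of its mark. Only vertices of one component are
  comparable.\<close>

lemma col_eq:
  assumes "\<And>k. k \<in> tree n l J \<Longrightarrow> odd (mk k) \<longleftrightarrow> crosses_code n S k" "comp n l J u = comp n l J v"
  shows "odd (col n l mk J u + col n l mk J v) \<longleftrightarrow> (u \<in> S) \<noteq> (v \<in> S)"
  using assms
proof (induction J arbitrary: u v)
  case (Suc j)
  have IH: "comp n l j u = comp n l j v \<Longrightarrow>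
      odd (col n l mk j u + col n l mk j v) \<longleftrightarrow> (u \<in> S) \<noteq> (v \<in> S)" for u v
    using Suc.IH Suc.prems(1) by (auto simp: tree_Suc)
  show ?case
  proof (cases "active n l (comp n l j) j")
    case False
    then show ?thesis using IH Suc.prems(2) by (simp add: Let_def)
  next
    case True
    let ?k = "j mod (n * n)" and ?c = "comp n l j" and ?d = "col n l mk j"
    let ?a = "?k div n" and ?b = "?k mod n"
    have mk: "odd (mk ?k) \<longleftrightarrow> (?a \<in> S) \<noteq> (?b \<in> S)"
      using Suc.prems(1)[of ?k] True by (simp add: tree_Suc crosses_code_def)
    have c: "(if ?c u = ?c ?a then ?c ?b else ?c u) = (if ?c v = ?c ?a then ?c ?b else ?c v)"
      using Suc.prems(2) True by (simp add: Let_def)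
    have d: "col n l mk (Suc j) w = (if ?c w = ?c ?a then ?d w + (?d ?a + ?d ?b + mk ?k) else ?d w)" for w
      using True by (simp add: Let_def)
    consider "?c u = ?c ?a" "?c v = ?c ?a" | "?c u = ?c ?a" "?c v = ?c ?b" "?c v \<noteq> ?c ?a"
      | "?c u = ?c ?b" "?c v = ?c ?a" "?c u \<noteq> ?c ?a" | "?c u = ?c v" "?c u \<noteq> ?c ?a" "?c v \<noteq> ?c ?a"
      using c by (auto split: if_splits)
    then show ?thesis
    proof cases
      case 1
      then have "?c u = ?c v" by simp
      from IH[OF this] show ?thesis unfolding d using 1 by simp argo
    next
      case 2
      from IH[OF 2(1)] IH[OF 2(2)] show ?thesis unfolding d using 2 mk by simp argo
    next
      case 3
      from IH[OF 3(1)] IH[OF 3(2)] show ?thesis unfolding d using 3 mk by simp argo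
    next
      case 4
      from IH[OF 4(1)] show ?thesis unfolding d using 4 by simp
    qed
  qed
qed simp

lemma col_parity_stable:
  assumes "comp n l J u = comp n l J v" "J \<le> J'"
  shows "odd (col n l mk J' u + col n l mk J' v) \<longleftrightarrow> odd (col n l mk J u + col n l mk J v)"
  using assms(2)
proof (induction J' rule: dec_induct)
  case (step j)
  have "comp n l j u = comp n l j v" using comp_mono[OF assms(1)] step.hyps by simp
  then show ?case using step.IH by (auto simp: Let_def)
qed simp

text \<open>Here the marks are arbitrary: every marking of a forest is realized by a colouring.
  \<open>candidates_zero\<close> needs this for marks that come from no given cut.\<close>

lemma col_tree:
  assumes "k \<in> tree n l J"
  shows "odd (col n l mk J (k div n) + col n l mk J (k mod n)) \<longleftrightarrow> odd (mk k)"
proof -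
  let ?j = "key n l k"
  have k: "k < n * n" "?j < J" "active n l (comp n l ?j) ?j" using assms by (auto simp: tree_def)
  note m = key_div_mod(2)[OF k(1), of l]
  have ne: "comp n l ?j (k div n) \<noteq> comp n l ?j (k mod n)"
    using k(3) m by (simp add: active_def Let_def)
  have "odd (col n l mk (Suc ?j) (k div n) + col n l mk (Suc ?j) (k mod n)) \<longleftrightarrow> odd (mk k)"
    using k(3) m ne by (auto simp: Let_def)
  moreover have "comp n l (Suc ?j) (k div n) = comp n l (Suc ?j) (k mod n)"
    using k(1) by (intro comp_processed) auto
  ultimately show ?thesis using col_parity_stable[of n l "Suc ?j" "k div n" "k mod n" J mk] k(2) by simp
qed

text \<open>\<open>x\<close> lists seven codes as digits in base \<open>n * n\<close>; a digit marks
  its code, and only the parity matters. In the rounds of the packing the last summand marks exactly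
  the non-edges: it vanishes on the packed trees when \<open>OPT > 0\<close> and produces the cut of
  cost 0 in a disconnected graph.\<close>

definition mark :: "nat \<Rightarrow> (nat \<Rightarrow> nat) \<Rightarrow> nat \<Rightarrow> nat \<Rightarrow> nat" where
  "mark n l x k = (\<Sum>d<7. of_bool (x div (n * n) ^ d mod (n * n) = k)) + of_bool (n * n < l k)"

definition colour_of :: "nat \<Rightarrow> nat set set \<Rightarrow> nat \<Rightarrow> nat \<Rightarrow> nat \<Rightarrow> nat" where
  "colour_of n E i x = col n (load n E i) (mark n (load n E i) x) (kruskal_time n)"

definition candidate :: "nat \<Rightarrow> nat set set \<Rightarrow> nat \<Rightarrow> nat \<Rightarrow> nat set" where
  "candidate n E i x = {v. v < n \<and> odd (colour_of n E i x v + colour_of n E i x 0)}"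

definition candidates :: "nat \<Rightarrow> nat set set \<Rightarrow> nat set set" where
  "candidates n E = (\<lambda>(i, x). candidate n E i x) ` ({..<n * n} \<times> {..<(n * n) ^ 7}) - {{}}"

lemma candidates_is_cut: "S \<in> candidates n E \<Longrightarrow> is_cut n S \<and> 0 \<notin> S"
proof -
  assume "S \<in> candidates n E"
  then obtain i x where S: "S = candidate n E i x" "S \<noteq> {}" by (auto simp: candidates_def)
  have "0 \<notin> S" by (simp add: S(1) candidate_def)
  moreover have "S \<subseteq> {..<n}" by (auto simp: S(1) candidate_def)
  moreover have "0 < n" using S(2) by (auto simp: S(1) candidate_def)
  ultimately show ?thesis using S(2) by (auto simp: is_cut_def)
qed

lemma card_candidates_le: "card (candidates n E) \<le> (n * n) ^ 8"
proof -
  have "card (candidates n E) \<le> card ((\<lambda>(i, x). candidate n E i x) ` ({..<n * n} \<times> {..<(n * n) ^ 7}))"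
    unfolding candidates_def by (intro card_mono) auto
  also have "\<dots> \<le> card ({..<n * n} \<times> {..<(n * n) ^ 7})" by (rule card_image_le) simp
  also have "\<dots> = (n * n) ^ 8" by (simp add: card_cartesian_product power_numeral_reduce)
  finally show ?thesis .
qed

section \<open>Every cheap cut is a candidate\<close>

lemma digits_exist:
  assumes "\<forall>d\<in>set ds. d < (b::nat)"
  shows "\<exists>x < b ^ length ds. \<forall>d < length ds. x div b ^ d mod b = ds ! d"
  using assms
proof (induction ds)
  case (Cons a ds)
  then obtain x where x: "x < b ^ length ds" "\<forall>d < length ds. x div b ^ d mod b = ds ! d" by auto
  have a: "a < b" using Cons.prems by simp
  have "x * b + a < Suc x * b" using a by simp
  also have "\<dots> \<le> b ^ length ds * b" using x(1) by (intro mult_le_mono1) simp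
  finally have "x * b + a < b ^ length (a # ds)" by (simp add: mult.commute)
  moreover have "(x * b + a) div b ^ d mod b = (a # ds) ! d" if "d < length (a # ds)" for d
  proof (cases d)
    case 0
    then show ?thesis using a by simp
  next
    case (Suc d')
    have "(x * b + a) div b ^ d = (x * b + a) div b div b ^ d'"
      by (simp add: Suc div_mult2_eq)
    also have "(x * b + a) div b = x" using a by simp
    finally show ?thesis using x(2) that Suc by simp
  qed
  ultimately show ?case by blast
qed simp

text \<open>Code 0 is the pair (0, 0), which is never active. Digit 0 can therefore pad lists of
  fewer than seven codes.\<close>

lemma zero_notin_tree: "0 \<notin> tree n l J"
proof
  assume "0 \<in> tree n l J"
  then have "0 < n * n" "active n l (comp n l (key n l 0)) (key n l 0)" by (auto simp: tree_def)
  then show False using key_div_mod(2)[of 0 n l] by (simp add: active_def Let_def)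
qed

lemma marks_exist:
  assumes R: "R \<subseteq> {..<b}" "card R \<le> 7" and b: "0 < (b::nat)"
  shows "\<exists>x<b ^ 7. \<forall>k. k \<noteq> 0 \<longrightarrow> (\<Sum>d<7. of_bool (x div b ^ d mod b = k)) = (of_bool (k \<in> R) :: nat)"
proof -
  have "finite R" using R(1) finite_subset by blast
  then obtain rs where rs: "set rs = R" "distinct rs" using finite_distinct_list by blast
  then have len: "length rs \<le> 7" using R(2) distinct_card by fastforce
  define ds where "ds = rs @ replicate (7 - length rs) 0"
  have l: "length ds = 7" using len by (simp add: ds_def)
  have "\<forall>d\<in>set ds. d < b" using R(1) rs(1) b by (auto simp: ds_def)
  from digits_exist[OF this] obtain x where x: "x < b ^ 7" "\<forall>d<7. x div b ^ d mod b = ds ! d"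
    using l by auto
  have "(\<Sum>d<7. of_bool (x div b ^ d mod b = k)) = (of_bool (k \<in> R) :: nat)" if "k \<noteq> 0" for k
  proof -
    have "(\<Sum>d<7. of_bool (x div b ^ d mod b = k)) = (\<Sum>d<length ds. of_bool (ds ! d = k) :: nat)"
      unfolding l using x(2) by (intro sum.cong) auto
    also have "\<dots> = card {d. d < length ds \<and> ds ! d = k}"
      by (simp add: of_bool_def sum.If_cases Int_def)
    also have "\<dots> = count_list ds k"
      by (simp add: count_list_eq_length_filter length_filter_conv_card eq_commute)
    also have "\<dots> = count_list rs k"
      using that by (simp add: ds_def)
    also have "\<dots> = of_bool (k \<in> set rs)"
      using rs(2) by (induction rs) auto
    also have "\<dots> = of_bool (k \<in> R)" by (simp only: rs(1))
    finally show ?thesis .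
  qed
  with x(1) show ?thesis by (intro exI[of _ x] conjI allI impI)
qed

text \<open>A tree that crosses \<open>S\<close> at most 7 times admits an \<open>x\<close> whose
  nonzero digits are exactly those crossings; since the tree spans, \<open>col_eq\<close> recovers
  \<open>S\<close> from the parities relative to vertex 0.\<close>

lemma candidates_complete:
  assumes g: "graph n E" "2 \<le> n" "0 < OPT n E"
  shows "small_cuts n E \<subseteq> candidates n E"
proof
  fix S assume "S \<in> small_cuts n E"
  then have S: "is_cut n S" "0 \<notin> S" "cut_cost E S \<le> 2 * OPT n E" by (auto simp: small_cuts_def)
  obtain i where i: "i < n * n" "card {k \<in> packed n E i. crosses_code n S k} \<le> 7"
    using packed_crosses_few[OF g S(1,3)] .
  let ?l = "load n E i"
  have T: "packed n E i \<subseteq> edge_codes n E" using i(1) by (intro packed_subset_edges g) simp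
  let ?R = "{k \<in> packed n E i. crosses_code n S k}"
  have R: "?R \<subseteq> {..<n * n}" using T by (auto simp: edge_codes_def)
  have N: "0 < n * n" using g(2) by simp
  from marks_exist[OF R i(2) N] obtain x where x: "x < (n * n) ^ 7"
    "\<forall>k. k \<noteq> 0 \<longrightarrow> (\<Sum>d<7. of_bool (x div (n * n) ^ d mod (n * n) = k)) = (of_bool (k \<in> ?R) :: nat)"
    by (elim exE conjE)
  have "odd (mark n ?l x k) \<longleftrightarrow> crosses_code n S k" if k: "k \<in> tree n ?l (kruskal_time n)" for k
  proof -
    have kp: "k \<in> packed n E i" using k unfolding packed_def .
    have "k \<noteq> 0" using k zero_notin_tree by metis
    then have 1: "(\<Sum>d<7. of_bool (x div (n * n) ^ d mod (n * n) = k)) = (of_bool (k \<in> ?R) :: nat)"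
      using x(2) by blast
    have 2: "\<not> n * n < ?l k" using load_gt_iff[of i n E k] T kp i(1) by auto
    show ?thesis unfolding mark_def 1 using kp 2 by simp
  qed
  note col = col_eq[where mk = "mark n ?l x", OF this]
  have "v \<in> candidate n E i x \<longleftrightarrow> v \<in> S" for v
  proof (cases "v < n")
    case True
    have "comp n ?l (kruskal_time n) v = comp n ?l (kruskal_time n) 0"
      using True i(1) by (intro comp_all_processed key_load_less) auto
    then show ?thesis using col S(2) True by (simp add: candidate_def colour_of_def)
  next
    case False
    then show ?thesis using S(1) by (auto simp: candidate_def is_cut_def)
  qed
  then have "S = candidate n E i x" by blast
  then show "S \<in> candidates n E" using i(1) x(1) S(1) by (auto simp: candidates_def is_cut_def)
qed

text \<open>In a disconnected graph the first tree, with exactly its non-edges marked, gives a cut of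
  cost 0.\<close>

lemma candidates_zero:
  assumes g: "graph n E" "2 \<le> n" "OPT n E = 0"
  obtains S where "S \<in> candidates n E" "cut_cost E S = 0"
proof -
  let ?l = "load n E 0" and ?J = "kruskal_time n" and ?Z = "Suc (n * n) * (n * n)"
  let ?mk = "mark n (load n E 0) 0"
  let ?S = "candidate n E 0 0"
  have N: "0 < n * n" using g(2) by simp
  have J: "?Z \<le> ?J" by (simp add: kruskal_time_def)
  have mk: "odd (?mk k) \<longleftrightarrow> k \<notin> edge_codes n E" if "k \<in> tree n ?l J" for k J
  proof -
    have "k \<noteq> 0" using that zero_notin_tree by metis
    then show ?thesis using N by (simp add: mark_def)
  qed
  have same: "comp n ?l ?J u = comp n ?l ?J v" if "u < n" "v < n" for u v
    by (rule comp_all_processed[OF key_load_less[OF _ N] that])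
  have mono: "even (col n ?l ?mk ?J (k div n) + col n ?l ?mk ?J (k mod n))" if k: "k \<in> edge_codes n E" for k
  proof -
    \<comment> \<open>Up to time \<open>?Z\<close> only codes of load 0, that is edges, can enter
      the forest; all their marks are even, which is the crossing pattern of the empty set.\<close>
    have m: "odd (?mk h) \<longleftrightarrow> crosses_code n {} h" if h: "h \<in> tree n ?l ?Z" for h
    proof -
      have "h \<in> edge_codes n E"
      proof (rule ccontr)
        assume "h \<notin> edge_codes n E"
        then have l: "?l h = Suc (n * n)" by simp
        have "?Z \<le> key n ?l h" unfolding key_def l by (rule le_add1)
        moreover have "key n ?l h < ?Z" using h unfolding tree_def by blast
        ultimately show False by linarith
      qed
      then show ?thesis using mk[OF h] by (simp only: crosses_code_def) simp
    qed
    have kn: "k < n * n" using k by (simp add: edge_codes_def)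
    have l: "?l k = 0" using k by simp
    have "key n ?l k < ?Z" unfolding key_def l using kn by simp
    with kn have e: "comp n ?l ?Z (k div n) = comp n ?l ?Z (k mod n)" by (rule comp_processed)
    have "odd (col n ?l ?mk ?Z (k div n) + col n ?l ?mk ?Z (k mod n)) \<longleftrightarrow>
        (k div n \<in> {}) \<noteq> (k mod n \<in> {})"
      using m e by (rule col_eq)
    then show ?thesis using col_parity_stable[OF e J, of ?mk] by blast
  qed
  obtain C where C: "is_cut n C" "cut_cost E C = 0" using OPT_attained[OF g(2), of E] g(3) by metis
  then have C0: "\<not> crosses_code n C k" if "k \<in> edge_codes n E" for k
    using cut_cost_eq_codes[OF g(1), of C] that by auto
  \<comment> \<open>If only edges were used, all marks would be even and fit both the zero cut
    \<open>C\<close> and the empty set; two vertices separated by \<open>C\<close> would then have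
    colours of both different and equal parity.\<close>
  have "\<exists>k\<in>tree n ?l ?J. k \<notin> edge_codes n E"
  proof (rule ccontr)
    assume no: "\<not> (\<exists>k\<in>tree n ?l ?J. k \<notin> edge_codes n E)"
    have 1: "odd (?mk h) \<longleftrightarrow> crosses_code n C h" and 2: "odd (?mk h) \<longleftrightarrow> crosses_code n {} h"
      if "h \<in> tree n ?l ?J" for h
      using mk[OF that] no that C0 by (auto simp: crosses_code_def)
    obtain u v where "u \<in> C" "v < n" "v \<notin> C" using C(1) by (auto simp: is_cut_def)
    moreover have "u < n" using C(1) \<open>u \<in> C\<close> by (auto simp: is_cut_def)
    ultimately have c: "comp n ?l ?J u = comp n ?l ?J v" by (intro same)
    have "odd (col n ?l ?mk ?J u + col n ?l ?mk ?J v) \<longleftrightarrow> (u \<in> C) \<noteq> (v \<in> C)"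
      using 1 c by (rule col_eq)
    moreover have "odd (col n ?l ?mk ?J u + col n ?l ?mk ?J v) \<longleftrightarrow> (u \<in> {}) \<noteq> (v \<in> {})"
      using 2 c by (rule col_eq)
    ultimately show False using \<open>u \<in> C\<close> \<open>v \<notin> C\<close> by blast
  qed
  then obtain f where f: "f \<in> tree n ?l ?J" "f \<notin> edge_codes n E" by blast
  have "odd (col n ?l ?mk ?J (f div n) + col n ?l ?mk ?J (f mod n))"
    using col_tree[OF f(1), of ?mk] mk[OF f(1)] f(2) by simp
  then have "f div n \<in> ?S \<or> f mod n \<in> ?S"
    using f(1) code_div_less code_mod_less by (auto simp: candidate_def colour_of_def tree_def)
  then have ne: "?S \<noteq> {}" by blast
  have "\<not> crosses_code n ?S k" if "k \<in> edge_codes n E" for k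
    using mono[OF that] that code_div_less[of k n] code_mod_less[of k n]
    by (auto simp: crosses_code_def candidate_def colour_of_def edge_codes_def)
  then have "cut_cost E ?S = 0" using cut_cost_eq_codes[OF g(1)] by auto
  moreover have "?S \<in> candidates n E" using ne N by (auto simp: candidates_def)
  ultimately show ?thesis using that by blast
qed

section \<open>Building blocks of the program\<close>

primrec straight :: "prog \<Rightarrow> bool" where
  "straight Skip = True"
| "straight (Write a i e) = True"
| "straight (Coin a i) = False"
| "straight (Seq c1 c2) = (straight c1 \<and> straight c2)"
| "straight (Branch b c1 c2) = (straight c1 \<and> straight c2)"
| "straight (While b c) = False"

text \<open>The clauses for \<open>Coin\<close> and \<open>While\<close> are dummies;
  \<open>exec\<close> describes a run under \<open>straight\<close> only.\<close>

primrec exec :: "prog \<Rightarrow> state \<Rightarrow> state" where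
  "exec Skip s = s"
| "exec (Write a i e) s = update s a (expr_val s i) (expr_val s e)"
| "exec (Coin a i) s = s"
| "exec (Seq c1 c2) s = exec c2 (exec c1 s)"
| "exec (Branch b c1 c2) s = (if expr_val s b \<noteq> 0 then exec c1 s else exec c2 s)"
| "exec (While b c) s = s"

primrec steps :: "prog \<Rightarrow> nat" where
  "steps Skip = 0"
| "steps (Write a i e) = 1"
| "steps (Coin a i) = 1"
| "steps (Seq c1 c2) = Suc (steps c1 + steps c2)"
| "steps (Branch b c1 c2) = Suc (max (steps c1) (steps c2))"
| "steps (While b c) = 0"

lemma fin_straight: "straight c \<Longrightarrow> fin c s (steps c) (return_pmf (exec c s))"
proof (induction c arbitrary: s)
  case Skip
  show ?case by (simp only: exec.simps fin_Skip)
next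
  case (Write a i e)
  have "fin (Write a i e) s (Suc 0) (return_pmf (exec (Write a i e) s))"
    by (rule fin_step[OF _ fin_Skip]) (simp add: cstep_def)
  then show ?case by simp
next
  case (Seq c1 c2)
  have "fin (Seq c1 c2) s (Suc (steps c1 + steps c2))
      (bind_pmf (return_pmf (exec c1 s)) (\<lambda>_. return_pmf (exec c2 (exec c1 s))))"
  proof (rule fin_Seq)
    show "fin c1 s (steps c1) (return_pmf (exec c1 s))" using Seq by simp
    show "fin c2 s' (steps c2) (return_pmf (exec c2 (exec c1 s)))"
      if "s' \<in> set_pmf (return_pmf (exec c1 s))" for s'
      using Seq that by simp
  qed
  then show ?case unfolding bind_return_pmf by (simp only: steps.simps exec.simps)
next
  case (Branch b c1 c2)
  let ?c = "if expr_val s b \<noteq> 0 then c1 else c2"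
  have "fin ?c s (steps ?c) (return_pmf (exec ?c s))" using Branch by simp
  then have "fin ?c s (max (steps c1) (steps c2)) (return_pmf (exec ?c s))"
    by (rule fin_mono) simp
  then have "fin (Branch b c1 c2) s (Suc (max (steps c1) (steps c2))) (return_pmf (exec ?c s))"
    by (rule fin_step[rotated]) (simp add: cstep_def)
  then show ?case by (cases "expr_val s b = 0") simp_all
qed simp_all

lemma tr_straight:
  assumes "straight c" "steps c \<le> K" "Q (exec c s)"
  shows "tr c s K Q"
  by (rule trI[of _ _ _ _ Q, OF fin_mono[OF fin_straight[OF assms(1)] assms(2)] assms(3)])

lemma tr_then:
  assumes "tr c1 s K1 Q1"
    and "\<And>t. (\<And>a. a \<notin> writes c1 \<Longrightarrow> t a = s a) \<Longrightarrow> Q1 t \<Longrightarrow> tr c2 t K2 Q"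
    and "Suc (K1 + K2) \<le> K"
  shows "tr (Seq c1 c2) s K Q"
proof (rule tr_Seq[OF _ assms(3)])
  show "tr c1 s K1 (\<lambda>t. tr c2 t K2 Q)"
  proof (rule tr_conseq[where Q = Q1, OF assms(1) order_refl])
    fix t assume "\<forall>a. a \<notin> writes c1 \<longrightarrow> t a = s a" "Q1 t"
    then show "tr c2 t K2 Q" by (intro assms(2)) simp_all
  qed
qed

lemma tr_exec_then:
  assumes "straight c1" "tr c2 (exec c1 s) K2 Q" "Suc (steps c1 + K2) \<le> K"
  shows "tr (Seq c1 c2) s K Q"
  by (rule tr_Seq[OF tr_straight[where Q = "\<lambda>t. tr c2 t K2 Q", OF assms(1) order_refl assms(2)] assms(3)])

lemma tr_For':
  fixes I :: "nat \<Rightarrow> state \<Rightarrow> bool"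
  assumes "x \<notin> writes c" "reads b \<inter> insert x (writes c) = {}" "expr_val s b = m"
    and "\<And>i t v. I i t \<Longrightarrow> I i (update t x 0 v)"
    and "I 0 s"
    and "\<And>i t. i < m \<Longrightarrow> t x 0 = i \<Longrightarrow> (\<And>a. a \<notin> insert x (writes c) \<Longrightarrow> t a = s a) \<Longrightarrow> I i t \<Longrightarrow>
      tr c t K (I (Suc i))"
    and "m * (K + 4) + 4 \<le> K'"
  shows "tr (For x b c) s K' (I m)"
  by (rule tr_For[where I = I and m = m and K = K and Q = "I m",
        OF assms(1-3) _ assms(5) _ _ assms(7)]) (rule assms(4) assms(6); assumption)+

section \<open>Derived expressions and the initial loads\<close>

lemma update_same [simp]: "update s a i k a = (s a)(i := k)"
  by (simp add: update_def)

lemma update_other [simp]: "b \<noteq> a \<Longrightarrow> update s a i k b = s b"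
  by (simp add: update_def)

text \<open>Remainder as a difference: although it contains a product, \<open>linear_expr\<close>
  inspects only the minuend, so the value may be written to memory.\<close>

definition mod_expr :: "expr \<Rightarrow> expr \<Rightarrow> expr" where
  "mod_expr a b = Binop Sub a (Binop Mul (Binop Div a b) b)"

definition eq_expr :: "expr \<Rightarrow> expr \<Rightarrow> expr" where
  "eq_expr a b = Binop Sub (Binop Sub (Const 1) (Binop Less a b)) (Binop Less b a)"

primrec power_expr :: "expr \<Rightarrow> nat \<Rightarrow> expr" where
  "power_expr e 0 = Const 1"
| "power_expr e (Suc k) = Binop Mul e (power_expr e k)"

lemma expr_val_mod_expr [simp]: "expr_val s (mod_expr a b) = expr_val s a mod expr_val s b"
  by (simp add: mod_expr_def minus_div_mult_eq_mod)

lemma expr_val_eq_expr [simp]: "expr_val s (eq_expr a b) = of_bool (expr_val s a = expr_val s b)"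
  by (simp add: eq_expr_def)

lemma expr_val_power_expr [simp]: "expr_val s (power_expr e k) = expr_val s e ^ k"
  by (induction k) simp_all

lemma reads_power_expr: "reads (power_expr e k) \<subseteq> reads e"
  by (induction k) auto

lemma linear_mod_expr [simp]: "linear_expr (mod_expr a b) = linear_expr a"
  by (simp add: mod_expr_def)

lemma linear_eq_expr [simp]: "linear_expr (eq_expr a b)"
  by (simp add: eq_expr_def)

definition nn_expr :: expr where
  "nn_expr = Binop Mul (scalar ''n'') (scalar ''n'')"

lemma expr_val_nn_expr [simp]: "expr_val s nn_expr = s ''n'' 0 * s ''n'' 0"
  by (simp add: nn_expr_def)

lemma reads_nn_expr [simp]: "reads nn_expr = {''n''}"
  by (simp add: nn_expr_def)

definition set_scalar :: "string \<Rightarrow> expr \<Rightarrow> prog" where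
  "set_scalar x e = Write x (Const 0) e"

lemma set_scalar_simps [simp]:
  "straight (set_scalar x e)" "exec (set_scalar x e) s = update s x 0 (expr_val s e)"
  "steps (set_scalar x e) = 1" "writes (set_scalar x e) = {x}"
  "linear_writes (set_scalar x e) = linear_expr e"
  by (simp_all add: set_scalar_def)

lemma linear_writes_For [simp]: "linear_writes (For x b c) = linear_writes c"
  by (simp add: For_def scalar_def)

lemma linear_scalar [simp]: "linear_expr (scalar x)"
  by (simp add: scalar_def)

abbreviation add_expr (infixl "\<oplus>" 65) where "a \<oplus> b \<equiv> Binop Add a b"
abbreviation mul_expr (infixl "\<otimes>" 70) where "a \<otimes> b \<equiv> Binop Mul a b"
abbreviation div_expr (infixl "\<oslash>" 70) where "a \<oslash> b \<equiv> Binop Div a b"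
abbreviation less_expr (infix "\<prec>" 50) where "a \<prec> b \<equiv> Binop Less a b"
abbreviation seq_prog (infixr ";;" 60) where "c ;; d \<equiv> Seq c d"

definition edge_test :: "expr \<Rightarrow> expr" where
  "edge_test k = Read ''adj'' k \<otimes> (k \<oslash> scalar ''n'' \<prec> mod_expr k (scalar ''n''))"

definition input :: "nat \<Rightarrow> nat set set \<Rightarrow> state \<Rightarrow> bool" where
  "input n E s \<longleftrightarrow> s ''n'' 0 = n \<and> (\<forall>k<n * n. s ''adj'' k = of_bool ({k div n, k mod n} \<in> E))"

lemma input_cong: "t ''n'' = s ''n'' \<Longrightarrow> t ''adj'' = s ''adj'' \<Longrightarrow> input n E s \<Longrightarrow> input n E t"
  by (simp add: input_def)

lemma edge_test:
  assumes "input n E s" "expr_val s k < n * n"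
  shows "expr_val s (edge_test k) = of_bool (expr_val s k \<in> edge_codes n E)"
  using assms by (auto simp: edge_test_def input_def edge_codes_def)

text \<open>\<open>n * n + 1\<close> is built by repeated addition, because
  \<open>linear_writes\<close> does not allow a product to be written to memory.\<close>

definition init_prog :: prog where
  "init_prog = set_scalar ''m'' (Const 1) ;;
     For ''i'' (scalar ''n'') (set_scalar ''m'' (scalar ''m'' \<oplus> scalar ''n'')) ;;
     For ''k'' nn_expr
       (Branch (edge_test (scalar ''k'')) (Write ''load'' (scalar ''k'') (Const 0))
         (Write ''load'' (scalar ''k'') (scalar ''m'')))"

lemma writes_init [simp]: "writes init_prog = {''m'', ''i'', ''k'', ''load''}"
  by (auto simp: init_prog_def)

definition K_init :: "nat \<Rightarrow> nat" where
  "K_init n = n * 5 + n * n * 6 + 12"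

lemma tr_init:
  assumes "input n E s"
  shows "tr init_prog s (K_init n)
    (\<lambda>t. t ''m'' 0 = Suc (n * n) \<and> (\<forall>k<n * n. t ''load'' k = load n E 0 k))"
  unfolding init_prog_def
proof (rule tr_exec_then[where ?K2.0 = "n * 5 + n * n * 6 + 10"])
  let ?s = "exec (set_scalar ''m'' (Const 1)) s"
  have n: "s ''n'' 0 = n" using assms by (simp add: input_def)
  let ?I = "\<lambda>(i::nat) (t::state). t ''m'' 0 = Suc (i * n)"
  show "tr (For ''i'' (scalar ''n'') (set_scalar ''m'' (scalar ''m'' \<oplus> scalar ''n'')) ;;
     For ''k'' nn_expr
       (Branch (edge_test (scalar ''k'')) (Write ''load'' (scalar ''k'') (Const 0))
         (Write ''load'' (scalar ''k'') (scalar ''m'')))) ?s (n * 5 + n * n * 6 + 10)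
    (\<lambda>t. t ''m'' 0 = Suc (n * n) \<and> (\<forall>k<n * n. t ''load'' k = load n E 0 k))"
  proof (rule tr_then[where ?Q1.0 = "?I n" and ?K1.0 = "n * 5 + 4" and ?K2.0 = "n * n * 6 + 4"])
    show "tr (For ''i'' (scalar ''n'') (set_scalar ''m'' (scalar ''m'' \<oplus> scalar ''n''))) ?s (n * 5 + 4) (?I n)"
    proof (rule tr_For'[where I = ?I and K = 1])
      fix i t assume "?I i t" "\<And>a. a \<notin> insert ''i'' (writes (set_scalar ''m'' (scalar ''m'' \<oplus> scalar ''n''))) \<Longrightarrow> t a = ?s a"
      then show "tr (set_scalar ''m'' (scalar ''m'' \<oplus> scalar ''n'')) t 1 (?I (Suc i))"
        using n by (intro tr_straight) simp_all
    qed (simp_all add: n)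
  next
    fix t assume t: "\<And>a. a \<notin> writes (For ''i'' (scalar ''n'') (set_scalar ''m'' (scalar ''m'' \<oplus> scalar ''n''))) \<Longrightarrow> t a = ?s a"
      and m: "?I n t"
    have inp: "input n E t" by (rule input_cong[OF _ _ assms]) (simp_all add: t)
    let ?c = "Branch (edge_test (scalar ''k'')) (Write ''load'' (scalar ''k'') (Const 0))
         (Write ''load'' (scalar ''k'') (scalar ''m''))"
    let ?I = "\<lambda>(i::nat) (u::state). u ''m'' 0 = Suc (n * n) \<and> (\<forall>k<i. u ''load'' k = load n E 0 k)"
    show "tr (For ''k'' nn_expr ?c) t (n * n * 6 + 4) (?I (n * n))"
    proof (rule tr_For'[where I = ?I and K = 2])
      fix i u assume i: "i < n * n" "u ''k'' 0 = i" "\<And>a. a \<notin> insert ''k'' (writes ?c) \<Longrightarrow> u a = t a" "?I i u"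
      have inp': "input n E u" by (rule input_cong[OF _ _ inp]) (simp_all add: i(3))
      have e: "expr_val u (edge_test (scalar ''k'')) = of_bool (i \<in> edge_codes n E)"
        using edge_test[OF inp', of "scalar ''k''"] i(1,2) by simp
      show "tr ?c u 2 (?I (Suc i))"
        by (rule tr_straight) (use i(2,4) e in \<open>auto simp: less_Suc_eq\<close>)
    qed (use n m in \<open>auto simp: t\<close>)
  qed simp
qed (simp_all add: K_init_def)

text \<open>The powers of \<open>n * n\<close> stay inside comparisons and never reach memory, so
  the sum is linear.\<close>

fun mark_sum :: "nat \<Rightarrow> expr" where
  "mark_sum 0 = Const 0"
| "mark_sum (Suc d) = mark_sum d \<oplus>
     eq_expr (mod_expr (scalar ''x'' \<oslash> power_expr nn_expr d) nn_expr) (scalar ''k'')"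

lemma expr_val_mark_sum:
  "expr_val s (mark_sum d) =
     (\<Sum>i<d. of_bool (s ''x'' 0 div (s ''n'' 0 * s ''n'' 0) ^ i mod (s ''n'' 0 * s ''n'' 0) = s ''k'' 0))"
  by (induction d) (simp_all del: sum_of_bool_eq)

lemma linear_mark_sum [simp]: "linear_expr (mark_sum d)"
  by (induction d) simp_all

section \<open>Kruskal's algorithm as a program\<close>

definition relabel_prog :: prog where
  "relabel_prog = For ''w'' (scalar ''n'')
     (Branch (eq_expr (Read ''comp'' (scalar ''w'')) (scalar ''a''))
        (Write ''comp'' (scalar ''w'') (scalar ''b'') ;;
         Write ''col'' (scalar ''w'') (Read ''col'' (scalar ''w'') \<oplus> scalar ''f''))
        Skip)"

definition merge_prog :: prog where
  "merge_prog =
     (set_scalar ''a'' (Read ''comp'' (scalar ''u'')) ;;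
      set_scalar ''b'' (Read ''comp'' (scalar ''v'')) ;;
      set_scalar ''f'' (Read ''col'' (scalar ''u'') \<oplus> Read ''col'' (scalar ''v'') \<oplus>
        (mark_sum 7 \<oplus> (nn_expr \<prec> Read ''load'' (scalar ''k'')))) ;;
      Write ''tree'' (scalar ''k'') (Const 1)) ;;
     relabel_prog"

definition kruskal_step :: prog where
  "kruskal_step =
     (set_scalar ''k'' (mod_expr (scalar ''j'') nn_expr) ;;
      set_scalar ''u'' (scalar ''k'' \<oslash> scalar ''n'') ;;
      set_scalar ''v'' (mod_expr (scalar ''k'') (scalar ''n''))) ;;
     Branch (eq_expr (scalar ''j'' \<oslash> nn_expr) (Read ''load'' (scalar ''k'')) \<otimes>
         Binop Sub (Const 1) (eq_expr (Read ''comp'' (scalar ''u'')) (Read ''comp'' (scalar ''v''))))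
       merge_prog Skip"

definition kruskal_prog :: prog where
  "kruskal_prog =
     For ''w'' (scalar ''n'')
       (Write ''comp'' (scalar ''w'') (scalar ''w'') ;; Write ''col'' (scalar ''w'') (Const 0)) ;;
     For ''k'' nn_expr (Write ''tree'' (scalar ''k'') (Const 0)) ;;
     For ''j'' ((Const 2 \<otimes> nn_expr \<oplus> Const 2) \<otimes> nn_expr) kruskal_step"

lemma writes_relabel [simp]: "writes relabel_prog = {''w'', ''comp'', ''col''}"
  by (auto simp: relabel_prog_def)

lemma writes_merge [simp]:
  "writes merge_prog = {''w'', ''comp'', ''col'', ''a'', ''b'', ''f'', ''tree''}"
  by (auto simp: merge_prog_def)

lemma writes_kruskal_step [simp]:
  "writes kruskal_step = {''w'', ''comp'', ''col'', ''a'', ''b'', ''f'', ''tree'', ''k'', ''u'', ''v''}"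
  by (auto simp: kruskal_step_def)

lemma writes_kruskal [simp]:
  "writes kruskal_prog = {''w'', ''comp'', ''col'', ''a'', ''b'', ''f'', ''tree'', ''k'', ''u'', ''v'', ''j''}"
  by (auto simp: kruskal_prog_def)

lemma tr_relabel:
  assumes n: "s ''n'' 0 = n" and ab: "s ''a'' 0 = a" "s ''b'' 0 = b" "s ''f'' 0 = f"
    and c: "\<forall>y<n. s ''comp'' y = c y \<and> s ''col'' y = d y"
  shows "tr relabel_prog s (n * 8 + 4) (\<lambda>t. \<forall>y<n. t ''comp'' y = (if c y = a then b else c y) \<and>
    t ''col'' y = (if c y = a then d y + f else d y))"
proof -
  let ?c = "Branch (eq_expr (Read ''comp'' (scalar ''w'')) (scalar ''a''))
        (Write ''comp'' (scalar ''w'') (scalar ''b'') ;;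
         Write ''col'' (scalar ''w'') (Read ''col'' (scalar ''w'') \<oplus> scalar ''f''))
        Skip"
  let ?I = "\<lambda>(i::nat) (t::state). \<forall>y<n. t ''comp'' y = (if y < i \<and> c y = a then b else c y) \<and>
    t ''col'' y = (if y < i \<and> c y = a then d y + f else d y)"
  have "tr (For ''w'' (scalar ''n'') ?c) s (n * 8 + 4) (?I n)"
  proof (rule tr_For'[where I = ?I and K = 4])
    fix i t assume i: "i < n" "t ''w'' 0 = i" "\<And>a. a \<notin> insert ''w'' (writes ?c) \<Longrightarrow> t a = s a" "?I i t"
    have t: "t ''a'' 0 = a" "t ''b'' 0 = b" "t ''f'' 0 = f" using ab by (simp_all add: i(3))
    show "tr ?c t 4 (?I (Suc i))"
      by (rule tr_straight) (use i(1,2,4) t in \<open>auto simp: less_Suc_eq\<close>)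
  qed (use n c in auto)
  then show ?thesis unfolding relabel_prog_def by (rule tr_conseq) (auto simp del: writes_For)
qed

definition K_step :: "nat \<Rightarrow> nat" where
  "K_step n = n * 8 + 20"

lemma tr_kruskal_step:
  assumes inp: "s ''n'' 0 = n" "0 < n" and l: "\<forall>k<n * n. s ''load'' k = l k"
    and x: "s ''x'' 0 = x" and j: "s ''j'' 0 = j"
    and c: "\<forall>w<n. s ''comp'' w = comp n l j w \<and> s ''col'' w = col n l (mark n l x) j w"
    and tree: "\<forall>k<n * n. s ''tree'' k = of_bool (k \<in> tree n l j)"
  shows "tr kruskal_step s (K_step n)
    (\<lambda>t. (\<forall>w<n. t ''comp'' w = comp n l (Suc j) w \<and> t ''col'' w = col n l (mark n l x) (Suc j) w) \<and>
      (\<forall>k<n * n. t ''tree'' k = of_bool (k \<in> tree n l (Suc j))))"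
    (is "tr _ _ _ ?Q")
proof -
  let ?mk = "mark n l x"
  define k where "k = j mod (n * n)"
  define u where "u = k div n"
  define v where "v = k mod n"
  have kn: "k < n * n" using inp(2) by (simp add: k_def)
  have uv: "u < n" "v < n" using code_div_less[OF kn] code_mod_less[OF kn] by (simp_all add: u_def v_def)
  let ?pre = "set_scalar ''k'' (mod_expr (scalar ''j'') nn_expr) ;;
      set_scalar ''u'' (scalar ''k'' \<oslash> scalar ''n'') ;;
      set_scalar ''v'' (mod_expr (scalar ''k'') (scalar ''n''))"
  let ?s = "exec ?pre s"
  have s1: "?s ''k'' 0 = k" "?s ''u'' 0 = u" "?s ''v'' 0 = v"
    using inp(1) j by (simp_all add: k_def u_def v_def)
  have s2: "?s a = s a" if "a \<notin> {''k'', ''u'', ''v''}" for a using that by simp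
  let ?g = "eq_expr (scalar ''j'' \<oslash> nn_expr) (Read ''load'' (scalar ''k'')) \<otimes>
         Binop Sub (Const 1) (eq_expr (Read ''comp'' (scalar ''u'')) (Read ''comp'' (scalar ''v'')))"
  have act: "active n l (comp n l j) j \<longleftrightarrow> j div (n * n) = l k \<and> comp n l j u \<noteq> comp n l j v"
    using inp(2) by (simp add: active_def Let_def k_def u_def v_def)
  have g: "expr_val ?s ?g = of_bool (active n l (comp n l j) j)"
    unfolding act using s1 inp(1) j l kn c uv by (simp add: s2)
  show ?thesis
    unfolding kruskal_step_def
  proof (rule tr_exec_then[where ?K2.0 = "n * 8 + 14"])
    show "tr (Branch ?g merge_prog Skip) ?s (n * 8 + 14) ?Q"
    proof (rule tr_Branch[where ?K1.0 = "n * 8 + 13"])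
      assume "expr_val ?s ?g = 0"
      then have na: "\<not> active n l (comp n l j) j" unfolding g by simp
      then have "comp n l (Suc j) = comp n l j" "col n l ?mk (Suc j) = col n l ?mk j" "tree n l (Suc j) = tree n l j"
        by (simp_all add: Let_def tree_Suc)
      then show "tr Skip ?s (n * 8 + 13) ?Q"
        using c tree by (intro tr_Skip) (simp only: s2, simp)
    next
      assume "expr_val ?s ?g \<noteq> 0"
      then have a: "active n l (comp n l j) j" unfolding g by simp
      let ?c = "comp n l j" and ?d = "col n l ?mk j"
      let ?f = "?d u + ?d v + ?mk k"
      let ?pre2 = "set_scalar ''a'' (Read ''comp'' (scalar ''u'')) ;;
        set_scalar ''b'' (Read ''comp'' (scalar ''v'')) ;;
        set_scalar ''f'' (Read ''col'' (scalar ''u'') \<oplus> Read ''col'' (scalar ''v'') \<oplus>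
          (mark_sum 7 \<oplus> (nn_expr \<prec> Read ''load'' (scalar ''k'')))) ;;
        Write ''tree'' (scalar ''k'') (Const 1)"
      let ?r = "exec ?pre2 ?s"
      have ms: "expr_val q (mark_sum 7) = (\<Sum>d<7. of_bool (x div (n * n) ^ d mod (n * n) = k))"
        if "q ''x'' 0 = x" "q ''n'' 0 = n" "q ''k'' 0 = k" for q
        unfolding expr_val_mark_sum that ..
      have "expr_val q (mark_sum 7 \<oplus> (nn_expr \<prec> Read ''load'' (scalar ''k''))) = ?mk k"
        if q: "q ''x'' 0 = x" "q ''n'' 0 = n" "q ''k'' 0 = k" "q ''load'' k = l k" for q
      proof -
        have "expr_val q (nn_expr \<prec> Read ''load'' (scalar ''k'')) = of_bool (n * n < l k)"
          using q by simp
        then show ?thesis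
          unfolding mark_def expr_val.simps(3) binop_val.simps ms[where q = q, OF q(1-3)] by (simp only:)
      qed
      note mk = this
      have r1: "?r ''a'' 0 = ?c u" "?r ''b'' 0 = ?c v" "?r ''f'' 0 = ?f"
        using s1 c uv mk x inp(1) l kn by (simp_all add: s2 del: mark_sum.simps)
      have rt: "?r ''tree'' = (s ''tree'')(k := 1)" using s1 by simp
      show "tr merge_prog ?s (n * 8 + 13) ?Q"
        unfolding merge_prog_def
      proof (rule tr_exec_then[where ?K2.0 = "n * 8 + 4"])
        have "tr relabel_prog ?r (n * 8 + 4) (\<lambda>t. \<forall>y<n. t ''comp'' y = (if ?c y = ?c u then ?c v else ?c y) \<and>
            t ''col'' y = (if ?c y = ?c u then ?d y + ?f else ?d y))"
        proof (rule tr_relabel)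
          have rs: "?r ''n'' = s ''n''" "?r ''comp'' = s ''comp''" "?r ''col'' = s ''col''" by simp_all
          show "?r ''n'' 0 = n" unfolding rs by (rule inp(1))
          show "\<forall>y<n. ?r ''comp'' y = ?c y \<and> ?r ''col'' y = ?d y" unfolding rs by (rule c)
        qed (rule r1)+
        then show "tr relabel_prog ?r (n * 8 + 4) ?Q"
        proof (rule tr_conseq)
          fix t assume t: "\<forall>a. a \<notin> writes relabel_prog \<longrightarrow> t a = ?r a"
            "\<forall>y<n. t ''comp'' y = (if ?c y = ?c u then ?c v else ?c y) \<and>
              t ''col'' y = (if ?c y = ?c u then ?d y + ?f else ?d y)"
          have "comp n l (Suc j) = (\<lambda>y. if ?c y = ?c u then ?c v else ?c y)"
            "col n l ?mk (Suc j) = (\<lambda>y. if ?c y = ?c u then ?d y + ?f else ?d y)"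
            unfolding comp.simps(2) col.simps(2) Let_def k_def[symmetric] u_def[symmetric] v_def[symmetric]
            by (simp_all only: a if_True)
          moreover have "t ''tree'' = (s ''tree'')(k := 1)"
            by (rule trans[OF _ rt]) (rule t(1)[rule_format], simp)
          moreover have "tree n l (Suc j) = insert k (tree n l j)" using a by (simp add: tree_Suc k_def)
          ultimately show "?Q t" using t(2) tree by simp
        qed simp
      qed simp_all
    qed simp
  qed (simp_all add: K_step_def)
qed

definition K_kruskal :: "nat \<Rightarrow> nat" where
  "K_kruskal n = n * 7 + n * n * 5 + kruskal_time n * (K_step n + 4) + 14"

lemma tr_kruskal:
  assumes n: "s ''n'' 0 = n" and l: "\<forall>k<n * n. s ''load'' k = l k" and x: "s ''x'' 0 = x"
  shows "tr kruskal_prog s (K_kruskal n)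
    (\<lambda>t. (\<forall>w<n. t ''col'' w = col n l (mark n l x) (kruskal_time n) w) \<and>
      (\<forall>k<n * n. t ''tree'' k = of_bool (k \<in> tree n l (kruskal_time n))))"
    (is "tr _ _ _ ?Q")
  unfolding kruskal_prog_def
proof (rule tr_then[where ?K1.0 = "n * 7 + 4" and ?K2.0 = "n * n * 5 + kruskal_time n * (K_step n + 4) + 9"])
  let ?c1 = "Write ''comp'' (scalar ''w'') (scalar ''w'') ;; Write ''col'' (scalar ''w'') (Const 0)"
  let ?I1 = "\<lambda>(i::nat) (t::state). \<forall>w<i. t ''comp'' w = w \<and> t ''col'' w = 0"
  show "tr (For ''w'' (scalar ''n'') ?c1) s (n * 7 + 4) (?I1 n)"
  proof (rule tr_For'[where I = ?I1 and K = 3])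
    fix i t assume i: "t ''w'' 0 = i" "?I1 i t"
    show "tr ?c1 t 3 (?I1 (Suc i))"
      by (rule tr_straight) (use i in \<open>auto simp: less_Suc_eq\<close>)
  qed (use n in auto)
  fix t assume t: "\<And>a. a \<notin> writes (For ''w'' (scalar ''n'') ?c1) \<Longrightarrow> t a = s a" "?I1 n t"
  let ?c2 = "Write ''tree'' (scalar ''k'') (Const 0)"
  let ?I2 = "\<lambda>(i::nat) (t::state). \<forall>k<i. t ''tree'' k = 0"
  let ?b = "(Const 2 \<otimes> nn_expr \<oplus> Const 2) \<otimes> nn_expr"
  show "tr (For ''k'' nn_expr ?c2 ;; For ''j'' ?b kruskal_step) t
      (n * n * 5 + kruskal_time n * (K_step n + 4) + 9) ?Q"
  proof (rule tr_then[where ?K1.0 = "n * n * 5 + 4" and ?K2.0 = "kruskal_time n * (K_step n + 4) + 4"])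
    show "tr (For ''k'' nn_expr ?c2) t (n * n * 5 + 4) (?I2 (n * n))"
    proof (rule tr_For'[where I = ?I2 and K = 1])
      fix i t assume i: "t ''k'' 0 = i" "?I2 i t"
      show "tr ?c2 t 1 (?I2 (Suc i))"
        by (rule tr_straight) (use i in \<open>auto simp: less_Suc_eq\<close>)
    qed (use n in \<open>auto simp: t(1)\<close>)
    fix r assume r: "\<And>a. a \<notin> writes (For ''k'' nn_expr ?c2) \<Longrightarrow> r a = t a" "?I2 (n * n) r"
    let ?I = "\<lambda>(j::nat) (t::state). (\<forall>w<n. t ''comp'' w = comp n l j w \<and> t ''col'' w = col n l (mark n l x) j w) \<and>
      (\<forall>k<n * n. t ''tree'' k = of_bool (k \<in> tree n l j))"
    have rs: "r a = s a" if "a \<notin> {''w'', ''k'', ''comp'', ''col'', ''tree''}" for a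
      using that by (simp add: r(1) t(1))
    have "tr (For ''j'' ?b kruskal_step) r (kruskal_time n * (K_step n + 4) + 4) (?I (kruskal_time n))"
    proof (rule tr_For'[where I = ?I and K = "K_step n"])
      fix j q assume j: "j < kruskal_time n" "q ''j'' 0 = j"
        "\<And>a. a \<notin> insert ''j'' (writes kruskal_step) \<Longrightarrow> q a = r a" "?I j q"
      have q: "q ''n'' 0 = n" "q ''x'' 0 = x" "\<forall>k<n * n. q ''load'' k = l k"
        using n x l by (simp_all add: j(3) rs)
      have "0 < n" using j(1) by (cases n) (simp_all add: kruskal_time_def)
      then show "tr kruskal_step q (K_step n) (?I (Suc j))"
        by (rule tr_kruskal_step[OF q(1) _ q(3) q(2) j(2)]) (use j(4) in blast)+
    next
      show "expr_val r ?b = kruskal_time n" using n by (simp add: rs kruskal_time_def)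
      have "tree n l 0 = {}" by (simp add: tree_def)
      then show "?I 0 r" using t(2) r by simp
    qed simp_all
    then show "tr (For ''j'' ?b kruskal_step) r (kruskal_time n * (K_step n + 4) + 4) ?Q"
      by (rule tr_conseq) simp_all
  qed simp
qed (simp add: K_kruskal_def)

section \<open>Enumeration of the candidates\<close>

text \<open>Sets are stored as bit masks. \<open>seen\<close> is a table addressed by the mask
  itself: the masks of cuts have at most \<open>n\<close> bits, which is affordable under
  logarithmic cost, and membership is a single read. Injectivity of \<open>lst\<close> matters,
  since a cut listed twice would be drawn twice as often.\<close>

definition found :: "nat set set \<Rightarrow> nat set set \<Rightarrow> state \<Rightarrow> bool" where
  "found E D s \<longleftrightarrow> finite D \<and> (\<forall>S\<in>D. finite S) \<and>
     bij_betw (s ''lst'') {..<s ''cnt'' 0} (set_encode ` D) \<and>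
     (\<forall>z. s ''seen'' z = of_bool (z \<in> set_encode ` D)) \<and>
     (\<forall>j<s ''cnt'' 0. s ''cst'' j = cut_cost E (set_decode (s ''lst'' j)))"

lemma found_cong:
  assumes "t ''lst'' = s ''lst''" "t ''cnt'' = s ''cnt''" "t ''seen'' = s ''seen''" "t ''cst'' = s ''cst''"
  shows "found E D t = found E D s"
  by (simp add: found_def assms)

lemma found_update [simp]:
  assumes "a \<notin> {''lst'', ''cnt'', ''seen'', ''cst''}"
  shows "found E D (update t a i v) = found E D t"
  using assms by (intro found_cong) (auto simp: update_def)

lemma found_cnt: "found E D s \<Longrightarrow> s ''cnt'' 0 = card D"
proof -
  assume f: "found E D s"
  then have "card {..<s ''cnt'' 0} = card (set_encode ` D)"
    by (intro bij_betw_same_card[of "s ''lst''"]) (simp add: found_def)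
  also have "\<dots> = card D"
    using f by (intro card_image inj_on_subset[OF inj_on_set_encode]) (auto simp: found_def)
  finally show ?thesis by simp
qed

lemma bij_betw_fun_upd:
  assumes "bij_betw f {..<m} B" "z \<notin> B"
  shows "bij_betw (f(m := z)) {..<Suc m} (insert z B)"
proof (rule bij_betw_imageI)
  have i: "inj_on f {..<m}" "f ` {..<m} = B" using assms(1) by (auto simp: bij_betw_def)
  have im: "(f(m := z)) ` {..<m} = B" using i(2) by auto
  show "(f(m := z)) ` {..<Suc m} = insert z B"
    unfolding lessThan_Suc image_insert im by simp
  have "inj_on (f(m := z)) {..<m}" using i(1) by (auto simp: inj_on_def)
  then show "inj_on (f(m := z)) {..<Suc m}"
    unfolding lessThan_Suc inj_on_insert using im assms(2) by auto
qed

text \<open>The mask \<open>z\<close> is assembled from the doubling power \<open>p\<close>, and the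
  cost \<open>c\<close> is counted over the edge codes. The product in the final guard is a
  conjunction: \<open>z = 0\<close> would be the empty set, and masks already seen are
  skipped.\<close>

definition record_prog :: prog where
  "record_prog =
     (set_scalar ''z'' (Const 0) ;; set_scalar ''p'' (Const 1) ;; set_scalar ''c'' (Const 0)) ;;
     For ''v'' (scalar ''n'')
       (Branch (mod_expr (Read ''col'' (scalar ''v'') \<oplus> Read ''col'' (Const 0)) (Const 2))
          (set_scalar ''z'' (scalar ''z'' \<oplus> scalar ''p'')) Skip ;;
        set_scalar ''p'' (scalar ''p'' \<oplus> scalar ''p'')) ;;
     For ''k'' nn_expr
       (Branch (edge_test (scalar ''k'') \<otimes>
            mod_expr (Read ''col'' (scalar ''k'' \<oslash> scalar ''n'') \<oplus>
              Read ''col'' (mod_expr (scalar ''k'') (scalar ''n''))) (Const 2))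
          (set_scalar ''c'' (scalar ''c'' \<oplus> Const 1)) Skip) ;;
     Branch (scalar ''z'' \<otimes> Binop Sub (Const 1) (Read ''seen'' (scalar ''z'')))
       (Write ''seen'' (scalar ''z'') (Const 1) ;;
        Write ''lst'' (scalar ''cnt'') (scalar ''z'') ;;
        Write ''cst'' (scalar ''cnt'') (scalar ''c'') ;;
        set_scalar ''cnt'' (scalar ''cnt'' \<oplus> Const 1))
       Skip"

lemma writes_record [simp]:
  "writes record_prog = {''z'', ''p'', ''c'', ''v'', ''k'', ''seen'', ''lst'', ''cst'', ''cnt''}"
  by (auto simp: record_prog_def)

definition K_record :: "nat \<Rightarrow> nat" where
  "K_record n = n * 8 + n * n * 6 + 30"

lemma tr_record:
  assumes inp: "input n E s" and g: "graph n E" and f: "found E D s"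
    and col: "\<forall>v<n. s ''col'' v = cl v" and S: "S = {v. v < n \<and> odd (cl v + cl 0)}"
  shows "tr record_prog s (K_record n) (found E (if S = {} then D else insert S D))"
    (is "tr _ _ _ ?Q")
  unfolding record_prog_def
proof (rule tr_exec_then[where ?K2.0 = "n * 8 + n * n * 6 + 20"])
  let ?pre = "set_scalar ''z'' (Const 0) ;; set_scalar ''p'' (Const 1) ;; set_scalar ''c'' (Const 0)"
  let ?s = "exec ?pre s"
  let ?c1 = "Branch (mod_expr (Read ''col'' (scalar ''v'') \<oplus> Read ''col'' (Const 0)) (Const 2))
          (set_scalar ''z'' (scalar ''z'' \<oplus> scalar ''p'')) Skip ;;
        set_scalar ''p'' (scalar ''p'' \<oplus> scalar ''p'')"
  let ?g2 = "edge_test (scalar ''k'') \<otimes>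
            mod_expr (Read ''col'' (scalar ''k'' \<oslash> scalar ''n'') \<oplus>
              Read ''col'' (mod_expr (scalar ''k'') (scalar ''n''))) (Const 2)"
  let ?c2 = "Branch ?g2 (set_scalar ''c'' (scalar ''c'' \<oplus> Const 1)) Skip"
  let ?c3 = "Branch (scalar ''z'' \<otimes> Binop Sub (Const 1) (Read ''seen'' (scalar ''z'')))
       (Write ''seen'' (scalar ''z'') (Const 1) ;;
        Write ''lst'' (scalar ''cnt'') (scalar ''z'') ;;
        Write ''cst'' (scalar ''cnt'') (scalar ''c'') ;;
        set_scalar ''cnt'' (scalar ''cnt'' \<oplus> Const 1))
       Skip"
  have n: "s ''n'' 0 = n" using inp by (simp add: input_def)
  let ?A = "\<lambda>i. {v. v < i \<and> odd (cl v + cl 0)}"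
  have A_Suc: "?A (Suc i) = (if odd (cl i + cl 0) then insert i (?A i) else ?A i)" for i
    by (auto simp: less_Suc_eq)
  let ?I1 = "\<lambda>(i::nat) (t::state). t ''z'' 0 = set_encode (?A i) \<and> t ''p'' 0 = 2 ^ i \<and> t ''c'' 0 = 0"
  show "tr (For ''v'' (scalar ''n'') ?c1 ;; For ''k'' nn_expr ?c2 ;; ?c3) ?s (n * 8 + n * n * 6 + 20) ?Q"
  proof (rule tr_then[where ?Q1.0 = "?I1 n" and ?K1.0 = "n * 8 + 4" and ?K2.0 = "n * n * 6 + 15"])
    show "tr (For ''v'' (scalar ''n'') ?c1) ?s (n * 8 + 4) (?I1 n)"
    proof (rule tr_For'[where I = ?I1 and K = 4])
      fix i t assume i: "i < n" "t ''v'' 0 = i" "\<And>a. a \<notin> insert ''v'' (writes ?c1) \<Longrightarrow> t a = ?s a" "?I1 i t"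
      have c: "t ''col'' i = cl i" "t ''col'' 0 = cl 0" using col i(1) by (simp_all add: i(3))
      show "tr ?c1 t 4 (?I1 (Suc i))"
      proof (rule tr_straight)
        show "?I1 (Suc i) (exec ?c1 t)"
        proof (cases "odd (cl i + cl 0)")
          case True
          then have "(cl i + cl 0) mod 2 = 1" by (simp only: odd_iff_mod_2_eq_one)
          moreover have "set_encode (?A (Suc i)) = 2 ^ i + set_encode (?A i)"
            unfolding A_Suc using True by simp
          ultimately show ?thesis using i(2,4) c by simp
        next
          case False
          then have "(cl i + cl 0) mod 2 = 0" by (simp only: even_iff_mod_2_eq_zero not_not)
          moreover have "set_encode (?A (Suc i)) = set_encode (?A i)"
            unfolding A_Suc using False by simp
          ultimately show ?thesis using i(2,4) c by simp
        qed
      qed simp_all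
    qed (simp_all add: n)
  next
    fix t assume t: "\<And>a. a \<notin> writes (For ''v'' (scalar ''n'') ?c1) \<Longrightarrow> t a = ?s a" "?I1 n t"
    have ts: "t a = s a" if "a \<notin> {''z'', ''p'', ''c'', ''v''}" for a using that by (simp add: t(1))
    have inp_t: "input n E t" by (rule input_cong[OF _ _ inp]) (simp_all add: ts)
    let ?B = "\<lambda>i. {k \<in> edge_codes n E. k < i \<and> crosses_code n S k}"
    have B_Suc: "?B (Suc i) = (if i \<in> edge_codes n E \<and> crosses_code n S i then insert i (?B i) else ?B i)" for i
      by (auto simp: less_Suc_eq)
    have finB: "finite (?B i)" for i by (rule finite_subset[OF _ finite_edge_codes[of n E]]) auto
    let ?I2 = "\<lambda>(i::nat) (t::state). t ''c'' 0 = card (?B i)"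
    show "tr (For ''k'' nn_expr ?c2 ;; ?c3) t (n * n * 6 + 15) ?Q"
    proof (rule tr_then[where ?Q1.0 = "?I2 (n * n)" and ?K1.0 = "n * n * 6 + 4" and ?K2.0 = 10])
      show "tr (For ''k'' nn_expr ?c2) t (n * n * 6 + 4) (?I2 (n * n))"
      proof (rule tr_For'[where I = ?I2 and K = 2])
        fix i u assume i: "i < n * n" "u ''k'' 0 = i" "\<And>a. a \<notin> insert ''k'' (writes ?c2) \<Longrightarrow> u a = t a" "?I2 i u"
        have inp_u: "input n E u" by (rule input_cong[OF _ _ inp_t]) (simp_all add: i(3))
        have un: "u ''n'' 0 = n" using inp_u by (simp add: input_def)
        have uv: "i div n < n" "i mod n < n" using code_div_less[OF i(1)] code_mod_less[OF i(1)] .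
        have c: "u ''col'' (i div n) = cl (i div n)" "u ''col'' (i mod n) = cl (i mod n)"
          using col uv by (simp_all add: i(3) ts)
        have e: "expr_val u (edge_test (scalar ''k'')) = of_bool (i \<in> edge_codes n E)"
          using edge_test[OF inp_u, of "scalar ''k''"] i(1,2) by simp
        have cr: "crosses_code n S i \<longleftrightarrow> odd (cl (i div n) + cl (i mod n))"
          unfolding crosses_code_def S using uv by auto
        have g: "expr_val u ?g2 \<noteq> 0 \<longleftrightarrow> i \<in> edge_codes n E \<and> crosses_code n S i"
        proof -
          have "expr_val u ?g2 = of_bool (i \<in> edge_codes n E) * ((cl (i div n) + cl (i mod n)) mod 2)"
            using e c i(2) un by simp
          then show ?thesis unfolding cr by (simp add: mod2_eq_if)
        qed
        show "tr ?c2 u 2 (?I2 (Suc i))"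
        proof (rule tr_straight)
          have x: "i \<notin> ?B i" by simp
          show "?I2 (Suc i) (exec ?c2 u)"
            unfolding B_Suc exec.simps g using i(4) finB[of i] x by (auto simp: card_insert_disjoint)
        qed simp_all
      next
        have "?B 0 = {}" by simp
        then show "?I2 0 t" using t(2) by (simp only: card.empty)
        show "expr_val t nn_expr = n * n" using inp_t by (simp add: input_def)
      qed simp_all
    next
      fix u assume u: "\<And>a. a \<notin> writes (For ''k'' nn_expr ?c2) \<Longrightarrow> u a = t a" "?I2 (n * n) u"
      have us: "u a = s a" if "a \<notin> {''z'', ''p'', ''c'', ''v'', ''k''}" for a
        using that ts[of a] by (simp add: u(1))
      have "?B (n * n) = {k \<in> edge_codes n E. crosses_code n S k}" by (auto simp: edge_codes_def)
      then have uc: "u ''c'' 0 = cut_cost E S" using u(2) cut_cost_eq_codes[OF g] by simp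
      have uz: "u ''z'' 0 = set_encode S" using t(2) unfolding S by (simp add: u(1))
      have fu: "found E D u" using f found_cong[of u s E D] by (simp add: us)
      have finS: "finite S" unfolding S by simp
      have z0: "set_encode S = 0 \<longleftrightarrow> S = {}"
        using set_encode_eq[OF finS finite.emptyI] by simp
      have mem: "set_encode S \<in> set_encode ` D \<longleftrightarrow> S \<in> D"
      proof
        assume "set_encode S \<in> set_encode ` D"
        then obtain T where T: "T \<in> D" "set_encode S = set_encode T" by blast
        have "finite T" using T(1) fu by (simp add: found_def)
        then show "S \<in> D" using T set_encode_eq[OF finS, of T] by simp
      qed (rule imageI)
      show "tr ?c3 u 10 ?Q"
      proof (rule tr_straight)
        show "?Q (exec ?c3 u)"
        proof (cases "S = {} \<or> S \<in> D")
          case True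
          then have e: "exec ?c3 u = u" using uz z0 mem fu by (auto simp: found_def)
          have D: "(if S = {} then D else insert S D) = D" using True by auto
          show ?thesis unfolding e D by (rule fu)
        next
          case False
          let ?m = "u ''cnt'' 0" and ?z = "set_encode S"
          let ?u = "exec ?c3 u"
          have b: "u ''seen'' ?z = 0" using fu False mem by (simp add: found_def)
          have e: "?u ''seen'' = (u ''seen'')(?z := 1)" "?u ''lst'' = (u ''lst'')(?m := ?z)"
            "?u ''cst'' = (u ''cst'')(?m := cut_cost E S)" "?u ''cnt'' 0 = Suc ?m"
            using uz z0 b uc False by (simp_all add: fun_upd_def)
          have "bij_betw ((u ''lst'')(?m := ?z)) {..<Suc ?m} (insert ?z (set_encode ` D))"
            using fu False mem by (intro bij_betw_fun_upd) (auto simp: found_def)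
          then have "found E (insert S D) ?u"
            unfolding found_def e using fu finS by (auto simp: found_def less_Suc_eq)
          then show ?thesis using False by simp
        qed
      qed simp_all
    qed simp
  qed simp
qed (simp_all add: K_record_def)

text \<open>The tree does not depend on the marks, so each pass over \<open>x\<close> reproduces the
  same tree in the array \<open>tree\<close>, and the copy left by the last pass is added to the
  loads.\<close>

definition enum_prog :: prog where
  "enum_prog = For ''i'' nn_expr
     (For ''x'' (power_expr nn_expr 7) (kruskal_prog ;; record_prog) ;;
      For ''h'' nn_expr
        (Write ''load'' (scalar ''h'') (Read ''load'' (scalar ''h'') \<oplus> Read ''tree'' (scalar ''h''))))"

lemma writes_enum [simp]:
  "writes enum_prog = {''i'', ''x'', ''h'', ''load''} \<union> writes kruskal_prog \<union> writes record_prog"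
  by (auto simp: enum_prog_def)

definition K_pass :: "nat \<Rightarrow> nat" where
  "K_pass n = (n * n) ^ 7 * (K_kruskal n + K_record n + 5) + n * n * 5 + 10"

definition K_enum :: "nat \<Rightarrow> nat" where
  "K_enum n = n * n * (K_pass n + 4) + 4"

lemma tr_enum:
  assumes inp: "input n E s" and g: "graph n E" and f: "found E {} s"
    and l: "\<forall>k<n * n. s ''load'' k = load n E 0 k"
  shows "tr enum_prog s (K_enum n) (found E (candidates n E))"
proof -
  let ?M = "(n * n) ^ 7"
  let ?D = "\<lambda>i. (\<lambda>(i, x). candidate n E i x) ` ({..<i} \<times> {..<?M}) - {{}}"
  let ?D' = "\<lambda>i x. ?D i \<union> (candidate n E i ` {..<x} - {{}})"
  let ?c1 = "kruskal_prog ;; record_prog"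
  let ?c2 = "Write ''load'' (scalar ''h'') (Read ''load'' (scalar ''h'') \<oplus> Read ''tree'' (scalar ''h''))"
  let ?c = "For ''x'' (power_expr nn_expr 7) ?c1 ;; For ''h'' nn_expr ?c2"
  let ?I = "\<lambda>(i::nat) (t::state). (\<forall>k<n * n. t ''load'' k = load n E i k) \<and> found E (?D i) t"
  have n: "s ''n'' 0 = n" using inp by (simp add: input_def)
  have Dx: "?D' i (Suc x) = (if candidate n E i x = {} then ?D' i x else insert (candidate n E i x) (?D' i x))" for i x
    by (auto simp: lessThan_Suc)
  have Di: "?D' i ?M = ?D (Suc i)" for i
  proof -
    have "{..<Suc i} \<times> {..<?M} = {..<i} \<times> {..<?M} \<union> Pair i ` {..<?M}" by (auto simp: less_Suc_eq)
    then show ?thesis by (simp add: image_Un image_image Un_Diff)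
  qed
  have "tr (For ''i'' nn_expr ?c) s (K_enum n) (?I (n * n))"
  proof (rule tr_For'[where I = ?I and K = "K_pass n"])
    fix i t assume i: "i < n * n" "t ''i'' 0 = i" "\<And>a. a \<notin> insert ''i'' (writes ?c) \<Longrightarrow> t a = s a" "?I i t"
    have inp_t: "input n E t" by (rule input_cong[OF _ _ inp]) (simp_all add: i(3))
    have tn: "t ''n'' 0 = n" using inp_t by (simp add: input_def)
    have N: "0 < n * n" using i(1) by (rule le_less_trans[rotated]) simp
    \<comment> \<open>Before the first pass the array \<open>tree\<close> need not hold the current
      tree; hence the condition \<open>0 < x\<close>, which \<open>0 < n * n\<close> discharges at
      the end.\<close>
    let ?J = "\<lambda>(x::nat) (u::state). found E (?D' i x) u \<and>
      (0 < x \<longrightarrow> (\<forall>k<n * n. u ''tree'' k = of_bool (k \<in> packed n E i)))"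
    show "tr ?c t (K_pass n) (?I (Suc i))"
    proof (rule tr_then[where ?Q1.0 = "?J ?M" and ?K1.0 = "?M * (K_kruskal n + K_record n + 5) + 4"
          and ?K2.0 = "n * n * 5 + 4"])
      show "tr (For ''x'' (power_expr nn_expr 7) ?c1) t (?M * (K_kruskal n + K_record n + 5) + 4) (?J ?M)"
      proof (rule tr_For'[where I = ?J and K = "K_kruskal n + K_record n + 1"])
        fix x u assume x: "x < ?M" "u ''x'' 0 = x" "\<And>a. a \<notin> insert ''x'' (writes ?c1) \<Longrightarrow> u a = t a" "?J x u"
        have un: "u ''n'' 0 = n" "\<forall>k<n * n. u ''load'' k = load n E i k" using tn i(4) by (simp_all add: x(3))
        have inp_u: "input n E u" by (rule input_cong[OF _ _ inp_t]) (simp_all add: x(3))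
        show "tr ?c1 u (K_kruskal n + K_record n + 1) (?J (Suc x))"
        proof (rule tr_then[OF tr_kruskal[OF un x(2)]])
          fix v assume v: "\<And>a. a \<notin> writes kruskal_prog \<Longrightarrow> v a = u a"
            "(\<forall>w<n. v ''col'' w = col n (load n E i) (mark n (load n E i) x) (kruskal_time n) w) \<and>
             (\<forall>k<n * n. v ''tree'' k = of_bool (k \<in> tree n (load n E i) (kruskal_time n)))"
          have inp_v: "input n E v" by (rule input_cong[OF _ _ inp_u]) (simp_all add: v(1))
          have fv: "found E (?D' i x) v" using x(4) found_cong[of v u E "?D' i x"] by (simp add: v(1))
          have col: "\<forall>w<n. v ''col'' w = colour_of n E i x w"
            unfolding colour_of_def using v(2) by blast
          have r: "tr record_prog v (K_record n) (found E (?D' i (Suc x)))"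
            unfolding Dx by (rule tr_record[OF inp_v g fv col candidate_def])
          show "tr record_prog v (K_record n) (?J (Suc x))"
          proof (rule tr_conseq[OF r order_refl])
            fix w assume w: "\<forall>a. a \<notin> writes record_prog \<longrightarrow> w a = v a" "found E (?D' i (Suc x)) w"
            have "w ''tree'' = v ''tree''" by (rule w(1)[rule_format]) simp
            then show "?J (Suc x) w" using w(2) v(2) unfolding packed_def by simp
          qed
        qed simp
      next
        show "reads (power_expr nn_expr 7) \<inter> insert ''x'' (writes ?c1) = {}"
          using reads_power_expr[of nn_expr 7] by auto
        have "?D' i 0 = ?D i" by simp
        then show "?J 0 t" using i(4) by (simp only: less_irrefl) simp
      qed (simp_all add: tn)
    next
      fix u assume u: "\<And>a. a \<notin> writes (For ''x'' (power_expr nn_expr 7) ?c1) \<Longrightarrow> u a = t a" "?J ?M u"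
      have fu: "found E (?D (Suc i)) u" using u(2) unfolding Di by (rule conjunct1)
      have tr_u: "\<forall>k<n * n. u ''tree'' k = of_bool (k \<in> packed n E i)" using u(2) N by simp
      have lu: "\<forall>k<n * n. u ''load'' k = load n E i k" using i(4) by (simp add: u(1))
      have un: "u ''n'' 0 = n" using tn by (simp add: u(1))
      let ?L = "\<lambda>(h::nat) (w::state). (\<forall>k<n * n. w ''load'' k = (if k < h then load n E (Suc i) k else load n E i k)) \<and>
        found E (?D (Suc i)) w"
      have "tr (For ''h'' nn_expr ?c2) u (n * n * 5 + 4) (?L (n * n))"
      proof (rule tr_For'[where I = ?L and K = 1])
        fix h w assume h: "h < n * n" "w ''h'' 0 = h" "\<And>a. a \<notin> insert ''h'' (writes ?c2) \<Longrightarrow> w a = u a" "?L h w"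
        have wt: "w ''tree'' h = of_bool (h \<in> packed n E i)" using tr_u h(1) by (simp add: h(3))
        have wl: "w ''load'' h = load n E i h" using h(1,4) by simp
        have e: "exec ?c2 w ''load'' = (w ''load'')(h := load n E (Suc i) h)"
          unfolding load_Suc_packed using h(2) wt wl by simp
        show "tr ?c2 w 1 (?L (Suc h))"
        proof (rule tr_straight)
          show "?L (Suc h) (exec ?c2 w)"
          proof
            show "\<forall>k<n * n. exec ?c2 w ''load'' k = (if k < Suc h then load n E (Suc i) k else load n E i k)"
              unfolding e using h(4) by (auto simp: less_Suc_eq simp del: load.simps)
            show "found E (?D (Suc i)) (exec ?c2 w)" using h(4) by simp
          qed
        qed simp_all
      qed (use lu fu un in \<open>simp_all del: load.simps\<close>)
      then show "tr (For ''h'' nn_expr ?c2) u (n * n * 5 + 4) (?I (Suc i))"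
        by (rule tr_conseq[OF _ order_refl]) (simp del: load.simps)
    qed (simp add: K_pass_def)
  qed (use l f in \<open>simp_all add: n K_enum_def del: load.simps\<close>)
  then show ?thesis
    unfolding enum_prog_def
  proof (rule tr_conseq[OF _ order_refl])
    fix t assume "?I (n * n) t"
    then show "found E (candidates n E) t" unfolding candidates_def by blast
  qed
qed

text \<open>\<open>m\<close> holds \<open>n * n + 1\<close>, which exceeds the cost of every cut and
  acts as infinity. \<open>sel\<close> is kept as the fallback output for the draws that the sampler
  cannot use.\<close>

definition min_prog :: prog where
  "min_prog = (set_scalar ''opt'' (scalar ''m'') ;; set_scalar ''sel'' (Const 0)) ;;
     For ''j'' (scalar ''cnt'')
       (Branch (Read ''cst'' (scalar ''j'') \<prec> scalar ''opt'')
          (set_scalar ''opt'' (Read ''cst'' (scalar ''j'')) ;; set_scalar ''sel'' (Read ''lst'' (scalar ''j'')))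
          Skip)"

lemma writes_min [simp]: "writes min_prog = {''opt'', ''sel'', ''j''}"
  by (auto simp: min_prog_def)

lemma tr_min:
  assumes "s ''cnt'' 0 = N" "N \<le> C"
  shows "tr min_prog s (C * 8 + 10) (\<lambda>t. (\<forall>j<N. t ''opt'' 0 \<le> s ''cst'' j) \<and>
    (t ''opt'' 0 = s ''m'' 0 \<or> (\<exists>j<N. s ''cst'' j = t ''opt'' 0 \<and> s ''lst'' j = t ''sel'' 0)))"
  unfolding min_prog_def
proof (rule tr_exec_then[where ?K2.0 = "C * 8 + 4"])
  let ?s = "exec (set_scalar ''opt'' (scalar ''m'') ;; set_scalar ''sel'' (Const 0)) s"
  let ?c = "Branch (Read ''cst'' (scalar ''j'') \<prec> scalar ''opt'')
          (set_scalar ''opt'' (Read ''cst'' (scalar ''j'')) ;; set_scalar ''sel'' (Read ''lst'' (scalar ''j'')))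
          Skip"
  let ?I = "\<lambda>(i::nat) (t::state). (\<forall>j<i. t ''opt'' 0 \<le> s ''cst'' j) \<and>
    (t ''opt'' 0 = s ''m'' 0 \<or> (\<exists>j<i. s ''cst'' j = t ''opt'' 0 \<and> s ''lst'' j = t ''sel'' 0))"
  show "tr (For ''j'' (scalar ''cnt'') ?c) ?s (C * 8 + 4) (?I N)"
  proof (rule tr_For'[where I = ?I and K = 4])
    fix i t assume i: "i < N" "t ''j'' 0 = i" "\<And>a. a \<notin> insert ''j'' (writes ?c) \<Longrightarrow> t a = ?s a" "?I i t"
    have a: "t ''cst'' = s ''cst''" "t ''lst'' = s ''lst''" by (simp_all add: i(3))
    show "tr ?c t 4 (?I (Suc i))"
    proof (rule tr_straight)
      show "?I (Suc i) (exec ?c t)"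
      proof (cases "s ''cst'' i < t ''opt'' 0")
        case True
        then have "exec ?c t ''opt'' 0 = s ''cst'' i" "exec ?c t ''sel'' 0 = s ''lst'' i"
          using i(2) a by simp_all
        moreover have "\<forall>j<Suc i. s ''cst'' i \<le> s ''cst'' j"
          using i(4) True by (fastforce simp: less_Suc_eq)
        ultimately show ?thesis by (metis lessI)
      next
        case False
        then have e: "exec ?c t = t" using i(2) a by simp
        show ?thesis unfolding e using i(4) False by (auto simp: less_Suc_eq)
      qed
    qed simp_all
  qed (use assms in simp_all)
qed simp_all

text \<open>Doubling \<open>p\<close> until it exceeds \<open>n\<close> counts the binary digits of
  \<open>n\<close>; \<open>n\<close> iterations are enough, as \<open>n < 2 ^ n\<close>. The 40 is
  what \<open>card_small_cuts_le\<close> requires.\<close>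

definition len_prog :: prog where
  "len_prog = (set_scalar ''p'' (Const 1) ;; set_scalar ''L'' (Const 0)) ;;
     For ''i'' (scalar ''n'')
       (Branch (scalar ''p'' \<prec> scalar ''n'' \<oplus> Const 1)
          (set_scalar ''p'' (scalar ''p'' \<oplus> scalar ''p'') ;; set_scalar ''L'' (scalar ''L'' \<oplus> Const 40))
          Skip)"

lemma writes_len [simp]: "writes len_prog = {''p'', ''L'', ''i''}"
  by (auto simp: len_prog_def)

lemma tr_len:
  assumes "s ''n'' 0 = n"
  shows "tr len_prog s (n * 8 + 10)
    (\<lambda>t. \<exists>e\<le>n. t ''L'' 0 = 40 * e \<and> n < 2 ^ e \<and> (e = 0 \<or> 2 ^ e \<le> 2 * n))"
  unfolding len_prog_def
proof (rule tr_exec_then[where ?K2.0 = "n * 8 + 4"])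
  let ?s = "exec (set_scalar ''p'' (Const 1) ;; set_scalar ''L'' (Const 0)) s"
  let ?c = "Branch (scalar ''p'' \<prec> scalar ''n'' \<oplus> Const 1)
          (set_scalar ''p'' (scalar ''p'' \<oplus> scalar ''p'') ;; set_scalar ''L'' (scalar ''L'' \<oplus> Const 40))
          Skip"
  let ?I = "\<lambda>(i::nat) (t::state). \<exists>e\<le>i. t ''p'' 0 = 2 ^ e \<and> t ''L'' 0 = 40 * e \<and>
    (e = 0 \<or> 2 ^ e \<le> 2 * n) \<and> (2 ^ e \<le> n \<longrightarrow> e = i)"
  have "tr (For ''i'' (scalar ''n'') ?c) ?s (n * 8 + 4) (?I n)"
  proof (rule tr_For'[where I = ?I and K = 4])
    fix i t assume i: "i < n" "t ''i'' 0 = i" "\<And>a. a \<notin> insert ''i'' (writes ?c) \<Longrightarrow> t a = ?s a" "?I i t"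
    have n: "t ''n'' 0 = n" using assms by (simp add: i(3))
    obtain e where e: "e \<le> i" "t ''p'' 0 = 2 ^ e" "t ''L'' 0 = 40 * e" "e = 0 \<or> 2 ^ e \<le> 2 * n"
      "2 ^ e \<le> n \<longrightarrow> e = i"
      using i(4) by blast
    show "tr ?c t 4 (?I (Suc i))"
    proof (rule tr_straight)
      show "?I (Suc i) (exec ?c t)"
      proof (cases "2 ^ e \<le> n")
        case True
        then have "exec ?c t ''p'' 0 = 2 ^ Suc e" "exec ?c t ''L'' 0 = 40 * Suc e" using e n by simp_all
        then show ?thesis using True e by (intro exI[of _ "Suc e"]) simp
      next
        case False
        then have x: "exec ?c t = t" using e n by simp
        show ?thesis unfolding x using False e by (intro exI[of _ e]) simp
      qed
    qed simp_all
  qed (use assms in simp_all)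
  then show "tr (For ''i'' (scalar ''n'') ?c) ?s (n * 8 + 4)
    (\<lambda>t. \<exists>e\<le>n. t ''L'' 0 = 40 * e \<and> n < 2 ^ e \<and> (e = 0 \<or> 2 ^ e \<le> 2 * n))"
  proof (rule tr_conseq[OF _ order_refl])
    fix t assume "?I n t"
    then obtain e where e: "e \<le> n" "t ''L'' 0 = 40 * e" "e = 0 \<or> 2 ^ e \<le> 2 * n" "2 ^ e \<le> n \<longrightarrow> e = n"
      by blast
    have "n < 2 ^ e"
    proof (rule ccontr)
      assume a: "\<not> n < 2 ^ e"
      then have "e = n" using e(4) by simp
      then show False using a less_exp[of n] by simp
    qed
    then show "\<exists>e\<le>n. t ''L'' 0 = 40 * e \<and> n < 2 ^ e \<and> (e = 0 \<or> 2 ^ e \<le> 2 * n)"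
      using e by blast
  qed
qed simp_all

text \<open>Every cost between 1 and \<open>n * n\<close> divides \<open>fact (n * n)\<close>, so
  its \<open>L\<close>-th power divides \<open>B\<close>, and the weights become exact integers.
  Multiplication by \<open>k + 1\<close> is repeated addition, again to keep writes linear.\<close>

definition base_prog :: prog where
  "base_prog = set_scalar ''B'' (Const 1) ;;
     For ''i'' (scalar ''L'')
       (For ''k'' nn_expr
          (set_scalar ''t'' (Const 0) ;;
           For ''j'' (scalar ''k'' \<oplus> Const 1) (set_scalar ''t'' (scalar ''t'' \<oplus> scalar ''B'')) ;;
           set_scalar ''B'' (scalar ''t'')))"

lemma writes_base [simp]: "writes base_prog = {''B'', ''i'', ''k'', ''t'', ''j''}"
  by (auto simp: base_prog_def)

definition K_base :: "nat \<Rightarrow> nat" where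
  "K_base n = 40 * n * (n * n * (n * n * 5 + 16) + 8) + 10"

lemma tr_base:
  assumes n: "s ''n'' 0 = n" and L: "s ''L'' 0 = L" "L \<le> 40 * n"
  shows "tr base_prog s (K_base n) (\<lambda>t. t ''B'' 0 = fact (n * n) ^ L)"
  unfolding base_prog_def
proof (rule tr_exec_then[where ?K2.0 = "40 * n * (n * n * (n * n * 5 + 16) + 8) + 4"])
  let ?s = "exec (set_scalar ''B'' (Const 1)) s"
  let ?c2 = "For ''j'' (scalar ''k'' \<oplus> Const 1) (set_scalar ''t'' (scalar ''t'' \<oplus> scalar ''B''))"
  let ?c1 = "set_scalar ''t'' (Const 0) ;; ?c2 ;; set_scalar ''B'' (scalar ''t'')"
  let ?c = "For ''k'' nn_expr ?c1"
  let ?I = "\<lambda>(i::nat) (t::state). t ''B'' 0 = fact (n * n) ^ i"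
  show "tr (For ''i'' (scalar ''L'') ?c) ?s (40 * n * (n * n * (n * n * 5 + 16) + 8) + 4) (?I L)"
  proof (rule tr_For'[where I = ?I and K = "n * n * (n * n * 5 + 16) + 4"])
    fix i t assume i: "i < L" "t ''i'' 0 = i" "\<And>a. a \<notin> insert ''i'' (writes ?c) \<Longrightarrow> t a = ?s a" "?I i t"
    let ?J = "\<lambda>(k::nat) (t::state). t ''B'' 0 = fact (n * n) ^ i * fact k"
    have "tr ?c t (n * n * (n * n * 5 + 16) + 4) (?J (n * n))"
    proof (rule tr_For'[where I = ?J and K = "n * n * 5 + 12"])
      fix k u assume k: "k < n * n" "u ''k'' 0 = k" "\<And>a. a \<notin> insert ''k'' (writes ?c1) \<Longrightarrow> u a = t a" "?J k u"
      let ?u = "exec (set_scalar ''t'' (Const 0)) u"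
      show "tr ?c1 u (n * n * 5 + 12) (?J (Suc k))"
      proof (rule tr_exec_then[where ?K2.0 = "n * n * 5 + 10"])
        let ?H = "\<lambda>(j::nat) (v::state). v ''t'' 0 = j * (fact (n * n) ^ i * fact k)"
        show "tr (?c2 ;; set_scalar ''B'' (scalar ''t'')) ?u (n * n * 5 + 10) (?J (Suc k))"
        proof (rule tr_then[where ?Q1.0 = "?H (Suc k)" and ?K1.0 = "n * n * 5 + 4" and ?K2.0 = 1])
          show "tr ?c2 ?u (n * n * 5 + 4) (?H (Suc k))"
          proof (rule tr_For'[where I = ?H and K = 1])
            fix j v assume j: "j < Suc k"
              "\<And>a. a \<notin> insert ''j'' (writes (set_scalar ''t'' (scalar ''t'' \<oplus> scalar ''B''))) \<Longrightarrow> v a = ?u a" "?H j v"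
            have "v ''B'' 0 = fact (n * n) ^ i * fact k" using k(4) by (simp add: j(2))
            then show "tr (set_scalar ''t'' (scalar ''t'' \<oplus> scalar ''B'')) v 1 (?H (Suc j))"
              using j(3) by (intro tr_straight) simp_all
          next
            have "Suc k * 5 \<le> n * n * 5" using k(1) by (intro mult_le_mono1) simp
            then show "Suc k * (1 + 4) + 4 \<le> n * n * 5 + 4" by simp
          qed (use k(2) in simp_all)
        next
          fix v assume "?H (Suc k) v"
          then show "tr (set_scalar ''B'' (scalar ''t'')) v 1 (?J (Suc k))"
            by (intro tr_straight) (simp_all add: algebra_simps)
        qed simp
      qed simp_all
    qed (use i(4) n in \<open>simp_all add: i(3)\<close>)
    then show "tr ?c t (n * n * (n * n * 5 + 16) + 4) (?I (Suc i))"
      by (rule tr_conseq[OF _ order_refl]) (simp add: mult.commute)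
  next
    have "L * (n * n * (n * n * 5 + 16) + 4 + 4) \<le> 40 * n * (n * n * (n * n * 5 + 16) + 4 + 4)"
      using L(2) by (rule mult_le_mono1)
    then show "L * (n * n * (n * n * 5 + 16) + 4 + 4) + 4 \<le> 40 * n * (n * n * (n * n * 5 + 16) + 8) + 4"
      by (simp add: algebra_simps)
  qed (use L in simp_all)
qed (simp_all add: K_base_def)

section \<open>Sampling\<close>

text \<open>\<open>c + of_bool (c < 1)\<close> replaces the divisor 0 by 1. If the minimum is 0,
  only cuts of cost 0 keep a weight, namely \<open>B\<close>.\<close>

definition cut_weight :: "nat \<Rightarrow> nat \<Rightarrow> nat \<Rightarrow> nat \<Rightarrow> nat" where
  "cut_weight B L opt c = (if c \<le> 2 * opt then B div (c + of_bool (c < 1)) ^ L else 0)"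

text \<open>Dividing \<open>L\<close> times by the cost equals dividing once by its
  \<open>L\<close>-th power, also with rounding down, and avoids writing that power to
  memory.\<close>

definition weight_prog :: prog where
  "weight_prog = set_scalar ''W'' (Const 0) ;;
     For ''j'' (scalar ''cnt'')
       (Branch (Read ''cst'' (scalar ''j'') \<prec> scalar ''opt'' \<oplus> scalar ''opt'' \<oplus> Const 1)
          (set_scalar ''w'' (scalar ''B'') ;;
           For ''i'' (scalar ''L'')
             (set_scalar ''w'' (scalar ''w'' \<oslash>
                (Read ''cst'' (scalar ''j'') \<oplus> (Read ''cst'' (scalar ''j'') \<prec> Const 1)))) ;;
           (Write ''wt'' (scalar ''j'') (scalar ''w'') ;;
            set_scalar ''W'' (scalar ''W'' \<oplus> scalar ''w'')))
          (Write ''wt'' (scalar ''j'') (Const 0)))"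

lemma writes_weight [simp]: "writes weight_prog = {''W'', ''j'', ''w'', ''i'', ''wt''}"
  by (auto simp: weight_prog_def)

definition K_weight :: "nat \<Rightarrow> nat" where
  "K_weight n = (n * n) ^ 8 * (40 * n * 5 + 20) + 10"

lemma tr_weight:
  assumes N: "s ''cnt'' 0 = N" "N \<le> (n * n) ^ 8" and L: "s ''L'' 0 = L" "L \<le> 40 * n"
  shows "tr weight_prog s (K_weight n)
    (\<lambda>t. (\<forall>j<N. t ''wt'' j = cut_weight (s ''B'' 0) L (s ''opt'' 0) (s ''cst'' j)) \<and>
      t ''W'' 0 = (\<Sum>j<N. cut_weight (s ''B'' 0) L (s ''opt'' 0) (s ''cst'' j)))"
  unfolding weight_prog_def
proof (rule tr_exec_then[where ?K2.0 = "(n * n) ^ 8 * (40 * n * 5 + 20) + 4"])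
  let ?s = "exec (set_scalar ''W'' (Const 0)) s"
  let ?d = "Read ''cst'' (scalar ''j'') \<oplus> (Read ''cst'' (scalar ''j'') \<prec> Const 1)"
  let ?c3 = "set_scalar ''w'' (scalar ''w'' \<oslash> ?d)"
  let ?c2 = "Write ''wt'' (scalar ''j'') (scalar ''w'') ;; set_scalar ''W'' (scalar ''W'' \<oplus> scalar ''w'')"
  let ?c1 = "set_scalar ''w'' (scalar ''B'') ;; For ''i'' (scalar ''L'') ?c3 ;; ?c2"
  let ?c = "Branch (Read ''cst'' (scalar ''j'') \<prec> scalar ''opt'' \<oplus> scalar ''opt'' \<oplus> Const 1)
    ?c1 (Write ''wt'' (scalar ''j'') (Const 0))"
  let ?f = "\<lambda>j. cut_weight (s ''B'' 0) L (s ''opt'' 0) (s ''cst'' j)"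
  let ?I = "\<lambda>(i::nat) (t::state). (\<forall>j<i. t ''wt'' j = ?f j) \<and> t ''W'' 0 = (\<Sum>j<i. ?f j)"
  show "tr (For ''j'' (scalar ''cnt'') ?c) ?s ((n * n) ^ 8 * (40 * n * 5 + 20) + 4) (?I N)"
  proof (rule tr_For'[where I = ?I and K = "40 * n * 5 + 16"])
    fix j t assume j: "j < N" "t ''j'' 0 = j" "\<And>a. a \<notin> insert ''j'' (writes ?c) \<Longrightarrow> t a = ?s a" "?I j t"
    have a: "t ''cst'' = s ''cst''" "t ''opt'' = s ''opt''" "t ''B'' = s ''B''" "t ''L'' = s ''L''"
      by (simp_all add: j(3))
    show "tr ?c t (40 * n * 5 + 16) (?I (Suc j))"
    proof (rule tr_Branch[where ?K1.0 = "40 * n * 5 + 15"])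
      assume "expr_val t (Read ''cst'' (scalar ''j'') \<prec> scalar ''opt'' \<oplus> scalar ''opt'' \<oplus> Const 1) \<noteq> 0"
      then have le: "s ''cst'' j \<le> 2 * s ''opt'' 0" using j(2) a by simp
      let ?t = "exec (set_scalar ''w'' (scalar ''B'')) t"
      let ?d' = "s ''cst'' j + of_bool (s ''cst'' j < 1)"
      let ?J = "\<lambda>(i::nat) (u::state). u ''w'' 0 = s ''B'' 0 div ?d' ^ i"
      show "tr ?c1 t (40 * n * 5 + 15) (?I (Suc j))"
      proof (rule tr_exec_then[where ?K2.0 = "40 * n * 5 + 10"])
        show "tr (For ''i'' (scalar ''L'') ?c3 ;; ?c2) ?t (40 * n * 5 + 10) (?I (Suc j))"
        proof (rule tr_then[where ?Q1.0 = "?J L" and ?K1.0 = "40 * n * 5 + 4" and ?K2.0 = 3])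
          show "tr (For ''i'' (scalar ''L'') ?c3) ?t (40 * n * 5 + 4) (?J L)"
          proof (rule tr_For'[where I = ?J and K = 1])
            fix i u assume i: "i < L" "u ''i'' 0 = i" "\<And>a. a \<notin> insert ''i'' (writes ?c3) \<Longrightarrow> u a = ?t a" "?J i u"
            have "u ''j'' 0 = j" "u ''cst'' = s ''cst''" using j(2) a by (simp_all add: i(3))
            then have "expr_val u ?d = ?d'" by simp
            then have "exec ?c3 u ''w'' 0 = s ''B'' 0 div ?d' ^ i div ?d'" using i(4) by simp
            also have "\<dots> = s ''B'' 0 div ?d' ^ Suc i"
              by (simp only: div_mult2_eq[symmetric] power_Suc2)
            finally show "tr ?c3 u 1 (?J (Suc i))" by (intro tr_straight) simp_all
          next
            have "L * 5 \<le> 40 * n * 5" using L(2) by (rule mult_le_mono1)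
            then show "L * (1 + 4) + 4 \<le> 40 * n * 5 + 4" by simp
          qed (use L a in simp_all)
        next
          fix u assume u: "\<And>a. a \<notin> writes (For ''i'' (scalar ''L'') ?c3) \<Longrightarrow> u a = ?t a" "?J L u"
          have w: "u ''w'' 0 = ?f j" using u(2) le by (simp add: cut_weight_def)
          have b: "u ''j'' 0 = j" "u ''wt'' = t ''wt''" "u ''W'' = t ''W''" using j(2) by (simp_all add: u(1))
          show "tr ?c2 u 3 (?I (Suc j))"
            by (rule tr_straight) (use w b j(4) in \<open>simp_all add: less_Suc_eq\<close>)
        qed simp
      qed simp_all
    next
      assume "expr_val t (Read ''cst'' (scalar ''j'') \<prec> scalar ''opt'' \<oplus> scalar ''opt'' \<oplus> Const 1) = 0"
      then have "?f j = 0" using j(2) a by (simp add: cut_weight_def split: if_splits)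
      then show "tr (Write ''wt'' (scalar ''j'') (Const 0)) t (40 * n * 5 + 15) (?I (Suc j))"
        by (intro tr_straight) (use j(2,4) in \<open>simp_all add: less_Suc_eq\<close>)
    qed simp
  next
    have "N * (40 * n * 5 + 16 + 4) \<le> (n * n) ^ 8 * (40 * n * 5 + 16 + 4)" using N(2) by (rule mult_le_mono1)
    then show "N * (40 * n * 5 + 16 + 4) + 4 \<le> (n * n) ^ 8 * (40 * n * 5 + 20) + 4"
      by (simp add: algebra_simps)
  qed (use N in simp_all)
qed (simp_all add: K_weight_def)

section \<open>Uniform integers from fair coins\<close>

lemma uniform_split:
  "pmf_of_set {..<(2::nat) ^ Suc j} =
     bind_pmf (bernoulli_pmf (1/2)) (\<lambda>b. map_pmf (\<lambda>y. of_bool b * 2 ^ j + y) (pmf_of_set {..<2 ^ j}))"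
    (is "_ = bind_pmf _ ?f")
proof (rule pmf_eqI)
  fix x :: nat
  have f: "pmf (?f b) x = indicator {of_bool b * 2 ^ j..<of_bool b * 2 ^ j + 2 ^ j} x / 2 ^ j" for b
  proof -
    have im: "(\<lambda>y. of_bool b * 2 ^ j + y) ` {..<2 ^ j} = {of_bool b * 2 ^ j..<of_bool b * 2 ^ j + (2::nat) ^ j}"
      by (simp add: lessThan_atLeast0 add.commute)
    have "?f b = pmf_of_set ((\<lambda>y. of_bool b * 2 ^ j + y) ` {..<2 ^ j})"
      by (rule map_pmf_of_set_inj) (auto simp: lessThan_empty_iff)
    then show ?thesis unfolding im by simp
  qed
  have "pmf (bind_pmf (bernoulli_pmf (1/2)) h) x = (pmf (h True) x + pmf (h False) x) / 2" for h
    by (simp add: pmf_bind)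
  then have "pmf (bind_pmf (bernoulli_pmf (1/2)) ?f) x = (pmf (?f True) x + pmf (?f False) x) / 2" .
  also have "\<dots> = pmf (pmf_of_set {..<(2::nat) ^ Suc j}) x"
    unfolding f by (auto simp: indicator_def lessThan_empty_iff)
  finally show "pmf (pmf_of_set {..<(2::nat) ^ Suc j}) x = pmf (bind_pmf (bernoulli_pmf (1/2)) ?f) x" ..
qed

definition toss_prog :: prog where
  "toss_prog = (Coin ''b'' (Const 0) ;;
      (set_scalar ''r'' (scalar ''r'' \<oplus> scalar ''r'' \<oplus> scalar ''b'') ;;
       set_scalar ''q'' (scalar ''q'' \<oplus> scalar ''q'')))"

definition coins_prog :: prog where
  "coins_prog = (set_scalar ''q'' (Const 1) ;; set_scalar ''r'' (Const 0)) ;;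
     For ''t'' (Const 2 \<otimes> scalar ''L'' \<otimes> nn_expr \<otimes> nn_expr) toss_prog"

lemma fin_Seq_map:
  assumes "fin c1 s K (map_pmf f p)" "straight c2"
  shows "fin (Seq c1 c2) s (Suc (K + steps c2)) (map_pmf (\<lambda>x. exec c2 (f x)) p)"
proof -
  have "fin (Seq c1 c2) s (Suc (K + steps c2)) (bind_pmf (map_pmf f p) (\<lambda>s'. return_pmf (exec c2 s')))"
    using fin_straight[OF assms(2)] by (intro fin_Seq[OF assms(1)])
  then show ?thesis unfolding bind_map_pmf unfolding map_pmf_def .
qed

text \<open>\<open>tr\<close> covers deterministic outcomes only, so this loop is treated with
  \<open>fin\<close> directly. The accumulator \<open>r\<close> is generalized: the remaining
  \<open>j\<close> tosses append \<open>j\<close> uniform binary digits to it, and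
  \<open>uniform_split\<close> reads the next toss as the leading one of these digits.\<close>

lemma coins_loop:
  fixes b :: expr
  defines "W \<equiv> While (scalar ''t'' \<prec> b) (toss_prog ;; Write ''t'' (Const 0) (scalar ''t'' \<oplus> Const 1))"
  assumes b: "reads b \<inter> {''b'', ''r'', ''q'', ''t''} = {}"
  shows "s ''t'' 0 + j = m \<Longrightarrow> expr_val s b = m \<Longrightarrow> \<exists>\<mu>. fin W s (j * 10 + 1) \<mu> \<and>
    (\<forall>t\<in>set_pmf \<mu>. (\<forall>a. a \<notin> {''b'', ''r'', ''q'', ''t''} \<longrightarrow> t a = s a) \<and> t ''q'' 0 = s ''q'' 0 * 2 ^ j) \<and>
    map_pmf (\<lambda>t. t ''r'' 0) \<mu> = map_pmf (\<lambda>y. s ''r'' 0 * 2 ^ j + y) (pmf_of_set {..<2 ^ j})"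
proof (induction j arbitrary: s)
  case 0
  have "fin W s (Suc 0) (return_pmf s)"
    by (rule fin_step[OF _ fin_Skip]) (use 0 in \<open>simp add: W_def cstep_def\<close>)
  moreover have "{..<(1::nat)} = {0}" by auto
  ultimately show ?case
    by (intro exI[of _ "return_pmf s"]) (simp add: pmf_of_set_singleton)
next
  case (Suc j)
  let ?st = "set_scalar ''r'' (scalar ''r'' \<oplus> scalar ''r'' \<oplus> scalar ''b'') ;;
       set_scalar ''q'' (scalar ''q'' \<oplus> scalar ''q'')"
  let ?inc = "Write ''t'' (Const 0) (scalar ''t'' \<oplus> Const 1)"
  let ?u = "\<lambda>x. update s ''b'' 0 (of_bool x)"
  define S where "S = (\<lambda>x. exec ?inc (exec ?st (?u x)))"
  have "fin (Coin ''b'' (Const 0)) s (Suc 0) (map_pmf ?u (bernoulli_pmf (1/2)))"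
    using fin_Coin[of "''b''" "Const 0" s] by simp
  then have "fin toss_prog s (Suc (Suc 0 + steps ?st)) (map_pmf (\<lambda>x. exec ?st (?u x)) (bernoulli_pmf (1/2)))"
    unfolding toss_prog_def by (rule fin_Seq_map) simp
  then have t: "fin (toss_prog ;; ?inc) s (Suc (Suc (Suc 0 + steps ?st) + steps ?inc)) (map_pmf S (bernoulli_pmf (1/2)))"
    unfolding S_def by (rule fin_Seq_map) simp
  have "Suc (Suc (Suc 0 + steps ?st) + steps ?inc) = 7" by simp
  from t[unfolded this] have toss: "fin (toss_prog ;; ?inc) s 7 (map_pmf S (bernoulli_pmf (1/2)))" .
  have S: "S x ''t'' 0 = Suc (s ''t'' 0)" "S x ''q'' 0 = 2 * s ''q'' 0" "S x ''r'' 0 = 2 * s ''r'' 0 + of_bool x" for x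
    by (simp_all add: S_def)
  have S_frame: "S x a = s a" if "a \<notin> {''b'', ''r'', ''q'', ''t''}" for x a
    using that by (simp add: S_def)
  have S_b: "expr_val (S x) b = m" for x
  proof -
    have "expr_val (S x) b = expr_val s b"
    proof (rule expr_val_cong)
      fix a assume "a \<in> reads b"
      then have "a \<notin> {''b'', ''r'', ''q'', ''t''}" using b by blast
      then show "S x a = s a" by (rule S_frame)
    qed
    then show ?thesis using Suc.prems(2) by (rule trans)
  qed
  define P where "P = (\<lambda>x \<mu>. fin W (S x) (j * 10 + 1) \<mu> \<and>
    (\<forall>t\<in>set_pmf \<mu>. (\<forall>a. a \<notin> {''b'', ''r'', ''q'', ''t''} \<longrightarrow> t a = S x a) \<and> t ''q'' 0 = S x ''q'' 0 * 2 ^ j) \<and>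
    map_pmf (\<lambda>t. t ''r'' 0) \<mu> = map_pmf (\<lambda>y. S x ''r'' 0 * 2 ^ j + y) (pmf_of_set {..<2 ^ j}))"
  have "\<exists>\<mu>. P x \<mu>" for x
    unfolding P_def
  proof (rule Suc.IH[OF _ S_b])
    show "S x ''t'' 0 + j = m" unfolding S(1) using Suc.prems(1) by linarith
  qed
  \<comment> \<open>One distribution of final states for each value of the next coin.\<close>
  then obtain \<nu> where P: "P x (\<nu> x)" for x by metis
  have \<nu>1: "fin W (S x) (j * 10 + 1) (\<nu> x)" for x
    using P[of x] unfolding P_def by (rule conjunct1)
  have \<nu>2: "map_pmf (\<lambda>t. t ''r'' 0) (\<nu> x) = map_pmf (\<lambda>y. S x ''r'' 0 * 2 ^ j + y) (pmf_of_set {..<2 ^ j})" for x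
    using P[of x] unfolding P_def by (elim conjE)
  note \<nu> = \<nu>1 \<nu>2
  have \<nu>_set: "t a = S x a" "t ''q'' 0 = S x ''q'' 0 * 2 ^ j"
    if "t \<in> set_pmf (\<nu> x)" "a \<notin> {''b'', ''r'', ''q'', ''t''}" for x t a
    using P[of x] that unfolding P_def by simp_all
  let ?\<mu> = "bind_pmf (bernoulli_pmf (1/2)) \<nu>"
  have seq: "crun (Suc (7 + (j * 10 + 1))) (Seq (toss_prog ;; ?inc) W, s) =
      bind_pmf (crun 7 (toss_prog ;; ?inc, s)) (\<lambda>y. crun (j * 10 + 1) (W, snd y))"
  proof (rule crun_Seq)
    have c: "crun 7 (toss_prog ;; ?inc, s) = map_pmf (\<lambda>x. (Skip, S x)) (bernoulli_pmf (1/2))"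
      using toss by (simp only: fin_def pmf.map_comp o_def)
    show "fst y = Skip" if "y \<in> set_pmf (crun 7 (toss_prog ;; ?inc, s))" for y
      using that unfolding c by auto
    show "fst z = Skip" if y: "y \<in> set_pmf (crun 7 (toss_prog ;; ?inc, s))"
      and z: "z \<in> set_pmf (crun (j * 10 + 1) (W, snd y))" for y z
    proof -
      obtain x where x: "snd y = S x" using y unfolding c set_map_pmf by auto
      show ?thesis using z unfolding x \<nu>(1)[unfolded fin_def] by auto
    qed
  qed
  have "fin (Seq (toss_prog ;; ?inc) W) s (Suc (7 + (j * 10 + 1))) ?\<mu>"
    unfolding fin_def seq toss[unfolded fin_def] bind_map_pmf snd_conv \<nu>(1)[unfolded fin_def] map_bind_pmf ..
  then have "fin W s (Suc (Suc (7 + (j * 10 + 1)))) ?\<mu>"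
    by (rule fin_step[rotated]) (use Suc.prems in \<open>simp add: W_def cstep_def\<close>)
  then have 1: "fin W s (Suc j * 10 + 1) ?\<mu>" by (rule fin_mono) simp
  have 2: "(\<forall>a. a \<notin> {''b'', ''r'', ''q'', ''t''} \<longrightarrow> t a = s a) \<and> t ''q'' 0 = s ''q'' 0 * 2 ^ Suc j"
    if t: "t \<in> set_pmf ?\<mu>" for t
  proof -
    obtain x where x: "t \<in> set_pmf (\<nu> x)" using t by auto
    have "t a = s a" if "a \<notin> {''b'', ''r'', ''q'', ''t''}" for a
      by (rule trans[OF \<nu>_set(1)[OF x that] S_frame[OF that]])
    moreover have "t ''q'' 0 = s ''q'' 0 * 2 ^ Suc j"
      using \<nu>_set(2)[OF x, of "''x''"] unfolding S(2) by simp
    ultimately show ?thesis by blast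
  qed
  have "map_pmf (\<lambda>t. t ''r'' 0) ?\<mu> =
      bind_pmf (bernoulli_pmf (1/2)) (\<lambda>x. map_pmf (\<lambda>y. (2 * s ''r'' 0 + of_bool x) * 2 ^ j + y) (pmf_of_set {..<2 ^ j}))"
    unfolding map_bind_pmf \<nu>(2) S(3) ..
  also have "\<dots> = map_pmf (\<lambda>y. s ''r'' 0 * 2 ^ Suc j + y) (pmf_of_set {..<2 ^ Suc j})"
  proof -
    have "(2 * r + x) * 2 ^ j + y = r * 2 ^ Suc j + (x * 2 ^ j + y)" for r x y :: nat
      by (simp add: algebra_simps)
    then show ?thesis unfolding uniform_split map_bind_pmf pmf.map_comp o_def by (simp only:)
  qed
  finally have 3: "map_pmf (\<lambda>t. t ''r'' 0) ?\<mu> =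
    map_pmf (\<lambda>y. s ''r'' 0 * 2 ^ Suc j + y) (pmf_of_set {..<2 ^ Suc j})" .
  show ?case
  proof (intro exI[of _ ?\<mu>] conjI ballI)
    show "fin W s (Suc j * 10 + 1) ?\<mu>" by (rule 1)
    show "\<forall>a. a \<notin> {''b'', ''r'', ''q'', ''t''} \<longrightarrow> t a = s a" if "t \<in> set_pmf ?\<mu>" for t
      using 2[OF that] by (rule conjunct1)
    show "t ''q'' 0 = s ''q'' 0 * 2 ^ Suc j" if "t \<in> set_pmf ?\<mu>" for t
      using 2[OF that] by (rule conjunct2)
    show "map_pmf (\<lambda>t. t ''r'' 0) ?\<mu> = map_pmf (\<lambda>y. s ''r'' 0 * 2 ^ Suc j + y) (pmf_of_set {..<2 ^ Suc j})"
      by (rule 3)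
  qed
qed

text \<open>Chosen so that \<open>2 ^ coin_count n L\<close> exceeds the total weight at least by
  the factor \<open>n ^ 4\<close>; see \<open>prepared_W_le\<close>.\<close>

definition coin_count :: "nat \<Rightarrow> nat \<Rightarrow> nat" where
  "coin_count n L = 2 * L * (n * n) * (n * n)"

definition K_coins :: "nat \<Rightarrow> nat" where
  "K_coins n = coin_count n (40 * n) * 10 + 10"

lemma fin_coins:
  assumes n: "s ''n'' 0 = n" and L: "s ''L'' 0 = L" "L \<le> 40 * n"
  shows "\<exists>\<mu>. fin coins_prog s (K_coins n) \<mu> \<and>
    (\<forall>t\<in>set_pmf \<mu>. (\<forall>a. a \<notin> {''b'', ''r'', ''q'', ''t''} \<longrightarrow> t a = s a) \<and> t ''q'' 0 = 2 ^ coin_count n L) \<and>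
    map_pmf (\<lambda>t. t ''r'' 0) \<mu> = pmf_of_set {..<2 ^ coin_count n L}"
proof -
  let ?b = "Const 2 \<otimes> scalar ''L'' \<otimes> nn_expr \<otimes> nn_expr" and ?R = "coin_count n L"
  let ?pre = "set_scalar ''q'' (Const 1) ;; set_scalar ''r'' (Const 0)"
  let ?W = "While (scalar ''t'' \<prec> ?b) (toss_prog ;; Write ''t'' (Const 0) (scalar ''t'' \<oplus> Const 1))"
  define s' where "s' = exec (Write ''t'' (Const 0) (Const 0)) (exec ?pre s)"
  have s: "s' ''t'' 0 = 0" "s' ''q'' 0 = 1" "s' ''r'' 0 = 0" by (simp_all add: s'_def)
  have fr: "s' a = s a" if "a \<notin> {''b'', ''r'', ''q'', ''t''}" for a using that by (simp add: s'_def)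
  have rb: "reads ?b \<inter> {''b'', ''r'', ''q'', ''t''} = {}" by simp
  have "s' ''t'' 0 + ?R = ?R" using s by simp
  moreover have "expr_val s' ?b = ?R" using n L by (simp add: coin_count_def s'_def)
  ultimately obtain \<mu> where \<mu>: "fin ?W s' (?R * 10 + 1) \<mu>"
    "\<forall>t\<in>set_pmf \<mu>. (\<forall>a. a \<notin> {''b'', ''r'', ''q'', ''t''} \<longrightarrow> t a = s' a) \<and> t ''q'' 0 = s' ''q'' 0 * 2 ^ ?R"
    "map_pmf (\<lambda>t. t ''r'' 0) \<mu> = map_pmf (\<lambda>y. s' ''r'' 0 * 2 ^ ?R + y) (pmf_of_set {..<2 ^ ?R})"
    using coins_loop[OF rb, of s' ?R ?R] by blast
  have "fin (For ''t'' ?b toss_prog) (exec ?pre s) (Suc (steps (Write ''t'' (Const 0) (Const 0)) + (?R * 10 + 1)))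
      (bind_pmf (return_pmf s') (\<lambda>_. \<mu>))"
    unfolding For_def s'_def
  proof (rule fin_Seq[OF fin_straight])
    show "fin ?W t (?R * 10 + 1) \<mu>"
      if "t \<in> set_pmf (return_pmf (exec (Write ''t'' (Const 0) (Const 0)) (exec ?pre s)))" for t
      using that \<mu>(1) unfolding s'_def set_return_pmf singleton_iff by (simp only:)
  qed (simp only: straight.simps)
  then have f: "fin (For ''t'' ?b toss_prog) (exec ?pre s) (Suc (1 + (?R * 10 + 1))) \<mu>"
    unfolding bind_return_pmf steps.simps .
  have "fin coins_prog s (Suc (steps ?pre + Suc (1 + (?R * 10 + 1)))) (bind_pmf (return_pmf (exec ?pre s)) (\<lambda>_. \<mu>))"
    unfolding coins_prog_def
  proof (rule fin_Seq[OF fin_straight])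
    show "fin (For ''t'' ?b toss_prog) t (Suc (1 + (?R * 10 + 1))) \<mu>"
      if "t \<in> set_pmf (return_pmf (exec ?pre s))" for t
      using that f unfolding set_return_pmf singleton_iff by (simp only:)
  qed simp
  then have "fin coins_prog s (Suc (steps ?pre + Suc (1 + (?R * 10 + 1)))) \<mu>"
    unfolding bind_return_pmf .
  then have 1: "fin coins_prog s (K_coins n) \<mu>"
  proof (rule fin_mono)
    have "?R \<le> coin_count n (40 * n)"
      unfolding coin_count_def using L(2) by (intro mult_le_mono order_refl)
    then show "Suc (steps ?pre + Suc (1 + (?R * 10 + 1))) \<le> K_coins n" by (simp add: K_coins_def)
  qed
  have 2: "\<forall>t\<in>set_pmf \<mu>. (\<forall>a. a \<notin> {''b'', ''r'', ''q'', ''t''} \<longrightarrow> t a = s a) \<and> t ''q'' 0 = 2 ^ ?R"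
  proof (intro ballI conjI allI impI)
    fix t assume t: "t \<in> set_pmf \<mu>"
    note m = \<mu>(2)[rule_format, OF t]
    show "t a = s a" if "a \<notin> {''b'', ''r'', ''q'', ''t''}" for a
      by (rule trans[OF conjunct1[OF m, rule_format, OF that] fr[OF that]])
    show "t ''q'' 0 = 2 ^ ?R" using conjunct2[OF m] unfolding s(2) by simp
  qed
  have 3: "map_pmf (\<lambda>t. t ''r'' 0) \<mu> = pmf_of_set {..<2 ^ ?R}"
    using \<mu>(3) unfolding s(3) by simp
  show ?thesis using 1 2 3 by (intro exI[of _ \<mu>] conjI)
qed

text \<open>The numbers \<open>r\<close> below \<open>q\<close> are cut into blocks of length
  \<open>q div W\<close>, so all block indices below \<open>W\<close> are equally likely, and
  subtracting weights in turn selects a cut with probability proportional to its weight. The few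
  \<open>r\<close> beyond the first \<open>W\<close> blocks leave the minimum cut \<open>sel\<close>
  in place. \<open>d\<close> records that the choice has been made.\<close>

definition pick_prog :: prog where
  "pick_prog = (set_scalar ''I'' (scalar ''r'' \<oslash> (scalar ''q'' \<oslash> scalar ''W'')) ;; set_scalar ''d'' (Const 0)) ;;
     For ''j'' (scalar ''cnt'')
       (Branch (scalar ''d'' \<prec> Const 1)
          (Branch (scalar ''I'' \<prec> Read ''wt'' (scalar ''j''))
             (set_scalar ''sel'' (Read ''lst'' (scalar ''j'')) ;; set_scalar ''d'' (Const 1))
             (set_scalar ''I'' (Binop Sub (scalar ''I'') (Read ''wt'' (scalar ''j'')))))
          Skip)"

lemma writes_pick [simp]: "writes pick_prog = {''I'', ''d'', ''j'', ''sel''}"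
  by (auto simp: pick_prog_def)

lemma tr_pick:
  fixes s :: state
  defines "x \<equiv> s ''r'' 0 div (s ''q'' 0 div s ''W'' 0)" and "cum \<equiv> \<lambda>j. \<Sum>i<j. s ''wt'' i"
  assumes N: "s ''cnt'' 0 = N" "N \<le> C"
  shows "tr pick_prog s (C * 9 + 10) (\<lambda>t. (\<exists>i<N. cum i \<le> x \<and> x < cum (Suc i) \<and> t ''sel'' 0 = s ''lst'' i) \<or>
    (cum N \<le> x \<and> t ''sel'' 0 = s ''sel'' 0))"
  unfolding pick_prog_def
proof (rule tr_exec_then[where ?K2.0 = "C * 9 + 4"])
  let ?s = "exec (set_scalar ''I'' (scalar ''r'' \<oslash> (scalar ''q'' \<oslash> scalar ''W'')) ;; set_scalar ''d'' (Const 0)) s"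
  let ?c = "Branch (scalar ''d'' \<prec> Const 1)
          (Branch (scalar ''I'' \<prec> Read ''wt'' (scalar ''j''))
             (set_scalar ''sel'' (Read ''lst'' (scalar ''j'')) ;; set_scalar ''d'' (Const 1))
             (set_scalar ''I'' (Binop Sub (scalar ''I'') (Read ''wt'' (scalar ''j'')))))
          Skip"
  let ?A = "\<lambda>j (t::state). \<exists>i<j. cum i \<le> x \<and> x < cum (Suc i) \<and> t ''sel'' 0 = s ''lst'' i"
  let ?B = "\<lambda>j (t::state). cum j \<le> x \<and> t ''sel'' 0 = s ''sel'' 0"
  let ?I = "\<lambda>(j::nat) (t::state). (t ''d'' 0 = 1 \<and> ?A j t) \<or> (t ''d'' 0 = 0 \<and> t ''I'' 0 = x - cum j \<and> ?B j t)"
  have "tr (For ''j'' (scalar ''cnt'') ?c) ?s (C * 9 + 4) (?I N)"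
  proof (rule tr_For'[where I = ?I and K = 5])
    fix j t assume j: "j < N" "t ''j'' 0 = j" "\<And>a. a \<notin> insert ''j'' (writes ?c) \<Longrightarrow> t a = ?s a" "?I j t"
    have a: "t ''wt'' = s ''wt''" "t ''lst'' = s ''lst''" by (simp_all add: j(3))
    have cS: "cum (Suc j) = cum j + s ''wt'' j" by (simp add: cum_def)
    show "tr ?c t 5 (?I (Suc j))"
    proof (rule tr_straight)
      show "?I (Suc j) (exec ?c t)"
      proof (cases "t ''d'' 0 = 1 \<and> ?A j t")
        case True
        then have e: "exec ?c t = t" by simp
        show ?thesis unfolding e using True less_SucI by blast
      next
        case False
        then have f: "t ''d'' 0 = 0" "t ''I'' 0 = x - cum j" "cum j \<le> x" "t ''sel'' 0 = s ''sel'' 0"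
          using j(4) by blast+
        show ?thesis
        proof (cases "x - cum j < s ''wt'' j")
          case True
          have e: "exec ?c t ''d'' 0 = 1" "exec ?c t ''sel'' 0 = s ''lst'' j"
            using f True a j(2) by simp_all
          have "x < cum (Suc j)" using True f(3) cS by linarith
          then show ?thesis unfolding e using f(3) by blast
        next
          case False
          have e: "exec ?c t ''d'' 0 = 0" "exec ?c t ''I'' 0 = x - cum j - s ''wt'' j"
            "exec ?c t ''sel'' 0 = s ''sel'' 0"
            using f False a j(2) by simp_all
          have "cum (Suc j) \<le> x" "x - cum j - s ''wt'' j = x - cum (Suc j)"
            using False f(3) cS by linarith+
          then show ?thesis unfolding e by simp
        qed
      qed
    qed simp_all
  next
    have "cum 0 = 0" by (simp add: cum_def)
    then show "?I 0 ?s" by (simp add: x_def)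
  qed (use N in simp_all)
  then show "tr (For ''j'' (scalar ''cnt'') ?c) ?s (C * 9 + 4) (\<lambda>t. ?A N t \<or> ?B N t)"
    by (rule tr_conseq[OF _ order_refl]) blast
qed simp_all

definition out_prog :: prog where
  "out_prog = For ''v'' (scalar ''n'')
     (Write ''out'' (scalar ''v'') (mod_expr (scalar ''sel'') (Const 2)) ;;
      set_scalar ''sel'' (scalar ''sel'' \<oslash> Const 2))"

lemma tr_out:
  assumes n: "s ''n'' 0 = n"
  shows "tr out_prog s (n * 7 + 4) (\<lambda>t. output_set n t = set_decode (s ''sel'' 0) \<inter> {..<n})"
proof -
  let ?c = "Write ''out'' (scalar ''v'') (mod_expr (scalar ''sel'') (Const 2)) ;;
      set_scalar ''sel'' (scalar ''sel'' \<oslash> Const 2)"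
  let ?z = "s ''sel'' 0"
  let ?I = "\<lambda>(i::nat) (t::state). t ''sel'' 0 = ?z div 2 ^ i \<and> (\<forall>v<i. t ''out'' v = ?z div 2 ^ v mod 2)"
  have "tr (For ''v'' (scalar ''n'') ?c) s (n * 7 + 4) (?I n)"
  proof (rule tr_For'[where I = ?I and K = 3])
    fix i t assume i: "t ''v'' 0 = i" "?I i t"
    have d: "?z div 2 ^ Suc i = ?z div 2 ^ i div 2" by (simp only: div_mult2_eq[symmetric] power_Suc2)
    show "tr ?c t 3 (?I (Suc i))"
      unfolding d by (rule tr_straight) (use i in \<open>simp_all add: less_Suc_eq\<close>)
  qed (use n in simp_all)
  then show ?thesis
    unfolding out_prog_def
  proof (rule tr_conseq[OF _ order_refl])
    fix t assume t: "?I n t"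
    have "v \<in> output_set n t \<longleftrightarrow> v \<in> set_decode ?z \<inter> {..<n}" for v
    proof (cases "v < n")
      case True
      then have "t ''out'' v = ?z div 2 ^ v mod 2" using t by blast
      then show ?thesis using True by (simp add: output_set_def set_decode_def mod2_eq_if)
    qed (simp add: output_set_def)
    then show "output_set n t = set_decode ?z \<inter> {..<n}" by blast
  qed
qed

section \<open>The complete program\<close>

definition prepare_prog :: prog where
  "prepare_prog = init_prog ;; enum_prog ;; min_prog ;; len_prog ;; base_prog ;; weight_prog"

definition select_prog :: prog where
  "select_prog = pick_prog ;; out_prog"

definition min_cut_prog :: prog where
  "min_cut_prog = prepare_prog ;; coins_prog ;; select_prog"

definition num_cands :: "nat \<Rightarrow> nat set set \<Rightarrow> nat" where
  "num_cands n E = card (candidates n E)"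

text \<open>All that the sampling phase relies on, in terms of the arrays;
  \<open>prepared_facts\<close> translates it to the graph. The alternative
  \<open>Suc (n * n)\<close> for \<open>opt\<close> is its initial value, excluded only once a
  minimum cut is known to be listed.\<close>

definition prepared :: "nat \<Rightarrow> nat set set \<Rightarrow> state \<Rightarrow> bool" where
  "prepared n E t \<longleftrightarrow> t ''n'' 0 = n \<and> found E (candidates n E) t \<and>
     (\<forall>j<num_cands n E. t ''opt'' 0 \<le> t ''cst'' j) \<and>
     (t ''opt'' 0 = Suc (n * n) \<or> (\<exists>j<num_cands n E. t ''cst'' j = t ''opt'' 0 \<and> t ''lst'' j = t ''sel'' 0)) \<and>
     (\<exists>e\<le>n. t ''L'' 0 = 40 * e \<and> n < 2 ^ e \<and> (e = 0 \<or> 2 ^ e \<le> 2 * n)) \<and>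
     (\<forall>j<num_cands n E. t ''wt'' j =
        cut_weight (fact (n * n) ^ t ''L'' 0) (t ''L'' 0) (t ''opt'' 0) (t ''cst'' j)) \<and>
     t ''W'' 0 = (\<Sum>j<num_cands n E. t ''wt'' j)"

definition K_prepare :: "nat \<Rightarrow> nat" where
  "K_prepare n = K_init n + (K_enum n + (((n * n) ^ 8 * 8 + 10) + ((n * 8 + 10) + (K_base n + K_weight n + 1) + 1) + 1) + 1) + 1"

lemma tr_prepare:
  assumes g: "graph n E"
  shows "tr prepare_prog (graph_input n E) (K_prepare n) (prepared n E)"
proof -
  let ?N = "num_cands n E" and ?C = "(n * n) ^ 8"
  define s where "s = graph_input n E"
  have inp: "input n E s" by (simp add: s_def input_def graph_input_def)
  have N: "?N \<le> ?C" unfolding num_cands_def by (rule card_candidates_le)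
  have s0: "s a = (\<lambda>_. 0)" if "a \<notin> {''n'', ''adj''}" for a
    using that by (auto simp: s_def graph_input_def)
  show ?thesis
    unfolding prepare_prog_def s_def[symmetric]
  proof (rule tr_then[OF tr_init[OF inp]])
    fix t1 assume t1: "\<And>a. a \<notin> writes init_prog \<Longrightarrow> t1 a = s a"
      "t1 ''m'' 0 = Suc (n * n) \<and> (\<forall>k<n * n. t1 ''load'' k = load n E 0 k)"
    have i1: "input n E t1" by (rule input_cong[OF _ _ inp]) (simp_all add: t1(1))
    have f1: "found E {} t1" by (simp add: found_def t1(1) s0 bij_betw_def)
    show "tr (enum_prog ;; min_prog ;; len_prog ;; base_prog ;; weight_prog) t1
      (K_enum n + ((?C * 8 + 10) + ((n * 8 + 10) + (K_base n + K_weight n + 1) + 1) + 1) + 1) (prepared n E)"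
    proof (rule tr_then[OF tr_enum[OF i1 g f1 conjunct2[OF t1(2)]]])
      fix t2 assume t2: "\<And>a. a \<notin> writes enum_prog \<Longrightarrow> t2 a = t1 a" "found E (candidates n E) t2"
      have cnt: "t2 ''cnt'' 0 = ?N" unfolding num_cands_def by (rule found_cnt[OF t2(2)])
      have n2: "t2 ''n'' 0 = n" using i1 by (simp add: t2(1) input_def)
      have m2: "t2 ''m'' 0 = Suc (n * n)" using t1(2) by (simp add: t2(1))
      show "tr (min_prog ;; len_prog ;; base_prog ;; weight_prog) t2
        ((?C * 8 + 10) + ((n * 8 + 10) + (K_base n + K_weight n + 1) + 1) + 1) (prepared n E)"
      proof (rule tr_then[OF tr_min[where s = t2, OF cnt N]])
        fix t3 assume t3: "\<And>a. a \<notin> writes min_prog \<Longrightarrow> t3 a = t2 a"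
          "(\<forall>j<?N. t3 ''opt'' 0 \<le> t2 ''cst'' j) \<and>
           (t3 ''opt'' 0 = t2 ''m'' 0 \<or> (\<exists>j<?N. t2 ''cst'' j = t3 ''opt'' 0 \<and> t2 ''lst'' j = t3 ''sel'' 0))"
        have n3: "t3 ''n'' 0 = n" using n2 by (simp add: t3(1))
        show "tr (len_prog ;; base_prog ;; weight_prog) t3
          ((n * 8 + 10) + (K_base n + K_weight n + 1) + 1) (prepared n E)"
        proof (rule tr_then[OF tr_len[where s = t3, OF n3]])
          fix t4 assume t4: "\<And>a. a \<notin> writes len_prog \<Longrightarrow> t4 a = t3 a"
            "\<exists>e\<le>n. t4 ''L'' 0 = 40 * e \<and> n < 2 ^ e \<and> (e = 0 \<or> 2 ^ e \<le> 2 * n)"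
          have n4: "t4 ''n'' 0 = n" using n3 by (simp add: t4(1))
          have L4: "t4 ''L'' 0 \<le> 40 * n" using t4(2) by auto
          show "tr (base_prog ;; weight_prog) t4 (K_base n + K_weight n + 1) (prepared n E)"
          proof (rule tr_then[OF tr_base[where s = t4, OF n4 refl L4]])
            fix t5 assume t5: "\<And>a. a \<notin> writes base_prog \<Longrightarrow> t5 a = t4 a"
              "t5 ''B'' 0 = fact (n * n) ^ t4 ''L'' 0"
            have c5: "t5 ''cnt'' 0 = ?N" using cnt by (simp add: t5(1) t4(1) t3(1))
            have L5: "t5 ''L'' 0 = t4 ''L'' 0" by (simp add: t5(1))
            show "tr weight_prog t5 (K_weight n) (prepared n E)"
            proof (rule tr_conseq[OF tr_weight[where s = t5, OF c5 N L5 L4] order_refl])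
              fix t assume t: "\<forall>a. a \<notin> writes weight_prog \<longrightarrow> t a = t5 a"
                "(\<forall>j<?N. t ''wt'' j = cut_weight (t5 ''B'' 0) (t4 ''L'' 0) (t5 ''opt'' 0) (t5 ''cst'' j)) \<and>
                 t ''W'' 0 = (\<Sum>j<?N. cut_weight (t5 ''B'' 0) (t4 ''L'' 0) (t5 ''opt'' 0) (t5 ''cst'' j))"
              have e: "t ''n'' = t2 ''n''" "t ''lst'' = t2 ''lst''" "t ''cnt'' = t2 ''cnt''"
                "t ''seen'' = t2 ''seen''" "t ''cst'' = t2 ''cst''" "t ''opt'' = t3 ''opt''"
                "t ''sel'' = t3 ''sel''" "t ''L'' = t4 ''L''" "t5 ''opt'' = t3 ''opt''" "t5 ''cst'' = t2 ''cst''"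
                by (simp_all add: t(1) t5(1) t4(1) t3(1))
              have "found E (candidates n E) t"
                using t2(2) found_cong[of t t2 E "candidates n E"] e by simp
              moreover have "t ''W'' 0 = (\<Sum>j<?N. t ''wt'' j)"
              proof -
                have "(\<Sum>j<?N. cut_weight (t5 ''B'' 0) (t4 ''L'' 0) (t5 ''opt'' 0) (t5 ''cst'' j)) = (\<Sum>j<?N. t ''wt'' j)"
                  by (rule sum.cong[OF refl]) (use t(2) in simp)
                then show ?thesis using t(2) by (simp only:)
              qed
              ultimately show "prepared n E t"
                unfolding prepared_def e using t(2) t3(2) t4(2) m2 n2 unfolding t5(2) e by auto
            qed
          qed simp
        qed simp
      qed simp
    qed simp
  qed (simp add: K_prepare_def)
qed

definition K_select :: "nat \<Rightarrow> nat" where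
  "K_select n = ((n * n) ^ 8 * 9 + 10) + (n * 7 + 4) + 1"

lemma tr_select:
  fixes s :: state
  defines "x \<equiv> s ''r'' 0 div (s ''q'' 0 div s ''W'' 0)" and "cum \<equiv> \<lambda>j. \<Sum>i<j. s ''wt'' i"
  assumes N: "s ''cnt'' 0 = N" "N \<le> (n * n) ^ 8" and n: "s ''n'' 0 = n"
  shows "tr select_prog s (K_select n) (\<lambda>t.
    (\<exists>i<N. cum i \<le> x \<and> x < cum (Suc i) \<and> output_set n t = set_decode (s ''lst'' i) \<inter> {..<n}) \<or>
    (cum N \<le> x \<and> output_set n t = set_decode (s ''sel'' 0) \<inter> {..<n}))"
  unfolding select_prog_def
proof (rule tr_then[OF tr_pick[where s = s, OF N]])
  fix t assume t: "\<And>a. a \<notin> writes pick_prog \<Longrightarrow> t a = s a"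
    "(\<exists>i<N. (\<Sum>j<i. s ''wt'' j) \<le> s ''r'' 0 div (s ''q'' 0 div s ''W'' 0) \<and>
        s ''r'' 0 div (s ''q'' 0 div s ''W'' 0) < (\<Sum>j<Suc i. s ''wt'' j) \<and> t ''sel'' 0 = s ''lst'' i) \<or>
     ((\<Sum>j<N. s ''wt'' j) \<le> s ''r'' 0 div (s ''q'' 0 div s ''W'' 0) \<and> t ''sel'' 0 = s ''sel'' 0)"
  have "t ''n'' 0 = n" using n by (simp add: t(1))
  note o = tr_out[where s = t, OF this]
  show "tr out_prog t (n * 7 + 4) (\<lambda>u.
    (\<exists>i<N. cum i \<le> x \<and> x < cum (Suc i) \<and> output_set n u = set_decode (s ''lst'' i) \<inter> {..<n}) \<or>
    (cum N \<le> x \<and> output_set n u = set_decode (s ''sel'' 0) \<inter> {..<n}))"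
  proof (rule tr_conseq[OF o order_refl])
    fix u assume u: "output_set n u = set_decode (t ''sel'' 0) \<inter> {..<n}"
    from t(2) show "(\<exists>i<N. cum i \<le> x \<and> x < cum (Suc i) \<and> output_set n u = set_decode (s ''lst'' i) \<inter> {..<n}) \<or>
      (cum N \<le> x \<and> output_set n u = set_decode (s ''sel'' 0) \<inter> {..<n})" (is ?thesis)
    proof (elim disjE exE conjE)
      fix i assume "i < N" "(\<Sum>j<i. s ''wt'' j) \<le> s ''r'' 0 div (s ''q'' 0 div s ''W'' 0)"
        "s ''r'' 0 div (s ''q'' 0 div s ''W'' 0) < (\<Sum>j<Suc i. s ''wt'' j)" "t ''sel'' 0 = s ''lst'' i"
      then show ?thesis unfolding cum_def x_def u by (intro disjI1 exI[of _ i] conjI) (simp_all only:)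
    next
      assume "(\<Sum>j<N. s ''wt'' j) \<le> s ''r'' 0 div (s ''q'' 0 div s ''W'' 0)" "t ''sel'' 0 = s ''sel'' 0"
      then show ?thesis unfolding cum_def x_def u by (intro disjI2 conjI) (simp_all only:)
    qed
  qed
qed (simp add: K_select_def)

definition K_min_cut :: "nat \<Rightarrow> nat" where
  "K_min_cut n = Suc (K_prepare n + Suc (K_coins n + K_select n))"

text \<open>The randomness is isolated: \<open>t\<close> is reached without chance, \<mu> is the law
  of the state after the coins, and \<open>out\<close> is the deterministic selection, so the output
  is governed by the uniform \<open>r\<close> alone.\<close>

lemma fin_min_cut:
  assumes g: "graph n E"
  shows "\<exists>t (\<mu>::state pmf) out. prepared n E t \<and> fin min_cut_prog (graph_input n E) (K_min_cut n) (map_pmf out \<mu>) \<and>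
    map_pmf (\<lambda>s. s ''r'' 0) \<mu> = pmf_of_set {..<2 ^ coin_count n (t ''L'' 0)} \<and>
    (\<forall>s\<in>set_pmf \<mu>. let x = s ''r'' 0 div (2 ^ coin_count n (t ''L'' 0) div t ''W'' 0); cum = \<lambda>j. \<Sum>i<j. t ''wt'' i in
      (\<exists>i<num_cands n E. cum i \<le> x \<and> x < cum (Suc i) \<and> output_set n (out s) = set_decode (t ''lst'' i) \<inter> {..<n}) \<or>
      (cum (num_cands n E) \<le> x \<and> output_set n (out s) = set_decode (t ''sel'' 0) \<inter> {..<n}))"
proof -
  let ?N = "num_cands n E"
  obtain t where t: "fin prepare_prog (graph_input n E) (K_prepare n) (return_pmf t)" "prepared n E t"
    using tr_prepare[OF g] unfolding tr_def by (elim exE conjE)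
  have n: "t ''n'' 0 = n" and f: "found E (candidates n E) t" using t(2) by (simp_all add: prepared_def)
  have L: "t ''L'' 0 \<le> 40 * n" using t(2) by (auto simp: prepared_def)
  have cnt: "t ''cnt'' 0 = ?N" unfolding num_cands_def by (rule found_cnt[OF f])
  have N: "?N \<le> (n * n) ^ 8" unfolding num_cands_def by (rule card_candidates_le)
  let ?R = "coin_count n (t ''L'' 0)"
  obtain \<mu> where \<mu>: "fin coins_prog t (K_coins n) \<mu>"
    "\<forall>s\<in>set_pmf \<mu>. (\<forall>a. a \<notin> {''b'', ''r'', ''q'', ''t''} \<longrightarrow> s a = t a) \<and> s ''q'' 0 = 2 ^ ?R"
    "map_pmf (\<lambda>s. s ''r'' 0) \<mu> = pmf_of_set {..<2 ^ ?R}"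
    using fin_coins[where s = t, OF n refl L] by blast
  define Q where "Q = (\<lambda>(s::state) (u::state). let x = s ''r'' 0 div (2 ^ ?R div t ''W'' 0); cum = \<lambda>j. \<Sum>i<j. t ''wt'' i in
      (\<exists>i<?N. cum i \<le> x \<and> x < cum (Suc i) \<and> output_set n u = set_decode (t ''lst'' i) \<inter> {..<n}) \<or>
      (cum ?N \<le> x \<and> output_set n u = set_decode (t ''sel'' 0) \<inter> {..<n}))"
  have "\<exists>u. fin select_prog s (K_select n) (return_pmf u) \<and> Q s u" if s: "s \<in> set_pmf \<mu>" for s
  proof -
    note m = \<mu>(2)[rule_format, OF s]
    have fr: "s a = t a" if "a \<notin> {''b'', ''r'', ''q'', ''t''}" for a
      by (rule conjunct1[OF m, rule_format, OF that])
    have e: "s ''cnt'' = t ''cnt''" "s ''n'' = t ''n''" "s ''W'' = t ''W''" "s ''wt'' = t ''wt''"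
      "s ''lst'' = t ''lst''" "s ''sel'' = t ''sel''"
      by (rule fr; simp)+
    have q: "s ''q'' 0 = 2 ^ ?R" using m by (rule conjunct2)
    have "s ''cnt'' 0 = ?N" "s ''n'' 0 = n" unfolding e by (rule cnt n)+
    note sel = tr_select[where s = s, OF this(1) N this(2)]
    have "tr select_prog s (K_select n) (Q s)"
      using sel unfolding Q_def Let_def e q .
    then obtain u where "fin select_prog s (K_select n) (return_pmf u)" "Q s u"
      unfolding tr_def by (elim exE conjE)
    then show ?thesis by (intro exI conjI)
  qed
  then obtain out where out: "\<And>s. s \<in> set_pmf \<mu> \<Longrightarrow> fin select_prog s (K_select n) (return_pmf (out s))"
    "\<And>s. s \<in> set_pmf \<mu> \<Longrightarrow> Q s (out s)"
    by metis
  have "fin (coins_prog ;; select_prog) t (Suc (K_coins n + K_select n)) (bind_pmf \<mu> (\<lambda>s. return_pmf (out s)))"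
    by (rule fin_Seq[OF \<mu>(1) out(1)])
  then have c: "fin (coins_prog ;; select_prog) t (Suc (K_coins n + K_select n)) (map_pmf out \<mu>)"
    unfolding map_pmf_def .
  have "fin min_cut_prog (graph_input n E) (K_min_cut n) (bind_pmf (return_pmf t) (\<lambda>_. map_pmf out \<mu>))"
    unfolding min_cut_prog_def K_min_cut_def
  proof (rule fin_Seq[OF t(1)])
    show "fin (coins_prog ;; select_prog) u (Suc (K_coins n + K_select n)) (map_pmf out \<mu>)"
      if "u \<in> set_pmf (return_pmf t)" for u
      using that c unfolding set_return_pmf singleton_iff by (simp only:)
  qed
  then have "fin min_cut_prog (graph_input n E) (K_min_cut n) (map_pmf out \<mu>)"
    unfolding bind_return_pmf .
  moreover have "\<forall>s\<in>set_pmf \<mu>. Q s (out s)"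
    using out(2) by (rule ballI)
  ultimately show ?thesis using t(2) \<mu>(3) unfolding Q_def
    by (intro exI[of _ t] exI[of _ \<mu>] exI[of _ out] conjI)
qed

section \<open>The algorithm\<close>

lemma linear_writes_min_cut: "linear_writes min_cut_prog"
  by (simp add: min_cut_prog_def prepare_prog_def select_prog_def coins_prog_def toss_prog_def
      pick_prog_def out_prog_def init_prog_def enum_prog_def min_prog_def len_prog_def base_prog_def
      weight_prog_def kruskal_prog_def kruskal_step_def merge_prog_def relabel_prog_def record_prog_def)

lemma poly_bounded_min_cut: "poly_bounded K_min_cut"
  unfolding K_min_cut_def[abs_def] K_prepare_def K_coins_def K_select_def K_init_def K_enum_def
    K_pass_def K_kruskal_def K_step_def K_record_def K_base_def K_weight_def coin_count_def
    kruskal_time_def Suc_eq_plus1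
  by (intro poly_bounded_intros)

lemma polynomial_time_min_cut: "polynomial_time min_cut_prog"
proof -
  define \<nu> where "\<nu> = (\<lambda>n E. SOME \<nu>. fin min_cut_prog (graph_input n E) (K_min_cut n) \<nu>)"
  have \<nu>: "fin min_cut_prog (graph_input n E) (K_min_cut n) (\<nu> n E)" if "graph n E" for n E
    unfolding \<nu>_def
  proof (rule someI_ex)
    show "\<exists>\<nu>. fin min_cut_prog (graph_input n E) (K_min_cut n) \<nu>"
      using fin_min_cut[OF that] by (elim exE conjE) (rule exI)
  qed
  show ?thesis
    by (rule polynomial_timeI[where \<mu> = \<nu>, OF \<nu> poly_bounded_min_cut linear_writes_min_cut])
qed

section \<open>The law of the output\<close>

definition log_len :: "nat \<Rightarrow> nat" where
  "log_len n = (LEAST e. n < 2 ^ e)"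

lemma log_len_unique:
  assumes "n < 2 ^ e" "e = 0 \<or> 2 ^ e \<le> 2 * n"
  shows "log_len n = e"
  unfolding log_len_def
proof (rule Least_equality)
  show "n < 2 ^ e" by (rule assms)
  fix y :: nat assume y: "n < 2 ^ y"
  show "e \<le> y"
  proof (rule ccontr)
    assume "\<not> e \<le> y"
    then have "(2::nat) ^ Suc y \<le> 2 ^ e" by (intro power_increasing) auto
    with assms(2) y \<open>\<not> e \<le> y\<close> show False by auto
  qed
qed

lemma log_len_bounds:
  assumes "2 \<le> n"
  shows "n < 2 ^ log_len n" "2 ^ log_len n \<le> 2 * n" "0 < log_len n"
proof -
  show *: "n < 2 ^ log_len n" unfolding log_len_def by (rule LeastI[of _ n]) simp
  then show pos: "0 < log_len n" using assms by (cases "log_len n") auto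
  have "\<not> n < 2 ^ (log_len n - 1)"
    unfolding log_len_def by (rule not_less_Least) (use pos in \<open>simp add: log_len_def\<close>)
  then show "2 ^ log_len n \<le> 2 * n" using pos by (cases "log_len n") auto
qed

lemma found_bij:
  assumes "found E D s"
  shows "bij_betw (\<lambda>j. set_decode (s ''lst'' j)) {..<s ''cnt'' 0} D"
proof -
  have f: "\<forall>S\<in>D. finite S" "bij_betw (s ''lst'') {..<s ''cnt'' 0} (set_encode ` D)"
    using assms by (simp_all add: found_def)
  have "bij_betw set_decode (set_encode ` D) D"
    by (rule bij_betw_byWitness[where f' = set_encode]) (use f(1) in auto)
  from bij_betw_trans[OF f(2) this] show ?thesis unfolding o_def .
qed

lemma found_decode: "found E D s \<Longrightarrow> j < s ''cnt'' 0 \<Longrightarrow> set_decode (s ''lst'' j) \<in> D"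
  by (drule found_bij, drule bij_betwE, erule bspec) simp

lemma found_cst:
  "found E D s \<Longrightarrow> j < s ''cnt'' 0 \<Longrightarrow> s ''cst'' j = cut_cost E (set_decode (s ''lst'' j))"
  by (simp add: found_def)

lemma found_index:
  assumes "found E D s" "S \<in> D"
  obtains j where "j < s ''cnt'' 0" "set_decode (s ''lst'' j) = S"
proof -
  have "S \<in> (\<lambda>j. set_decode (s ''lst'' j)) ` {..<s ''cnt'' 0}"
    unfolding bij_betw_imp_surj_on[OF found_bij[OF assms(1)]] by (rule assms(2))
  then obtain j where "j < s ''cnt'' 0" "set_decode (s ''lst'' j) = S" by auto
  then show ?thesis by (rule that)
qed

text \<open>The list contains a minimum cut in either case: by \<open>candidates_complete\<close> if
  \<open>OPT > 0\<close>, by \<open>candidates_zero\<close> otherwise. Hence the minimum over the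
  list is \<open>OPT\<close>.\<close>

lemma prepared_facts:
  assumes g: "graph n E" "2 \<le> n" and t: "prepared n E t"
  shows "found E (candidates n E) t" "t ''cnt'' 0 = num_cands n E"
    "t ''opt'' 0 = OPT n E" "set_decode (t ''sel'' 0) \<in> small_cuts n E"
    "t ''L'' 0 = 40 * log_len n"
proof -
  show f: "found E (candidates n E) t" using t by (simp add: prepared_def)
  show cnt: "t ''cnt'' 0 = num_cands n E" unfolding num_cands_def by (rule found_cnt[OF f])
  have dec: "is_cut n (set_decode (t ''lst'' j)) \<and> 0 \<notin> set_decode (t ''lst'' j) \<and>
      t ''cst'' j = cut_cost E (set_decode (t ''lst'' j))" if "j < num_cands n E" for j
    using candidates_is_cut[OF found_decode[OF f, of j]] found_cst[OF f, of j] that unfolding cnt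
    by simp
  have "\<exists>S\<in>candidates n E. cut_cost E S = OPT n E"
  proof (cases "OPT n E = 0")
    case True
    then show ?thesis using candidates_zero[OF g True] by metis
  next
    case False
    obtain S where S: "is_cut n S" "0 \<notin> S" "cut_cost E S = OPT n E" using min_cut_avoiding_0[OF g] .
    then have "S \<in> small_cuts n E" by (simp add: small_cuts_def)
    then show ?thesis using candidates_complete[OF g] False S(3) by auto
  qed
  then obtain S j where S: "cut_cost E S = OPT n E" "j < num_cands n E" "set_decode (t ''lst'' j) = S"
    using found_index[OF f] unfolding cnt by metis
  have le: "t ''opt'' 0 \<le> OPT n E" using t S dec[OF S(2)] unfolding prepared_def by metis
  \<comment> \<open>\<open>OPT < n\<close> excludes the initial value, so the stored minimum belongs
    to a listed cut.\<close>
  have "t ''opt'' 0 \<noteq> Suc (n * n)" using le OPT_less[OF g] le_square[of n] by linarith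
  then obtain i where i: "i < num_cands n E" "t ''cst'' i = t ''opt'' 0" "t ''lst'' i = t ''sel'' 0"
    using t unfolding prepared_def by blast
  show opt: "t ''opt'' 0 = OPT n E"
    using le OPT_le[of n "set_decode (t ''lst'' i)" E] dec[OF i(1)] i(2) by simp
  show "set_decode (t ''sel'' 0) \<in> small_cuts n E"
    using dec[OF i(1)] i(2) opt unfolding i(3)[symmetric] small_cuts_def by simp
  show "t ''L'' 0 = 40 * log_len n"
    using t log_len_unique[of n] unfolding prepared_def by metis
qed

text \<open>For \<open>OPT = 0\<close> only support and size of the weights are claimed. Exactness
  is stated for \<open>OPT > 0\<close>, where the costs are at least 1 and divide the
  factorial.\<close>

lemma prepared_wt:
  assumes g: "graph n E" "2 \<le> n" and t: "prepared n E t" and j: "j < num_cands n E"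
  defines "S \<equiv> set_decode (t ''lst'' j)" and "L \<equiv> 40 * log_len n"
  shows "0 < t ''wt'' j \<Longrightarrow> S \<in> small_cuts n E"
    "t ''wt'' j \<le> fact (n * n) ^ L"
    "0 < OPT n E \<Longrightarrow>
      real (t ''wt'' j) = (if S \<in> small_cuts n E then fact (n * n) ^ L * weight L E S else 0)"
proof -
  note p = prepared_facts[OF g t]
  have S: "is_cut n S" "0 \<notin> S" "t ''cst'' j = cut_cost E S"
    using candidates_is_cut[OF found_decode[OF p(1)], of j] found_cst[OF p(1), of j] j unfolding p(2) S_def by simp_all
  have w: "t ''wt'' j = cut_weight (fact (n * n) ^ L) L (OPT n E) (cut_cost E S)"
    using t j unfolding prepared_def p(3,5) L_def S(3)[symmetric] by blast
  show "S \<in> small_cuts n E" if "0 < t ''wt'' j"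
    using that S unfolding w cut_weight_def small_cuts_def by (auto split: if_splits)
  show "t ''wt'' j \<le> fact (n * n) ^ L"
    unfolding w cut_weight_def by (simp add: div_le_dividend)
  show "real (t ''wt'' j) = (if S \<in> small_cuts n E then fact (n * n) ^ L * weight L E S else 0)"
    if k: "0 < OPT n E"
  proof (cases "S \<in> small_cuts n E")
    case True
    have c: "1 \<le> cut_cost E S" "cut_cost E S \<le> n * n"
      using small_cuts_cost[OF True] k cut_cost_le[OF g(1)] by (simp, blast)
    have "cut_cost E S dvd fact (n * n)" using c by (rule dvd_fact)
    then have "cut_cost E S ^ L dvd fact (n * n) ^ L" by (rule dvd_power_same)
    moreover have "t ''wt'' j = fact (n * n) ^ L div cut_cost E S ^ L"
      using True c unfolding w cut_weight_def small_cuts_def by auto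
    ultimately show ?thesis using True by (simp add: real_of_nat_div weight_def)
  next
    case False
    then show ?thesis using S unfolding w cut_weight_def small_cuts_def by auto
  qed
qed

text \<open>Candidates outside \<open>small_cuts\<close> have weight 0, so the total over the list
  is the total over \<open>small_cuts\<close>; here the dependence on the enumeration
  disappears.\<close>

lemma prepared_W:
  assumes g: "graph n E" "2 \<le> n" and t: "prepared n E t" and k: "0 < OPT n E"
  shows "real (t ''W'' 0) =
    fact (n * n) ^ (40 * log_len n) * sum (weight (40 * log_len n) E) (small_cuts n E)"
proof -
  note p = prepared_facts[OF g t]
  let ?L = "40 * log_len n" and ?F = "small_cuts n E" and ?C = "candidates n E"
  let ?f = "\<lambda>S. if S \<in> ?F then fact (n * n) ^ ?L * weight ?L E S else (0::real)"
  have fin: "finite ?C" using p(1) by (simp add: found_def)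
  have "real (t ''W'' 0) = (\<Sum>j<num_cands n E. real (t ''wt'' j))"
    using t by (simp add: prepared_def)
  also have "\<dots> = (\<Sum>j<num_cands n E. ?f (set_decode (t ''lst'' j)))"
    by (rule sum.cong[OF refl], rule prepared_wt(3)[OF g t _ k]) simp
  also have "\<dots> = sum ?f ?C"
    using found_bij[OF p(1)] unfolding p(2) by (rule sum.reindex_bij_betw)
  also have "\<dots> = sum ?f ?F"
    by (rule sum.mono_neutral_right[OF fin candidates_complete[OF g k]]) simp
  also have "\<dots> = fact (n * n) ^ ?L * sum (weight ?L E) ?F"
    by (simp add: sum_distrib_left)
  finally show ?thesis .
qed

text \<open>With \<open>m = n * n\<close>, at most \<open>m ^ 8\<close> weights of size at most
  \<open>m ^ (m * L)\<close> give \<open>m ^ (10 + m * L)\<close> after the factor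
  \<open>m ^ 2\<close>; since \<open>m \<le> 2 ^ m\<close> and \<open>10 \<le> m * L\<close>, the
  exponent of 2 is at most \<open>2 * L * m * m\<close>.\<close>

lemma prepared_W_le:
  assumes g: "graph n E" "2 \<le> n" and t: "prepared n E t"
  shows "t ''W'' 0 * (n * n)\<^sup>2 \<le> 2 ^ coin_count n (t ''L'' 0)"
proof -
  let ?L = "40 * log_len n" and ?m = "n * n"
  have m: "4 \<le> ?m" using mult_le_mono[OF g(2) g(2)] by simp
  have L: "40 \<le> ?L" using log_len_bounds(3)[OF g(2)] by simp
  have "t ''W'' 0 = (\<Sum>j<num_cands n E. t ''wt'' j)" using t by (simp add: prepared_def)
  also have "\<dots> \<le> (\<Sum>j<num_cands n E. fact ?m ^ ?L)"
    by (rule sum_mono, rule prepared_wt(2)[OF g t]) simp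
  also have "\<dots> = num_cands n E * fact ?m ^ ?L" by simp
  also have "\<dots> \<le> ?m ^ 8 * (?m ^ ?m) ^ ?L"
  proof (rule mult_le_mono)
    show "num_cands n E \<le> ?m ^ 8" unfolding num_cands_def by (rule card_candidates_le)
    have "fact ?m \<le> ?m ^ ?m" using fact_le_power[of ?m, where 'a = nat] by simp
    then show "fact ?m ^ ?L \<le> (?m ^ ?m) ^ ?L" by (rule power_mono) simp
  qed
  finally have "t ''W'' 0 * ?m\<^sup>2 \<le> ?m ^ 8 * (?m ^ ?m) ^ ?L * ?m\<^sup>2" by (rule mult_le_mono1)
  also have "\<dots> = ?m ^ (10 + ?m * ?L)"
    unfolding power_mult[symmetric] power_add[symmetric] by (rule arg_cong[where f = "power ?m"]) simp
  also have "\<dots> \<le> (2 ^ ?m) ^ (10 + ?m * ?L)"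
    by (rule power_mono) (simp_all add: less_imp_le[OF less_exp])
  also have "\<dots> = 2 ^ (?m * (10 + ?m * ?L))" by (rule power_mult[symmetric])
  also have "\<dots> \<le> 2 ^ coin_count n (t ''L'' 0)"
  proof (rule power_increasing)
    have "10 \<le> ?m * ?L" using mult_le_mono[OF m L] by linarith
    then have "?m * (10 + ?m * ?L) \<le> ?m * (2 * (?m * ?L))" by (intro mult_le_mono2) simp
    also have "\<dots> = coin_count n ?L" unfolding coin_count_def by (simp only: ac_simps)
    finally show "?m * (10 + ?m * ?L) \<le> coin_count n (t ''L'' 0)"
      unfolding prepared_facts(5)[OF g t] .
  qed simp
  finally show ?thesis .
qed

lemma interval_index_unique:
  fixes f :: "nat \<Rightarrow> nat"
  assumes "(\<Sum>i<j. f i) \<le> x" "x < (\<Sum>i<Suc j. f i)" "(\<Sum>i<k. f i) \<le> x" "x < (\<Sum>i<Suc k. f i)"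
  shows "j = k"
proof -
  have mono: "(\<Sum>i<a. f i) \<le> (\<Sum>i<b. f i)" if "a \<le> b" for a b
    using that by (intro sum_mono2) auto
  show ?thesis
    using mono[of "Suc j" k] mono[of "Suc k" j] assms by (cases j k rule: linorder_cases) auto
qed

lemma scaled_interval_div:
  fixes q :: nat
  assumes "r \<in> {q * a..<q * b}"
  shows "a \<le> r div q" "r div q < b"
proof -
  have "0 < q" using assms by (cases q) auto
  then show "a \<le> r div q" "r div q < b"
    using assms by (simp_all add: less_eq_div_iff_mult_less_eq div_less_iff_less_mult mult.commute)
qed

lemma uniform_measure_interval:
  assumes "b \<le> (N::nat)" "a \<le> b"
  shows "measure (pmf_of_set {..<N}) {a..<b} = real (b - a) / real N"
proof (cases "N = 0")
  case False
  have "{..<N} \<inter> {a..<b} = {a..<b}" using assms by auto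
  then show ?thesis using False by (subst measure_pmf_of_set) auto
qed (use assms in simp)

text \<open>The origin of 40: \<open>(2/3) ^ 40 \<le> (1/2) ^ 23\<close>, so the decay
  \<open>1 / n ^ 23\<close> beats the number \<open>n ^ 16\<close> of candidates with
  \<open>1 / n ^ 7\<close> to spare.\<close>

lemma card_small_cuts_le:
  assumes g: "graph n E" "2 \<le> n" "0 < OPT n E"
  shows "real (card (small_cuts n E)) * (2/3) ^ (40 * log_len n) \<le> 1 / real n ^ 7"
proof -
  let ?e = "log_len n"
  have fin: "finite (candidates n E)" by (simp add: candidates_def)
  have "card (small_cuts n E) \<le> (n * n) ^ 8"
    using card_mono[OF fin candidates_complete[OF g]] card_candidates_le[of n E] by (rule order_trans)
  then have "real (card (small_cuts n E)) \<le> real ((n * n) ^ 8)" by (rule of_nat_mono)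
  also have "\<dots> = real n ^ 16" by (simp add: power_mult_distrib flip: power_add)
  finally have c: "real (card (small_cuts n E)) \<le> real n ^ 16" .
  have "((2/3) ^ 40 :: real) \<le> (1/2) ^ 23" by (simp add: field_simps)
  then have "((2/3) ^ 40 :: real) ^ ?e \<le> ((1/2) ^ 23) ^ ?e" by (rule power_mono) simp
  also have "\<dots> = 1 / (2 ^ ?e) ^ 23"
    by (simp only: power_one_over power_mult[symmetric] mult.commute)
  also have "\<dots> \<le> 1 / real n ^ 23"
  proof -
    have "real n \<le> 2 ^ ?e" using log_len_bounds(1)[OF g(2)]
      by (metis less_imp_le of_nat_le_iff of_nat_numeral of_nat_power)
    then have "real n ^ 23 \<le> (2 ^ ?e) ^ 23" by (rule power_mono) simp
    then show ?thesis using g(2) by (intro divide_left_mono) auto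
  qed
  finally have "(2/3 :: real) ^ (40 * ?e) \<le> 1 / real n ^ 23" unfolding power_mult .
  then have "real (card (small_cuts n E)) * (2/3) ^ (40 * ?e) \<le> real n ^ 16 * (1 / real n ^ 23)"
    using c by (intro mult_mono) auto
  also have "\<dots> = 1 / real n ^ 7"
  proof -
    have e: "real n ^ 23 = real n ^ 16 * real n ^ 7" by (simp flip: power_add)
    have "x * (1 / (x * y)) = 1 / y" if "x \<noteq> 0" for x y :: real using that by simp
    then show ?thesis unfolding e using g(2) by (metis of_nat_0_eq_iff power_not_zero not_numeral_le_zero)
  qed
  finally show ?thesis .
qed

text \<open>The cut at position \<open>j\<close> is output whenever \<open>r\<close> lies in its
  stretch of \<open>q * wt j\<close> numbers, where \<open>q\<close> now denotes the block length;
  the fallback can only add probability. Rounding loses fewer than \<open>W\<close> of the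
  \<open>2 ^ R\<close> draws, a fraction of at most \<open>1 / n ^ 4\<close>.\<close>

lemma approx_gibbs_min_cut:
  assumes g: "graph n E" "2 \<le> n"
  shows "approx_gibbs (40 * log_len n) (1 / real n ^ 4) (1 / real n ^ 7) n E (alg_dist min_cut_prog n E)"
proof -
  let ?N = "num_cands n E" and ?L = "40 * log_len n"
  obtain t and \<mu> :: "state pmf" and out where t: "prepared n E t"
    and fin: "fin min_cut_prog (graph_input n E) (K_min_cut n) (map_pmf out \<mu>)"
    and r: "map_pmf (\<lambda>s. s ''r'' 0) \<mu> = pmf_of_set {..<2 ^ coin_count n (t ''L'' 0)}"
    and Q: "\<forall>s\<in>set_pmf \<mu>. let x = s ''r'' 0 div (2 ^ coin_count n (t ''L'' 0) div t ''W'' 0);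
        cum = \<lambda>j. \<Sum>i<j. t ''wt'' i in
      (\<exists>i<?N. cum i \<le> x \<and> x < cum (Suc i) \<and> output_set n (out s) = set_decode (t ''lst'' i) \<inter> {..<n}) \<or>
      (cum ?N \<le> x \<and> output_set n (out s) = set_decode (t ''sel'' 0) \<inter> {..<n})"
    using fin_min_cut[OF g(1)] by (elim exE conjE)
  define R q cum where "R = coin_count n (t ''L'' 0)" and "q = 2 ^ R div t ''W'' 0"
    and "cum = (\<lambda>j. \<Sum>i<j. t ''wt'' i)"
  note p = prepared_facts[OF g t]
  have sub: "S \<inter> {..<n} = S" if "is_cut n S" for S using that by (auto simp: is_cut_def)
  have res: "(\<exists>i<?N. cum i \<le> s ''r'' 0 div q \<and> s ''r'' 0 div q < cum (Suc i) \<and>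
        output_set n (out s) = set_decode (t ''lst'' i)) \<or>
      (cum ?N \<le> s ''r'' 0 div q \<and> output_set n (out s) = set_decode (t ''sel'' 0))"
    if "s \<in> set_pmf \<mu>" for s
  proof -
    have "is_cut n (set_decode (t ''lst'' i))" if "i < ?N" for i
      using candidates_is_cut[OF found_decode[OF p(1)], of i] that p(2) by simp
    moreover have "is_cut n (set_decode (t ''sel'' 0))" using p(4) by (simp add: small_cuts_def)
    ultimately show ?thesis
      using Q[rule_format, OF that, unfolded Let_def, folded R_def, folded q_def] sub
      unfolding cum_def by metis
  qed
  have A: "alg_dist min_cut_prog n E = map_pmf (\<lambda>s. output_set n (out s)) \<mu>"
    using alg_dist_eq[OF fin polynomial_time_min_cut g(1)] by (simp add: map_pmf_comp)
  have W: "t ''W'' 0 = cum ?N" using t by (simp add: prepared_def cum_def)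
  have mono: "cum a \<le> cum b" if "a \<le> b" for a b
    unfolding cum_def using that by (intro sum_mono2) auto
  show ?thesis unfolding approx_gibbs_def
  proof (intro conjI impI ballI)
    show "set_pmf (alg_dist min_cut_prog n E) \<subseteq> small_cuts n E"
    proof
      fix S assume "S \<in> set_pmf (alg_dist min_cut_prog n E)"
      then obtain s where s: "s \<in> set_pmf \<mu>" "S = output_set n (out s)" unfolding A by auto
      show "S \<in> small_cuts n E"
      proof (cases "output_set n (out s) = set_decode (t ''sel'' 0)")
        case True
        then show ?thesis using p(4) s(2) by simp
      next
        case False
        then obtain i where i: "i < ?N" "cum i < cum (Suc i)" "S = set_decode (t ''lst'' i)"
          using res[OF s(1)] s(2) by (metis le_less_trans)
        then have "0 < t ''wt'' i" by (simp add: cum_def)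
        then show ?thesis using prepared_wt(1)[OF g t i(1)] i(3) by simp
      qed
    qed
  next
    assume "0 < OPT n E"
    then show "real (card (small_cuts n E)) * (2/3) ^ ?L \<le> 1 / real n ^ 7"
      by (rule card_small_cuts_le[OF g])
  next
    fix S assume k: "0 < OPT n E" and S: "S \<in> small_cuts n E"
    obtain j where j: "j < ?N" "set_decode (t ''lst'' j) = S"
      by (rule found_index[OF p(1) subsetD[OF candidates_complete[OF g k] S], unfolded p(2)])
    let ?I = "{q * cum j..<q * cum (Suc j)}"
    have Wpos: "0 < real (t ''W'' 0)"
      unfolding prepared_W[OF g t k] by (intro mult_pos_pos total_pos g k) simp
    have qW: "q * cum ?N \<le> 2 ^ R" unfolding q_def W by (rule div_times_less_eq_dividend)
    have out: "output_set n (out s) = S" if s: "s \<in> set_pmf \<mu>" "s ''r'' 0 \<in> ?I" for s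
    proof -
      note d = scaled_interval_div[OF s(2)]
      have "\<not> cum ?N \<le> s ''r'' 0 div q" using d(2) mono[OF Suc_leI[OF j(1)]] by linarith
      then obtain i where i: "cum i \<le> s ''r'' 0 div q" "s ''r'' 0 div q < cum (Suc i)"
        "output_set n (out s) = set_decode (t ''lst'' i)"
        using res[OF s(1)] by blast
      have "i = j"
        using interval_index_unique[OF i(1,2)[unfolded cum_def] d[unfolded cum_def]] .
      then show ?thesis using i(3) j(2) by simp
    qed
    have "real q * real (t ''wt'' j) / 2 ^ R = measure (pmf_of_set {..<2 ^ R}) ?I"
    proof -
      have "q * cum (Suc j) \<le> 2 ^ R" using qW mono[of "Suc j" ?N] j(1)
        by (meson Suc_leI le_trans mult_le_mono2)
      moreover have "q * cum (Suc j) - q * cum j = q * t ''wt'' j"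
        by (simp add: cum_def add_mult_distrib2)
      ultimately show ?thesis
        using uniform_measure_interval[of "q * cum (Suc j)" "2 ^ R" "q * cum j"] mono[of j "Suc j"]
        by simp
    qed
    also have "\<dots> = measure \<mu> ((\<lambda>s. s ''r'' 0) -` ?I)"
      unfolding R_def r[symmetric] by (rule measure_map_pmf)
    also have "\<dots> \<le> measure \<mu> ((\<lambda>s. output_set n (out s)) -` {S})"
      by (rule measure_pmf.finite_measure_mono_AE) (use out in \<open>auto simp: AE_measure_pmf_iff\<close>)
    also have "\<dots> = pmf (alg_dist min_cut_prog n E) S"
      unfolding A by (simp add: pmf_map)
    finally have low: "real q * real (t ''wt'' j) / 2 ^ R \<le> pmf (alg_dist min_cut_prog n E) S" .
    have gibbs: "gibbs ?L n E S = real (t ''wt'' j) / real (t ''W'' 0)"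
      using prepared_wt(3)[OF g t j(1) k] S j(2) prepared_W[OF g t k] by (simp add: gibbs_def)
    have "(1 - 1 / real n ^ 4) \<le> real q * real (t ''W'' 0) / 2 ^ R"
    proof -
      have "real (t ''W'' 0 * (n * n)\<^sup>2) \<le> real (2 ^ R)"
        using prepared_W_le[OF g t] unfolding R_def by (rule of_nat_mono)
      then have "real (t ''W'' 0) * real n ^ 4 \<le> 2 ^ R" by (simp add: power2_eq_square power4_eq_xxxx ac_simps)
      then have a: "real (t ''W'' 0) \<le> 2 ^ R / real n ^ 4" using g(2) by (simp add: field_simps)
      have "2 ^ R < q * t ''W'' 0 + t ''W'' 0"
        using Wpos div_mult_mod_eq[of "2 ^ R" "t ''W'' 0"] mod_less_divisor[of "t ''W'' 0" "2 ^ R"]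
        unfolding q_def by linarith
      then have "real (2 ^ R) < real (q * t ''W'' 0 + t ''W'' 0)" by (rule of_nat_less_iff[THEN iffD2])
      then have "2 ^ R < real q * real (t ''W'' 0) + real (t ''W'' 0)" by simp
      with a have "2 ^ R - 2 ^ R / real n ^ 4 \<le> real q * real (t ''W'' 0)" by linarith
      then have "(2 ^ R - 2 ^ R / real n ^ 4) / 2 ^ R \<le> real q * real (t ''W'' 0) / 2 ^ R"
        by (rule divide_right_mono) simp
      then show ?thesis by (simp add: diff_divide_distrib)
    qed
    then have "(1 - 1 / real n ^ 4) * gibbs ?L n E S \<le> real q * real (t ''W'' 0) / 2 ^ R * gibbs ?L n E S"
      by (rule mult_right_mono) simp
    also have "\<dots> = real q * real (t ''wt'' j) / 2 ^ R"
      unfolding gibbs using Wpos by simp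
    finally show "(1 - 1 / real n ^ 4) * gibbs ?L n E S \<le> pmf (alg_dist min_cut_prog n E) S"
      using low by linarith
  qed
qed

text \<open>\<open>2 ^ log_len n \<le> 2 * n \<le> n * n\<close> and \<open>ln 2 \<ge> 2/3\<close>
  give \<open>log_len n \<le> 3 * ln n\<close>.\<close>

lemma log_len_le_ln:
  assumes "2 \<le> n"
  shows "real (40 * log_len n) \<le> 120 * ln (real n)"
proof -
  have "(2::nat) ^ log_len n \<le> 2 * n" by (rule log_len_bounds(2)[OF assms])
  also have "\<dots> \<le> n\<^sup>2" using assms by (simp add: power2_eq_square)
  finally have "real (2 ^ log_len n) \<le> real (n\<^sup>2)" by (rule of_nat_mono)
  then have "ln ((2::real) ^ log_len n) \<le> ln (real n ^ 2)" using assms by (subst ln_le_cancel_iff) auto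
  then have "real (log_len n) * ln 2 \<le> 2 * ln (real n)" using assms by (simp add: ln_realpow)
  moreover have "real (log_len n) * (2/3) \<le> real (log_len n) * ln 2"
    by (rule mult_left_mono) (use ln2_ge_two_thirds in auto)
  ultimately show ?thesis by simp
qed

theorem mainTheorem6:
  shows "\<exists>g :: real \<Rightarrow> real. g \<in> O[at_right 0](\<lambda>\<epsilon>. 1 / \<epsilon>) \<and>
    (\<forall>\<epsilon>>0. \<exists>P. polynomial_time P \<and>
      (\<forall>n E. 2 \<le> n \<and> graph n E \<longrightarrow>
        (\<forall>S \<in> set_pmf (alg_dist P n E).
           is_cut n S \<and> real (cut_cost E S) \<le> (2 + \<epsilon>) * real (OPT n E)) \<and>
        (0 < OPT n E \<longrightarrow>
           avg_sensitivity (alg_dist P) n E \<le> real n powr (g \<epsilon> / real (OPT n E)))))"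
proof (rule exI[of _ "\<lambda>_. 1920"], intro conjI allI impI exI[of _ min_cut_prog] ballI)
  \<comment> \<open>On the interval from 0 to 1 the reference function exceeds 1, so a constant is
    well within the allowed growth.\<close>
  show "(\<lambda>_. 1920) \<in> O[at_right 0](\<lambda>\<epsilon>::real. 1 / \<epsilon>)"
  proof (rule bigoI[where c = 1920])
    have "eventually (\<lambda>\<epsilon>::real. \<epsilon> \<in> {0<..<1}) (at_right 0)"
      by (rule eventually_at_right_real) simp
    then show "\<forall>\<^sub>F \<epsilon>::real in at_right 0. norm (1920::real) \<le> 1920 * norm (1 / \<epsilon>)"
      by eventually_elim (simp add: field_simps)
  qed
  show "polynomial_time min_cut_prog" by (rule polynomial_time_min_cut)
  fix \<epsilon> :: real and n :: nat and E assume eps: "0 < \<epsilon>" and "2 \<le> n \<and> graph n E"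
  then have g: "graph n E" "2 \<le> n" by auto
  fix S assume "S \<in> set_pmf (alg_dist min_cut_prog n E)"
  then have S: "S \<in> small_cuts n E" using approx_gibbs_min_cut[OF g] by (auto simp: approx_gibbs_def)
  then show "is_cut n S" by (simp add: small_cuts_def)
  have "real (cut_cost E S) \<le> 2 * real (OPT n E)" using S by (simp add: small_cuts_def)
  also have "\<dots> \<le> (2 + \<epsilon>) * real (OPT n E)" using eps by (intro mult_right_mono) auto
  finally show "real (cut_cost E S) \<le> (2 + \<epsilon>) * real (OPT n E)" .
next
  fix \<epsilon> :: real and n :: nat and E assume "2 \<le> n \<and> graph n E" and k: "0 < OPT n E"
  then have g: "graph n E" "2 \<le> n" by auto
  have n7: "2 ^ 7 \<le> real n ^ 7" "2 ^ 3 \<le> real n ^ 3" "2 ^ 6 \<le> real n ^ 6"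
    using g(2) by (intro power_mono; simp)+
  have tau: "1 / real n ^ 7 \<le> 1 / 2" using n7(1) g(2) by (intro divide_left_mono) auto
  have red: "real n * (1 / real n ^ Suc k) = 1 / real n ^ k" for k using g(2) by simp
  have "1 / real n ^ 3 \<le> 1 / 2 ^ 3" "1 / real n ^ 6 \<le> 1 / 2 ^ 6"
    using n7 g(2) by (intro divide_left_mono; simp)+
  \<comment> \<open>The left side is \<open>2 / n ^ 3 + 3 / n ^ 6\<close>, at most
    \<open>2 / 8 + 3 / 64\<close>.\<close>
  then have small: "real n * (2 * (1 / real n ^ 4) + 3 * (1 / real n ^ 7)) \<le> 1"
    using red[of 3, simplified] red[of 6, simplified] by (simp add: distrib_left)
  show "avg_sensitivity (alg_dist min_cut_prog) n E \<le> real n powr (1920 / real (OPT n E))"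
  proof (rule avg_sensitivity_le_powr[where A = "alg_dist min_cut_prog" and L = "40 * log_len n"
        and err = "1 / real n ^ 4" and tau = "1 / real n ^ 7"])
    show "approx_gibbs (40 * log_len n) (1 / real n ^ 4) (1 / real n ^ 7) n E' (alg_dist min_cut_prog n E')"
      if "graph n E'" for E'
      by (rule approx_gibbs_min_cut[OF that g(2)])
  qed (use g k tau small log_len_le_ln[OF g(2)] in simp_all)
qed

end
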